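(* Let $n>1$. Let Assumption P (stated in the context) hold, and assume that all agents have the same initial wealth $w^i=w/n>0$ and the same utility function $u^i\equiv u$ satisfying Assumption U (stated in the context). Let $g(\cdot,c)$ be the inverse of $u_x(\cdot,c)$ and $h(\psi,c):=u_c(g(\psi,c),c)$ for $\psi,c>0$. Then there is a Nash equilibrium of the public good contribution game given by $$\hat C^i(t)=\sup_{0\le u\le t}\hat l(u)\vee0,\qquad\hat x^i(t)=g\big(\hat\lambda e^{\int_0^tr(s)ds}\psi_x(t),\hat C(t)\big),\qquad\hat C:=\sum_{j=1}^n\hat C^j,$$ for all $i=1,\dots,n$, if $\hat l$ is an optional, upper right-continuous process solving the stochastic backward equation $$E\Big[\int_\tau^Te^{-\int_0^tr(s)ds}h\Big(\hat\lambda e^{\int_0^tr(u)du}\psi_x(t),\ n\sup_{\tau\le u\le t}l(u)\Big)dt\,\Big|\,\mathcal{F}_\tau\Big]=\hat\lambda\psi_c(\tau)\mathbf{1}_{\{\tau<T\}}$$ for any stopping time $\tau\in[0,T]$, with $\hat l_T=0$ $P$-a.s., for a Lagrange multiplier $\hat\lambda>0$ such that $\Psi(\hat x^i,\hat C^i)=w/n$.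
   Context: Setting. Fix $0<T\le\infty$, a number $n$ of agents, and a filtered probability space $(\Omega,\mathcal{F},\{\mathcal{F}_t\}_{t\in[0,T]},P)$ satisfying the usual conditions, with expectation $E$. Let $w^i>0$ be initial wealths, $\psi_x,\psi_c$ strictly positive price processes, $r$ a discount rate process. For nonnegative processes set $$\Psi(x^i,C^i):=E\Big[\int_0^T\psi_x(t)x^i(t)\,dt+\int_0^T\psi_c(t)\,dC^i(t)\Big].$$ For a nondecreasing right-continuous $C$, $\int_0^T(\cdot)\,dC(t)$ denotes the Lebesgue–Stieltjes integral over $[0,T]$, including a possible point mass $C(0)$ at $t=0$ (convention $C(0-)=0$). The budget sets are $$\mathcal{B}_{w^i}:=\{(x^i,C^i):\Omega\times[0,T]\to\mathbb{R}_+^2\text{ optional}:\ C^i\text{ right-continuous, nondecreasing},\ C^i(0-)=0\ P\text{-a.s.},\ \Psi(x^i,C^i)\le w^i\}.$$ Payoffs: with $C:=\sum_{j}C^j$, $C^{-i}:=\sum_{j\ne i}C^j$ and $u^i:\mathbb{R}_+^2\to\mathbb{R}_+$, $$U^i(x^i,C^i;C^{-i}):=E\Big[\int_0^T e^{-\int_0^t r(s)ds}u^i(x^i(t),C(t))\,dt\Big].$$ Subscripts on $u$ denote partial derivatives. Public good contribution game. Let $V^i(C^{-i}):=\sup_{(x^i,C^i)\in\mathcal{B}_{w^i}}U^i(x^i,C^i;C^{-i})$. A tuple $(\hat x^1,\dots,\hat x^n,\hat C^1,\dots,\hat C^n)$ is a Nash equilibrium if for all $i$, $(\hat x^i,\hat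 C^i)\in\mathcal{B}_{w^i}$ and $U^i(\hat x^i,\hat C^i;\hat C^{-i})=V^i(\hat C^{-i})$. A process $l$ is upper right-continuous if a.s. $l(t)=\limsup_{s\downarrow t}l(s):=\lim_{s\downarrow t}\sup_{v\in[t,s)}l(v)$ for all $t\in[0,T)$. A solution $l$ of the backward equation is understood to have positive running suprema $\sup_{\tau\le u\le t}l(u)$ wherever they enter the integral (as $h(\psi,c)$ is defined for $c>0$). Assumption U. (i) Each $u^i$ is increasing and strictly concave on $\mathbb{R}_+^2$ and twice continuously differentiable on $\mathbb{R}_{++}^2$ with negative definite Hessian; moreover $\lim_{x\downarrow0}u^i_x(x,c)=+\infty$ and $\lim_{x\uparrow\infty}u^i_x(x,c)=0$ for any $c>0$. (ii) For each $i$ the family $e^{-\int_0^t r(\omega,s)ds}u^i(x^i(\omega,t),C(\omega,t))$, indexed by $((x^j,C^j))_{j}\in\prod_{j=1}^n\mathcal{B}_{w^j}$ with $C=\sum_jC^j$, is $P\otimes dt$-uniformly integrable. Assumption P. (i) $\psi_c=\{\psi_c(t),t\in[0,T]\}$ is adapted, right-continuous, $\psi_c(t)=e^{-\int_0^t r_c(s)ds}\mathcal{E}_c(t)$ a.s. for every $t\in[0,T]$, with $r_c$ a uniformly bounded, strictly positive process and $\mathcal{E}_c=\{\mathcal{E}_c(t),t\in[0,T]\}$ an exponential martingale (strictly positive, mean one); if $T=\infty$ then $\psi_c(T)=0$ a.s. (ii) $\psi_x$ is adapted, right-continuous, $\psi_x(t)=e^{-\int_0^t r_x(s)ds}\mathcal{E}_x(t)$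 a.s. for every $t\in[0,T]$, with $r_x$ uniformly bounded and strictly positive and $\mathcal{E}_x$ an exponential martingale. (iii) $r$ is optional, strictly positive and uniformly bounded. *)

theory Defs
  imports "HOL-Probability.Probability"
begin

section \<open>Time and filtered probability spaces\<close>

text \<open>
  The horizon \<open>T\<close> and stopping times are extended nonnegative reals. Processes are written
  \<open>X t \<omega>\<close> and are considered at the finite times of \<open>[0,T]\<close>, i.e. on \<open>[0,T]\<close> if \<open>T < \<infinity>\<close> and on
  \<open>[0,\<infinity>)\<close> if \<open>T = \<infinity>\<close>. The filtration also has a member at time \<open>\<infinity>\<close>, which is needed for stopping
  times with values in \<open>[0,\<infinity>]\<close>; its members after \<open>T\<close> play no role.
\<close>

type_synonym 'a process = "ennreal \<Rightarrow> 'a \<Rightarrow> real"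

definition time_set :: "ennreal \<Rightarrow> ennreal set" where
  "time_set T = {t. t \<le> T \<and> t < \<infinity>}"

text \<open>
  Lebesgue measure on \<open>[0,T]\<close>, carried over to the type of times. The underlying space is
  \<open>time_set T\<close>, so that values of an integrand after \<open>T\<close> cannot affect its measurability.
\<close>

definition dt :: "ennreal \<Rightarrow> ennreal measure" where
  "dt T = distr (restrict_space lborel {s. 0 \<le> s \<and> ennreal s \<le> T})
            (restrict_space borel (time_set T)) ennreal"

text \<open>
  Lebesgue--Stieltjes measure on \<open>[0,T]\<close> of a nondecreasing right-continuous path \<open>C\<close> with the
  convention \<open>C(0-) = 0\<close>, so that there is a point mass \<open>C 0\<close> at time \<open>0\<close>. For \<open>T = \<infinity>\<close> there is no
  mass at \<open>\<infinity>\<close>; this is immaterial for integrands that vanish there, as \<open>\<psi>\<^sub>c\<close> does.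
\<close>

definition stieltjes :: "ennreal \<Rightarrow> (ennreal \<Rightarrow> real) \<Rightarrow> ennreal measure" where
  "stieltjes T C =
     distr (interval_measure (\<lambda>t. if t < 0 then 0 else C (min (ennreal t) T)))
       (restrict_space borel (time_set T)) (\<lambda>t. min (ennreal t) T)"

locale usual_filtered_space = prob_space M + filtration "space M" F
  for M :: "'a measure" and F :: "ennreal \<Rightarrow> 'a measure" +
  fixes T :: ennreal
  assumes horizon_pos: "0 < T"
    and subalg: "\<And>t. subalgebra M (F t)"
    and complete: "\<And>A N. N \<in> null_sets M \<Longrightarrow> A \<subseteq> N \<Longrightarrow> A \<in> sets (F 0)"
    and right_cont: "\<And>t. t < T \<Longrightarrow> sets (F t) = (\<Inter>s\<in>{t<..T}. sets (F s))"

definition right_continuous_path :: "ennreal \<Rightarrow> (ennreal \<Rightarrow> real) \<Rightarrow> bool" where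
  "right_continuous_path T X \<longleftrightarrow> (\<forall>t\<in>time_set T. t < T \<longrightarrow> continuous (at_right t) X)"

definition adapted :: "(ennreal \<Rightarrow> 'a measure) \<Rightarrow> ennreal \<Rightarrow> 'a process \<Rightarrow> bool" where
  "adapted F T X \<longleftrightarrow> (\<forall>t\<in>time_set T. X t \<in> borel_measurable (F t))"

text \<open>
  The optional sigma-algebra, generated by the right-continuous adapted processes. (Under the
  usual conditions, additionally requiring left limits of the generators makes no difference.)
  As always under the usual conditions, indistinguishable processes are identified.
\<close>

definition optional_sigma ::
    "'a measure \<Rightarrow> (ennreal \<Rightarrow> 'a measure) \<Rightarrow> ennreal \<Rightarrow> ('a \<times> ennreal) measure" where
  "optional_sigma M F T = sigma (space M \<times> time_set T)
     {{(\<omega>, t) \<in> space M \<times> time_set T. Y t \<omega> \<in> B} | Y B.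
        B \<in> sets borel \<and> adapted F T Y \<and>
        (\<forall>\<omega>\<in>space M. right_continuous_path T (\<lambda>t. Y t \<omega>))}"

definition optional ::
    "'a measure \<Rightarrow> (ennreal \<Rightarrow> 'a measure) \<Rightarrow> ennreal \<Rightarrow> 'a process \<Rightarrow> bool" where
  "optional M F T X \<longleftrightarrow>
     (\<exists>Y. (\<lambda>(\<omega>, t). Y t \<omega>) \<in> borel_measurable (optional_sigma M F T) \<and>
          (AE \<omega> in M. \<forall>t\<in>time_set T. X t \<omega> = Y t \<omega>))"

definition upper_right_continuous :: "'a measure \<Rightarrow> ennreal \<Rightarrow> 'a process \<Rightarrow> bool" where
  "upper_right_continuous M T l \<longleftrightarrow>
     (AE \<omega> in M. \<forall>t<T.
        ((\<lambda>s. SUP v\<in>{t..<s}. ereal (l v \<omega>)) \<longlongrightarrow> ereal (l t \<omega>)) (at_right t))"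

definition exponential_martingale ::
    "'a measure \<Rightarrow> (ennreal \<Rightarrow> 'a measure) \<Rightarrow> ennreal \<Rightarrow> 'a process \<Rightarrow> bool" where
  "exponential_martingale M F T X \<longleftrightarrow>
     adapted F T X \<and>
     (\<forall>t\<in>time_set T. integrable M (X t)) \<and>
     (\<forall>s\<in>time_set T. \<forall>t\<in>time_set T. s \<le> t \<longrightarrow>
        (AE \<omega> in M. real_cond_exp M (F s) (X t) \<omega> = X s \<omega>)) \<and>
     (AE \<omega> in M. \<forall>t\<in>time_set T. 0 < X t \<omega>) \<and>
     (\<forall>t\<in>time_set T. integral\<^sup>L M (X t) = 1)"

definition strictly_positive_bounded :: "'a measure \<Rightarrow> ennreal \<Rightarrow> 'a process \<Rightarrow> bool" where
  "strictly_positive_bounded M T \<rho> \<longleftrightarrow>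
     (\<exists>K. AE \<omega> in M. \<forall>t\<in>time_set T. 0 < \<rho> t \<omega> \<and> \<rho> t \<omega> \<le> K)"

text \<open>The exponent \<open>\<integral>\<^sub>0\<^sup>t \<rho>(s) ds\<close>.\<close>

definition cum :: "'a process \<Rightarrow> 'a process" where
  "cum \<rho> t \<omega> = (\<integral>s. \<rho> s \<omega> \<partial>dt t)"

definition price_process ::
    "'a measure \<Rightarrow> (ennreal \<Rightarrow> 'a measure) \<Rightarrow> ennreal \<Rightarrow> 'a process \<Rightarrow> bool" where
  "price_process M F T \<psi> \<longleftrightarrow>
     adapted F T \<psi> \<and>
     (AE \<omega> in M. right_continuous_path T (\<lambda>t. \<psi> t \<omega>)) \<and>
     (AE \<omega> in M. \<forall>t\<in>time_set T. 0 < \<psi> t \<omega>) \<and>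
     (\<exists>\<rho> \<E>. (\<lambda>(\<omega>, t). \<rho> t \<omega>) \<in> borel_measurable (M \<Otimes>\<^sub>M dt T) \<and>
            strictly_positive_bounded M T \<rho> \<and>
            exponential_martingale M F T \<E> \<and>
            (\<forall>t\<in>time_set T. AE \<omega> in M. \<psi> t \<omega> = exp (- cum \<rho> t \<omega>) * \<E> t \<omega>))"

definition assumption_P ::
    "'a measure \<Rightarrow> (ennreal \<Rightarrow> 'a measure) \<Rightarrow> ennreal \<Rightarrow>
     'a process \<Rightarrow> 'a process \<Rightarrow> 'a process \<Rightarrow> bool" where
  "assumption_P M F T \<psi>\<^sub>x \<psi>\<^sub>c r \<longleftrightarrow>
     price_process M F T \<psi>\<^sub>c \<and> (T = \<infinity> \<longrightarrow> (AE \<omega> in M. \<psi>\<^sub>c T \<omega> = 0)) \<and>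
     price_process M F T \<psi>\<^sub>x \<and>
     optional M F T r \<and> strictly_positive_bounded M T r"

section \<open>Budgets, payoffs and equilibrium\<close>

definition cost ::
    "'a measure \<Rightarrow> ennreal \<Rightarrow> 'a process \<Rightarrow> 'a process \<Rightarrow> 'a process \<Rightarrow> 'a process \<Rightarrow> ennreal" where
  "cost M T \<psi>\<^sub>x \<psi>\<^sub>c x C =
     (\<integral>\<^sup>+\<omega>. (\<integral>\<^sup>+t. ennreal (\<psi>\<^sub>x t \<omega> * x t \<omega>) \<partial>dt T)
        + (\<integral>\<^sup>+t. ennreal (\<psi>\<^sub>c t \<omega>) \<partial>stieltjes T (\<lambda>t. C t \<omega>)) \<partial>M)"

definition budget ::
    "'a measure \<Rightarrow> (ennreal \<Rightarrow> 'a measure) \<Rightarrow> ennreal \<Rightarrow> 'a process \<Rightarrow> 'a process \<Rightarrow>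
     real \<Rightarrow> ('a process \<times> 'a process) set" where
  "budget M F T \<psi>\<^sub>x \<psi>\<^sub>c w =
     {(x, C). optional M F T x \<and> optional M F T C \<and>
        (AE \<omega> in M. \<forall>t\<in>time_set T. 0 \<le> x t \<omega> \<and> 0 \<le> C t \<omega>) \<and>
        (AE \<omega> in M. right_continuous_path T (\<lambda>t. C t \<omega>) \<and> mono_on (time_set T) (\<lambda>t. C t \<omega>)) \<and>
        cost M T \<psi>\<^sub>x \<psi>\<^sub>c x C \<le> ennreal w}"

text \<open>\<open>C'\<close> is the aggregate contribution of the other agents.\<close>

definition payoff ::
    "'a measure \<Rightarrow> ennreal \<Rightarrow> 'a process \<Rightarrow> (real \<Rightarrow> real \<Rightarrow> real) \<Rightarrow>
     'a process \<Rightarrow> 'a process \<Rightarrow> 'a process \<Rightarrow> ennreal" where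
  "payoff M T r u x C C' =
     (\<integral>\<^sup>+\<omega>. \<integral>\<^sup>+t. ennreal (exp (- cum r t \<omega>) * u (x t \<omega>) (C t \<omega> + C' t \<omega>)) \<partial>dt T \<partial>M)"

definition best_payoff ::
    "'a measure \<Rightarrow> (ennreal \<Rightarrow> 'a measure) \<Rightarrow> ennreal \<Rightarrow> 'a process \<Rightarrow> 'a process \<Rightarrow> 'a process \<Rightarrow>
     real \<Rightarrow> (real \<Rightarrow> real \<Rightarrow> real) \<Rightarrow> 'a process \<Rightarrow> ennreal" where
  "best_payoff M F T \<psi>\<^sub>x \<psi>\<^sub>c r w u C' =
     (SUP (x, C)\<in>budget M F T \<psi>\<^sub>x \<psi>\<^sub>c w. payoff M T r u x C C')"

text \<open>The agents are \<open>0, \<dots>, n - 1\<close>.\<close>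

definition nash_equilibrium ::
    "'a measure \<Rightarrow> (ennreal \<Rightarrow> 'a measure) \<Rightarrow> ennreal \<Rightarrow> 'a process \<Rightarrow> 'a process \<Rightarrow> 'a process \<Rightarrow>
     nat \<Rightarrow> (nat \<Rightarrow> real) \<Rightarrow> (nat \<Rightarrow> real \<Rightarrow> real \<Rightarrow> real) \<Rightarrow>
     (nat \<Rightarrow> 'a process) \<Rightarrow> (nat \<Rightarrow> 'a process) \<Rightarrow> bool" where
  "nash_equilibrium M F T \<psi>\<^sub>x \<psi>\<^sub>c r n w u x C \<longleftrightarrow>
     (\<forall>i<n. (x i, C i) \<in> budget M F T \<psi>\<^sub>x \<psi>\<^sub>c (w i) \<and>
        (let C' = (\<lambda>t \<omega>. \<Sum>j\<in>{..<n} - {i}. C j t \<omega>)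
         in payoff M T r (u i) (x i) (C i) C' = best_payoff M F T \<psi>\<^sub>x \<psi>\<^sub>c r (w i) (u i) C'))"

section \<open>Utility functions\<close>

definition D\<^sub>x :: "(real \<Rightarrow> real \<Rightarrow> real) \<Rightarrow> real \<Rightarrow> real \<Rightarrow> real" where
  "D\<^sub>x u x c = deriv (\<lambda>y. u y c) x"

definition D\<^sub>c :: "(real \<Rightarrow> real \<Rightarrow> real) \<Rightarrow> real \<Rightarrow> real \<Rightarrow> real" where
  "D\<^sub>c u x c = deriv (\<lambda>d. u x d) c"

definition has_continuous_partials :: "(real \<Rightarrow> real \<Rightarrow> real) \<Rightarrow> bool" where
  "has_continuous_partials u \<longleftrightarrow>
     (\<forall>x>0. \<forall>c>0. (\<lambda>y. u y c) field_differentiable (at x) \<and> (\<lambda>d. u x d) field_differentiable (at c)) \<and>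
     continuous_on ({0<..} \<times> {0<..}) (\<lambda>(x, c). D\<^sub>x u x c) \<and>
     continuous_on ({0<..} \<times> {0<..}) (\<lambda>(x, c). D\<^sub>c u x c)"

definition utility_function :: "(real \<Rightarrow> real \<Rightarrow> real) \<Rightarrow> bool" where
  "utility_function u \<longleftrightarrow>
     (\<forall>x\<ge>0. \<forall>c\<ge>0. 0 \<le> u x c) \<and>
     (\<forall>x\<ge>0. \<forall>c\<ge>0. \<forall>x'\<ge>x. \<forall>c'\<ge>c. u x c \<le> u x' c') \<and>
     (\<forall>x\<ge>0. \<forall>c\<ge>0. \<forall>x'\<ge>0. \<forall>c'\<ge>0. \<forall>a. (x, c) \<noteq> (x', c') \<and> 0 < a \<and> a < 1 \<longrightarrow>
        (1 - a) * u x c + a * u x' c' < u ((1 - a) * x + a * x') ((1 - a) * c + a * c')) \<and>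
     has_continuous_partials u \<and> has_continuous_partials (D\<^sub>x u) \<and> has_continuous_partials (D\<^sub>c u) \<and>
     (\<forall>x>0. \<forall>c>0. \<forall>a b. (a, b) \<noteq> (0, 0) \<longrightarrow>
        D\<^sub>x (D\<^sub>x u) x c * a * a + D\<^sub>c (D\<^sub>x u) x c * a * b
        + D\<^sub>x (D\<^sub>c u) x c * b * a + D\<^sub>c (D\<^sub>c u) x c * b * b < 0) \<and>
     (\<forall>c>0. filterlim (\<lambda>x. D\<^sub>x u x c) at_top (at_right 0) \<and>
            ((\<lambda>x. D\<^sub>x u x c) \<longlongrightarrow> 0) at_top)"

text \<open>
  Uniform integrability over a measure that need not be finite (for \<open>T = \<infinity>\<close>): the constants of
  the finite-measure definition are replaced by integrable functions. For finite measures this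
  is the usual notion.
\<close>

definition uniformly_integrable :: "'b measure \<Rightarrow> ('b \<Rightarrow> real) set \<Rightarrow> bool" where
  "uniformly_integrable N \<F> \<longleftrightarrow>
     (\<forall>\<epsilon>>0. \<exists>g. integrable N g \<and> (\<forall>z. 0 \<le> g z) \<and>
        (\<forall>f\<in>\<F>. (\<integral>\<^sup>+z. ennreal \<bar>f z\<bar> * indicator {z. g z \<le> \<bar>f z\<bar>} z \<partial>N) \<le> ennreal \<epsilon>))"

definition assumption_U ::
    "'a measure \<Rightarrow> (ennreal \<Rightarrow> 'a measure) \<Rightarrow> ennreal \<Rightarrow> 'a process \<Rightarrow> 'a process \<Rightarrow> 'a process \<Rightarrow>
     nat \<Rightarrow> (nat \<Rightarrow> real) \<Rightarrow> (nat \<Rightarrow> real \<Rightarrow> real \<Rightarrow> real) \<Rightarrow> bool" where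
  "assumption_U M F T \<psi>\<^sub>x \<psi>\<^sub>c r n w u \<longleftrightarrow>
     (\<forall>i<n. utility_function (u i)) \<and>
     (\<forall>i<n. uniformly_integrable (M \<Otimes>\<^sub>M dt T)
        {(\<lambda>(\<omega>, t). exp (- cum r t \<omega>) * u i (x i t \<omega>) (\<Sum>j<n. C j t \<omega>)) | x C.
           \<forall>j<n. (x j, C j) \<in> budget M F T \<psi>\<^sub>x \<psi>\<^sub>c (w j)})"

text \<open>
  \<open>g\<close> is only meaningful for \<open>\<psi>, c > 0\<close>; the value \<open>0\<close> elsewhere is relevant at most at time \<open>0\<close>
  (where the aggregate contribution may vanish) and on null sets.
\<close>

definition g_inv :: "(real \<Rightarrow> real \<Rightarrow> real) \<Rightarrow> real \<Rightarrow> real \<Rightarrow> real" where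
  "g_inv u \<psi> c = (if 0 < \<psi> \<and> 0 < c then THE x. 0 < x \<and> D\<^sub>x u x c = \<psi> else 0)"

definition h_fun :: "(real \<Rightarrow> real \<Rightarrow> real) \<Rightarrow> real \<Rightarrow> real \<Rightarrow> real" where
  "h_fun u \<psi> c = D\<^sub>c u (g_inv u \<psi> c) c"

section \<open>The backward equation\<close>

text \<open>
  The integrand is nonnegative (\<open>u\<close> is increasing), hence the conditional expectation of
  nonnegative functions. The positivity requirement makes the second argument of \<open>h\<close> positive
  wherever it enters the integral.
\<close>

definition solves_backward_equation ::
    "'a measure \<Rightarrow> (ennreal \<Rightarrow> 'a measure) \<Rightarrow> ennreal \<Rightarrow> 'a process \<Rightarrow> 'a process \<Rightarrow> 'a process \<Rightarrow>
     nat \<Rightarrow> (real \<Rightarrow> real \<Rightarrow> real) \<Rightarrow> real \<Rightarrow> 'a process \<Rightarrow> bool" where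
  "solves_backward_equation M F T \<psi>\<^sub>x \<psi>\<^sub>c r n u lam l \<longleftrightarrow>
     (\<forall>\<tau>. stopping_time F \<tau> \<and> (\<forall>\<omega>\<in>space M. \<tau> \<omega> \<le> T) \<longrightarrow>
        (AE \<omega> in M. AE t in dt T. \<tau> \<omega> \<le> t \<longrightarrow> 0 < (SUP s\<in>{\<tau> \<omega>..t}. l s \<omega>)) \<and>
        (AE \<omega> in M.
           nn_cond_exp M (filtration.pre_sigma (space M) F \<tau>)
             (\<lambda>\<omega>. \<integral>\<^sup>+t\<in>{\<tau> \<omega>..T}.
                ennreal (exp (- cum r t \<omega>) *
                  h_fun u (lam * exp (cum r t \<omega>) * \<psi>\<^sub>x t \<omega>)
                          (real n * (SUP s\<in>{\<tau> \<omega>..t}. l s \<omega>))) \<partial>dt T) \<omega>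
           = ennreal (lam * \<psi>\<^sub>c (\<tau> \<omega>) \<omega> * (if \<tau> \<omega> < T then 1 else 0))))"

end

theory Submission
  imports Defs
begin

text \<open>
  Let \<open>(x\<^sub>0, C\<^sub>0)\<close> be the candidate of each agent. Since \<open>u\<close> is concave, deviating to \<open>(x, C)\<close> gains at most
  the discounted expected integral of \<open>u\<^sub>x (x - x\<^sub>0) + u\<^sub>c (C - C\<^sub>0)\<close>, with derivatives taken at \<open>(x\<^sub>0, n C\<^sub>0)\<close>.
  The first order condition for \<open>x\<^sub>0\<close> turns the first term into \<open>lam\<close> times the difference of the costs of
  \<open>x\<close> and \<open>x\<^sub>0\<close>. In the second term \<open>C\<close> is decomposed by levels: \<open>C\<close> reaches level \<open>a\<close> at a stopping
  time \<open>\<tau>\<^sub>a\<close>, so that \<open>E \<integral> H C dt\<close>, where \<open>H\<close> is the discounted \<open>u\<^sub>c\<close>, is the integral over \<open>a\<close> of the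
  expectations of \<open>\<integral> H dt\<close> over the times after \<open>\<tau>\<^sub>a\<close>. Because \<open>h\<close> decreases in \<open>c\<close> and the supremum of \<open>l\<close>
  over \<open>[\<tau>\<^sub>a, t]\<close> is at most \<open>C\<^sub>0 t\<close>, the backward equation at \<open>\<tau>\<^sub>a\<close> bounds them by \<open>lam E \<psi>\<^sub>c(\<tau>\<^sub>a)\<close>, with
  equality for \<open>C = C\<^sub>0\<close> and almost every \<open>a\<close>. Hence the gain is at most \<open>lam\<close> times the difference of
  the costs, which is not positive. Keeping all terms nonnegative avoids subtracting expectations
  that might be infinite. That \<open>C\<^sub>0\<close> is adapted is an instance of the measurable projection theorem,
  which is obtained from Suslin schemes.
\<close>

section \<open>Measurable projection\<close>

text \<open>The backward equation is blind at \<open>T\<close>: its right side vanishes there, and a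
  single time contributes nothing to utility, so a jump at \<open>T\<close> costs and yields
  nothing. Costs are therefore compared without the mass at \<open>T\<close>. For a deviation this
  leaves a lower bound of its cost, which is the right direction; for the candidate nothing is lost,
  since \<open>l T = 0\<close>. The exceptional levels are those on which the running supremum
  rests: the supremum restarted at the hitting time of \<open>a\<close> agrees with the full one
  only where \<open>a\<close> is strictly exceeded. Symmetry enters through the aggregate: against
  \<open>n - 1\<close> copies of the candidate, the aggregate of a deviation differs from
  \<open>n\<close> times the candidate by exactly the change of one agent's contribution. A further
  obstacle is that the hypotheses hold almost surely, while stopping times and joint measurability
  ask for regularity of every path; discount, prices and contributions are therefore replaced by
  versions.\<close>

definition compact_rectangles :: "'a measure \<Rightarrow> ('a \<times> 'b::topological_space) set set" where
  "compact_rectangles N = {A \<times> K | A K. A \<in> sets N \<and> compact K}"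

text \<open>The number of values of \<open>f\<close> on which \<open>S k f\<close> depends may itself depend on \<open>f\<close>; countable unions
  and intersections of schemes are then mere reindexings of the branches.\<close>

definition suslin_scheme ::
    "'a measure \<Rightarrow> (nat \<Rightarrow> (nat \<Rightarrow> nat) \<Rightarrow> ('a \<times> 'b::topological_space) set) \<Rightarrow> bool" where
  "suslin_scheme N S \<longleftrightarrow> (\<forall>k f. S k f \<in> compact_rectangles N) \<and>
     (\<forall>k f. \<exists>m. \<forall>g. (\<forall>j<m. g j = f j) \<longrightarrow> S k g = S k f)"

text \<open>The Suslin operation: an uncountable union over branches \<open>f\<close> of countable
  intersections. In the classical form stage \<open>k\<close> depends on the first \<open>k\<close>
  entries of \<open>f\<close>.\<close>

definition suslin_set :: "'a measure \<Rightarrow> ('a \<times> 'b::topological_space) set \<Rightarrow> bool" where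
  "suslin_set N E \<longleftrightarrow> (\<exists>S. suslin_scheme N S \<and> E = {z. \<exists>f. \<forall>k. z \<in> S k f})"

lemma suslin_schemeD:
  assumes "suslin_scheme N S"
  shows "S k f \<in> compact_rectangles N"
    and "\<exists>m. \<forall>g. (\<forall>j<m. g j = f j) \<longrightarrow> S k g = S k f"
  using assms unfolding suslin_scheme_def by blast+

lemma suslin_set_rectangle:
  assumes "R \<in> compact_rectangles N"
  shows "suslin_set N R"
  unfolding suslin_set_def suslin_scheme_def
  by (rule exI[of _ "\<lambda>_ _. R"]) (use assms in auto)

text \<open>The entry \<open>f 0\<close> selects the set, the shifted sequence is the branch in its
  scheme.\<close>

lemma suslin_set_UN:
  fixes E :: "nat \<Rightarrow> ('a \<times> 'b::topological_space) set"
  assumes "\<And>i. suslin_set N (E i)"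
  shows "suslin_set N (\<Union>i. E i)"
proof -
  have "\<forall>i. \<exists>S. suslin_scheme N S \<and> E i = {z. \<exists>f. \<forall>k. z \<in> S k f}"
    using assms unfolding suslin_set_def by blast
  from choice[OF this] obtain S where
    S: "\<And>i. suslin_scheme N (S i)" "\<And>i. E i = {z. \<exists>f. \<forall>k. z \<in> S i k f}"
    by blast
  define S' where "S' k f = S (f 0) k (\<lambda>j. f (Suc j))" for k and f :: "nat \<Rightarrow> nat"
  have "suslin_set N {z. \<exists>f. \<forall>k. z \<in> S' k f}"
    unfolding suslin_set_def suslin_scheme_def
  proof (intro exI[of _ S'] conjI allI refl)
    fix k f show "S' k f \<in> compact_rectangles N"
      unfolding S'_def by (rule suslin_schemeD[OF S(1)])
  next
    fix k f
    obtain m where m: "\<And>g. (\<forall>j<m. g j = f (Suc j)) \<Longrightarrow> S (f 0) k g = S (f 0) k (\<lambda>j. f (Suc j))"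
      using suslin_schemeD(2)[OF S(1)[of "f 0"], of "\<lambda>j. f (Suc j)" k] by blast
    show "\<exists>m. \<forall>g. (\<forall>j<m. g j = f j) \<longrightarrow> S' k g = S' k f"
    proof (intro exI[of _ "Suc m"] allI impI)
      fix g assume "\<forall>j<Suc m. g j = f j"
      then have "g 0 = f 0" "\<forall>j<m. g (Suc j) = f (Suc j)" by auto
      then show "S' k g = S' k f"
        unfolding S'_def using m[of "\<lambda>j. g (Suc j)"] by simp
    qed
  qed
  moreover have "(\<exists>i. \<exists>f. \<forall>k. z \<in> S i k f) \<longleftrightarrow> (\<exists>f. \<forall>k. z \<in> S' k f)" for z
  proof
    assume "\<exists>i. \<exists>f. \<forall>k. z \<in> S i k f"
    then obtain i f where "\<forall>k. z \<in> S i k f" by blast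
    then show "\<exists>f. \<forall>k. z \<in> S' k f"
      by (intro exI[of _ "case_nat i f"]) (simp add: S'_def)
  qed (auto simp: S'_def)
  ultimately show ?thesis
    by (simp add: S(2) UNION_eq)
qed

text \<open>One sequence codes countably many branches as rows: row \<open>i\<close> serves the
  scheme of \<open>E i\<close>, and stage \<open>p\<close> tests stage \<open>k\<close> of scheme
  \<open>i\<close>, where \<open>p\<close> codes \<open>(i, k)\<close>.\<close>

lemma suslin_set_INT:
  fixes E :: "nat \<Rightarrow> ('a \<times> 'b::topological_space) set"
  assumes "\<And>i. suslin_set N (E i)"
  shows "suslin_set N (\<Inter>i. E i)"
proof -
  have "\<forall>i. \<exists>S. suslin_scheme N S \<and> E i = {z. \<exists>f. \<forall>k. z \<in> S k f}"
    using assms unfolding suslin_set_def by blast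
  from choice[OF this] obtain S where
    S: "\<And>i. suslin_scheme N (S i)" "\<And>i. E i = {z. \<exists>f. \<forall>k. z \<in> S i k f}"
    by blast
  define S' where "S' p f = (case prod_decode p of (i, k) \<Rightarrow> S i k (\<lambda>j. f (prod_encode (i, j))))"
    for p and f :: "nat \<Rightarrow> nat"
  have "suslin_set N {z. \<exists>f. \<forall>k. z \<in> S' k f}"
    unfolding suslin_set_def suslin_scheme_def
  proof (intro exI[of _ S'] conjI allI refl)
    fix k f show "S' k f \<in> compact_rectangles N"
      unfolding S'_def by (auto split: prod.split intro: suslin_schemeD[OF S(1)])
  next
    fix p f
    obtain i k where ik: "prod_decode p = (i, k)" by (cases "prod_decode p")
    obtain m where m: "\<And>g. (\<forall>j<m. g j = f (prod_encode (i, j))) \<Longrightarrow>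
        S i k g = S i k (\<lambda>j. f (prod_encode (i, j)))"
      using suslin_schemeD(2)[OF S(1)[of i], of "\<lambda>j. f (prod_encode (i, j))" k] by blast
    \<comment> \<open>The first \<open>m\<close> entries of row \<open>i\<close> are scattered over
      the codes \<open>prod_encode (i, j)\<close>; \<open>m'\<close> lies beyond all of
      them.\<close>
    obtain m' where m': "\<And>j. j < m \<Longrightarrow> prod_encode (i, j) < m'"
      using finite_imageI[OF finite_lessThan[of m], of "\<lambda>j. prod_encode (i, j)"]
      unfolding finite_nat_set_iff_bounded by auto
    show "\<exists>m. \<forall>g. (\<forall>j<m. g j = f j) \<longrightarrow> S' p g = S' p f"
    proof (intro exI[of _ m'] allI impI)
      fix g assume "\<forall>j<m'. g j = f j"
      then have "\<forall>j<m. g (prod_encode (i, j)) = f (prod_encode (i, j))" using m' by blast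
      then show "S' p g = S' p f"
        unfolding S'_def ik using m[of "\<lambda>j. g (prod_encode (i, j))"] by simp
    qed
  qed
  moreover have "(\<forall>i. \<exists>f. \<forall>k. z \<in> S i k f) \<longleftrightarrow> (\<exists>f. \<forall>k. z \<in> S' k f)" for z
  proof
    assume "\<forall>i. \<exists>f. \<forall>k. z \<in> S i k f"
    then obtain f where f: "\<And>i k. z \<in> S i k (f i)" by metis
    have "z \<in> S' p (\<lambda>q. case prod_decode q of (i, j) \<Rightarrow> f i j)" for p
      by (cases "prod_decode p") (simp add: S'_def f)
    then show "\<exists>f. \<forall>k. z \<in> S' k f" by blast
  next
    assume "\<exists>f. \<forall>k. z \<in> S' k f"
    then obtain f where f: "\<And>p. z \<in> S' p f" by blast
    show "\<forall>i. \<exists>f. \<forall>k. z \<in> S i k f"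
    proof
      fix i
      have "z \<in> S i k (\<lambda>j. f (prod_encode (i, j)))" for k
        using f[of "prod_encode (i, k)"] by (simp add: S'_def)
      then show "\<exists>f. \<forall>k. z \<in> S i k f" by blast
    qed
  qed
  ultimately show ?thesis
    by (simp add: S(2) INTER_eq)
qed

lemma suslin_set_Un:
  assumes "suslin_set N A" "suslin_set N B"
  shows "suslin_set N (A \<union> B)"
proof -
  have "A \<union> B = (\<Union>i::nat. if i = 0 then A else B)"
    by (auto split: if_splits)
  then show ?thesis
    using suslin_set_UN[of N "\<lambda>i::nat. if i = 0 then A else B"] assms by simp
qed

text \<open>Open subsets of a Euclidean space are countable unions of compact sets. For closed sets
  the same follows by cutting with balls.\<close>

lemma suslin_set_open_Times:
  fixes U :: "'b::euclidean_space set"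
  assumes "A \<in> sets N" "open U"
  shows "suslin_set N (A \<times> U)"
proof -
  obtain C :: "nat \<Rightarrow> 'b set" where C: "\<And>n. compact (C n)" "\<Union>(range C) = U"
    using open_Union_compact_subsets[OF assms(2)] by metis
  have "A \<times> U = (\<Union>n. A \<times> C n)"
    using C(2) by auto
  moreover have "suslin_set N (A \<times> C n)" for n
    by (rule suslin_set_rectangle) (use assms C in \<open>auto simp: compact_rectangles_def\<close>)
  ultimately show ?thesis
    using suslin_set_UN[of N "\<lambda>n. A \<times> C n"] by simp
qed

lemma suslin_set_closed_Times:
  fixes F :: "'b::euclidean_space set"
  assumes "A \<in> sets N" "closed F"
  shows "suslin_set N (A \<times> F)"
proof -
  have "F \<subseteq> (\<Union>n::nat. F \<inter> cball 0 (real n))"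
  proof
    fix x assume "x \<in> F"
    moreover obtain n where "norm x \<le> real n" using real_arch_simple by blast
    ultimately show "x \<in> (\<Union>n::nat. F \<inter> cball 0 (real n))" by auto
  qed
  then have "A \<times> F = (\<Union>n::nat. A \<times> (F \<inter> cball 0 (real n)))"
    by auto
  moreover have "suslin_set N (A \<times> (F \<inter> cball 0 (real n)))" for n
  proof (rule suslin_set_rectangle)
    have "compact (F \<inter> cball 0 (real n))"
      using assms(2) by (intro closed_Int_compact) auto
    then show "A \<times> (F \<inter> cball 0 (real n)) \<in> compact_rectangles N"
      unfolding compact_rectangles_def using assms(1) by blast
  qed
  ultimately show ?thesis
    using suslin_set_UN[of N "\<lambda>n. A \<times> (F \<inter> cball 0 (real n))"] by simp
qed

text \<open>Complements of Suslin sets need not be Suslin, so the induction carries a set together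
  with its complement: complementation swaps the two, and a union needs closure under countable
  unions for the one and intersections for the other.\<close>

lemma suslin_set_borel_Times:
  fixes B :: "'b::euclidean_space set"
  assumes A: "A \<in> sets N" and B: "B \<in> sets borel"
  shows "suslin_set N (A \<times> B)"
proof -
  have "B \<in> sigma_sets UNIV (Collect open)"
    using B by (simp add: borel_def)
  then have "suslin_set N (A \<times> B) \<and> suslin_set N (A \<times> (- B))"
  proof induction
    case (Basic U)
    then show ?case
      using suslin_set_open_Times[OF A, of U] suslin_set_closed_Times[OF A, of "- U"]
      by (auto simp: closed_def)
  next
    case Empty
    show ?case
      using suslin_set_open_Times[OF A, of "{}"] suslin_set_open_Times[OF A, of UNIV] by simp
  next
    case (Compl a)
    then show ?case by (simp add: Compl_eq_Diff_UNIV Diff_Diff_Int)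
  next
    case (Union a)
    have "A \<times> \<Union> (range a) = (\<Union>i. A \<times> a i)" "A \<times> - \<Union> (range a) = (\<Inter>i. A \<times> (- a i))"
      by auto
    then show ?case
      using suslin_set_UN[of N "\<lambda>i. A \<times> a i"] suslin_set_INT[of N "\<lambda>i. A \<times> (- a i)"] Union
      by simp
  qed
  then show ?thesis ..
qed

text \<open>The same paired induction, with complements relative to \<open>?X\<close>; the
  complement of a generating rectangle is a union of two rectangles.\<close>

theorem suslin_set_pair_measure:
  fixes E :: "('a \<times> 'b::euclidean_space) set"
  assumes "E \<in> sets (N \<Otimes>\<^sub>M borel)"
  shows "suslin_set N E"
proof -
  let ?X = "space N \<times> (UNIV :: 'b set)"
  have "E \<in> sigma_sets ?X {a \<times> b | a b. a \<in> sets N \<and> b \<in> sets (borel :: 'b measure)}"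
    using assms by (simp add: sets_pair_measure)
  then have "suslin_set N E \<and> suslin_set N (?X - E)"
  proof induction
    case (Basic R)
    then obtain a b where R: "R = a \<times> b" "a \<in> sets N" "b \<in> sets borel" by auto
    have "?X - R = (space N - a) \<times> UNIV \<union> a \<times> (- b)"
      using sets.sets_into_space[OF R(2)] by (auto simp: R(1))
    then show ?case
      using suslin_set_borel_Times[OF R(2,3)] suslin_set_borel_Times[OF R(2), of "- b"]
        suslin_set_borel_Times[of "space N - a" N UNIV] R suslin_set_Un by auto
  next
    case Empty
    show ?case
      using suslin_set_borel_Times[of "{}" N UNIV] suslin_set_borel_Times[of "space N" N UNIV] by simp
  next
    case (Compl a)
    have "a \<subseteq> ?X"
      by (rule sigma_sets_into_sp[OF _ Compl.hyps]) (auto dest: sets.sets_into_space)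
    then have "?X - (?X - a) = a" by blast
    with Compl.IH show ?case by simp
  next
    case (Union a)
    have "?X - \<Union> (range a) = (\<Inter>i. ?X - a i)" by auto
    then show ?case
      using suslin_set_UN[of N a] suslin_set_INT[of N "\<lambda>i. ?X - a i"] Union.IH by metis
  qed
  then show ?thesis ..
qed

text \<open>Tychonoff for the finite discrete sets \<open>{..b j}\<close>, in sequential form.
  Convergence in a discrete factor is eventual equality.\<close>

lemma bounded_nat_sequences_compact:
  fixes g :: "nat \<Rightarrow> nat \<Rightarrow> nat"
  assumes "\<And>n j. g n j \<le> b j"
  obtains r g' where "strict_mono r" "\<And>j. \<forall>\<^sub>F n in sequentially. g (r n) j = g' j"
proof -
  have "compactin (product_topology (\<lambda>_. euclidean) UNIV) (PiE UNIV (\<lambda>j. {..b j}))"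
    unfolding compactin_PiE by (simp add: finite_imp_compact)
  then have c: "compact (PiE UNIV (\<lambda>j. {..b j}))"
    by (simp only: euclidean_product_topology compactin_euclidean_iff)
  have g: "\<forall>n. g n \<in> PiE UNIV (\<lambda>j. {..b j})"
    using assms by (simp add: PiE_UNIV_domain)
  from c have "seq_compact (PiE UNIV (\<lambda>j. {..b j}))"
    by (rule compact_imp_seq_compact)
  then obtain g' r where r: "strict_mono r" "(g \<circ> r) \<longlonglongrightarrow> g'"
    using g by (rule seq_compactE)
  have "\<forall>\<^sub>F n in sequentially. g (r n) j = g' j" for j
  proof -
    have "(\<lambda>n. (g \<circ> r) n j) \<longlonglongrightarrow> g' j"
      by (rule continuous_on_tendsto_compose[OF continuous_on_product_coordinates[of j] r(2)]) auto
    then show ?thesis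
      by (auto simp: tendsto_discrete)
  qed
  with r(1) show ?thesis using that by blast
qed

text \<open>A locally constant map on a compact space is uniformly so: counterexamples for ever
  larger \<open>m\<close> would accumulate at a branch that violates its own modulus. Only
  \<open>f\<close> has to be bounded, since \<open>g\<close> is compared with it on a
  prefix.\<close>

lemma suslin_scheme_uniform:
  fixes b :: "nat \<Rightarrow> nat"
  assumes "suslin_scheme N S"
  shows "\<exists>m. \<forall>f g. (\<forall>j. f j \<le> b j) \<longrightarrow> (\<forall>j<m. g j = f j) \<longrightarrow> S k g = S k f"
proof (rule ccontr)
  assume "\<not> ?thesis"
  then have "\<forall>m. \<exists>f g. (\<forall>j. f j \<le> b j) \<and> (\<forall>j<m. g j = f j) \<and> S k g \<noteq> S k f"
    by blast
  then obtain F G where FG: "\<And>m j. F m j \<le> b j" "\<And>m j. j < m \<Longrightarrow> G m j = F m j"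
      "\<And>m. S k (G m) \<noteq> S k (F m)"
    by metis
  obtain r f where r: "strict_mono r" "\<And>j. \<forall>\<^sub>F n in sequentially. F (r n) j = f j"
    using bounded_nat_sequences_compact[of F b] FG(1) by blast
  obtain m where m: "\<And>g. (\<forall>j<m. g j = f j) \<Longrightarrow> S k g = S k f"
    using suslin_schemeD(2)[OF assms, of f k] by blast
  have "\<forall>\<^sub>F n in sequentially. \<forall>j\<in>{..<m}. F (r n) j = f j"
    by (intro eventually_ball_finite) (auto intro: r(2))
  then have "\<forall>\<^sub>F n in sequentially. (\<forall>j<m. F (r n) j = f j) \<and> m \<le> n"
    using eventually_ge_at_top[of m] by eventually_elim auto
  then obtain n where n: "\<forall>j<m. F (r n) j = f j" "m \<le> n"
    using eventually_happens'[OF sequentially_bot] by blast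
  then have "m \<le> r n"
    using seq_suble[OF r(1), of n] by linarith
  then have "\<forall>j<m. G (r n) j = f j"
    using n(1) FG(2)[of _ "r n"] by simp
  then have "S k (G (r n)) = S k f" "S k (F (r n)) = S k f"
    using m[of "G (r n)"] m[of "F (r n)"] n(1) by blast+
  with FG(3)[of "r n"] show False by simp
qed

text \<open>Choquet's capacitability argument for the outer measure. The projection is squeezed
  between a countable union of measurable subsets and a measurable hull of the same finite measure;
  completeness absorbs the gap.\<close>

theorem measurable_projection:
  fixes E :: "('a \<times> 'b::euclidean_space) set"
  assumes "finite_measure N"
    and complete: "\<And>A B. B \<in> null_sets N \<Longrightarrow> A \<subseteq> B \<Longrightarrow> A \<in> sets N"
    and "E \<in> sets (N \<Otimes>\<^sub>M borel)"
  shows "fst ` E \<in> sets N"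
proof -
  interpret finite_measure N by fact
  obtain S where S: "suslin_scheme N S" and E: "E = {z. \<exists>f. \<forall>k. z \<in> S k f}"
    using suslin_set_pair_measure[OF assms(3)] unfolding suslin_set_def by blast
  have E_space: "fst ` E \<subseteq> space N"
    using sets.sets_into_space[OF assms(3)] by (auto simp: space_pair_measure)
  \<comment> \<open>\<open>W bs\<close> collects the points of \<open>E\<close> with a branch whose
    first entries are bounded by \<open>bs\<close>. Its projection is not known to be measurable;
    the outer measure is nevertheless continuous along increasing sequences of arbitrary
    sets.\<close>
  define W where "W bs = {z. \<exists>f. (\<forall>j<length bs. f j \<le> bs ! j) \<and> (\<forall>k. z \<in> S k f)}" for bs :: "nat list"
  define I where "I A = outer_measure_of N (fst ` A)" for A :: "('a \<times> 'b) set"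
  have W_space: "fst ` W bs \<subseteq> space N" for bs
    using E_space by (force simp: W_def E)
  have W_Suc: "I (W bs) = (SUP v. I (W (bs @ [v])))" for bs
  proof -
    have step: "W (bs @ [v]) =
        {z. \<exists>f. (\<forall>j<length bs. f j \<le> bs ! j) \<and> f (length bs) \<le> v \<and> (\<forall>k. z \<in> S k f)}" for v
      unfolding W_def by (auto simp: nth_append less_Suc_eq all_conj_distrib)
    have "W bs = (\<Union>v. W (bs @ [v]))"
      unfolding step by (auto simp: W_def)
    then have "fst ` W bs = (\<Union>v. fst ` W (bs @ [v]))"
      by (metis image_UN)
    moreover have "incseq (\<lambda>v. fst ` W (bs @ [v]))"
      unfolding step incseq_def by (intro allI impI image_mono) (auto intro: le_trans)
    ultimately show ?thesis
      unfolding I_def using SUP_outer_measure_of_incseq[of "\<lambda>v. fst ` W (bs @ [v])" N] W_space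
      by simp
  qed
  text \<open>Capacitability: every level below the outer measure is reached from the inside. A bound \<open>b\<close>
    on the branches keeps the level and makes the set of branches compact.\<close>
  have inner: "\<exists>D\<in>sets N. D \<subseteq> fst ` E \<and> a \<le> emeasure N D" if a: "a < I E" for a
  proof -
    have "\<exists>Bs. \<forall>n. (length (Bs n) = n \<and> a < I (W (Bs n))) \<and> (\<exists>v. Bs (Suc n) = Bs n @ [v])"
    proof (rule dependent_nat_choice)
      show "\<exists>bs. length bs = 0 \<and> a < I (W bs)"
        using a by (intro exI[of _ "[]"]) (simp add: W_def E)
      fix bs and n :: nat
      assume bs: "length bs = n \<and> a < I (W bs)"
      then obtain v where "a < I (W (bs @ [v]))"
        unfolding W_Suc[of bs] less_SUP_iff by blast
      with bs show "\<exists>bs'. (length bs' = Suc n \<and> a < I (W bs')) \<and> (\<exists>v. bs' = bs @ [v])"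
        by (intro exI[of _ "bs @ [v]"]) simp
    qed
    then obtain Bs where Bs: "\<And>n. length (Bs n) = n" "\<And>n. a < I (W (Bs n))"
        "\<And>n. \<exists>v. Bs (Suc n) = Bs n @ [v]"
      by blast
    define b where "b j = Bs (Suc j) ! j" for j
    have Bs_nth: "Bs n ! j = b j" if "j < n" for n j
      using that
    proof (induction n)
      case (Suc n)
      obtain v where v: "Bs (Suc n) = Bs n @ [v]" using Bs(3) by blast
      show ?case
      proof (cases "j = n")
        case False
        with Suc show ?thesis by (simp add: v nth_append Bs(1))
      qed (simp add: b_def)
    qed simp
    \<comment> \<open>Only the stages up to \<open>m\<close> are tested, but the bound
      \<open>b\<close> is imposed on all entries. This makes \<open>K m\<close> a finite union of
      rectangles, hence its projection measurable, and the intersection of these projections still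
      lies in that of \<open>E\<close>.\<close>
    define K where "K m = {z. \<exists>f. (\<forall>j. f j \<le> b j) \<and> (\<forall>k\<le>m. z \<in> S k f)}" for m :: nat
    have K: "fst ` K m \<in> sets N \<and> a \<le> emeasure N (fst ` K m)" for m
    proof -
      obtain d where d: "\<And>k f g. \<forall>j. f j \<le> b j \<Longrightarrow> \<forall>j<d k. g j = f j \<Longrightarrow> S k g = S k f"
        using suslin_scheme_uniform[OF S, of b] by metis
      obtain M where M: "\<And>k. k \<le> m \<Longrightarrow> d k \<le> M"
        using finite_imageI[OF finite_atMost[of m], of d] unfolding finite_nat_set_iff_bounded_le
        by auto
      have dM: "S k g = S k f" if "k \<le> m" "\<forall>j. f j \<le> b j" "\<forall>j<M. g j = f j" for k f g
        using d[of f k g] M[of k] that by auto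
      \<comment> \<open>Representatives of branches: the stages up to \<open>m\<close> see only the
        first \<open>M\<close> entries, so the later ones may be set to \<open>0\<close>.\<close>
      define R where "R = PiE_dflt {..<M} 0 (\<lambda>j. {..b j})"
      have "finite R"
        unfolding R_def by (intro finite_PiE_dflt) auto
      have RD: "\<forall>j. f j \<le> b j" if "f \<in> R" for f
        using that unfolding R_def PiE_dflt_def by (metis (mono_tags, lifting) atMost_iff mem_Collect_eq zero_le)
      have K_eq: "K m = (\<Union>f\<in>R. \<Inter>k\<in>{..m}. S k f)"
      proof (intro set_eqI iffI)
        fix z assume "z \<in> K m"
        then obtain f where f: "\<forall>j. f j \<le> b j" "\<forall>k\<le>m. z \<in> S k f" unfolding K_def by blast
        define f' where "f' j = (if j < M then f j else 0)" for j
        have "S k f' = S k f" if "k \<le> m" for k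
          using dM[of k f f'] that f(1) by (simp add: f'_def)
        moreover have "f' \<in> R"
          using f(1) by (auto simp: R_def PiE_dflt_def f'_def)
        ultimately show "z \<in> (\<Union>f\<in>R. \<Inter>k\<in>{..m}. S k f)"
          using f(2) by (intro UN_I[of f']) auto
      next
        fix z assume "z \<in> (\<Union>f\<in>R. \<Inter>k\<in>{..m}. S k f)"
        then show "z \<in> K m"
          unfolding K_def using RD by auto
      qed
      have "fst ` (\<Inter>k\<in>{..m}. S k f) \<in> sets N" for f
      proof -
        have "\<exists>A C. A \<in> sets N \<and> compact C \<and> (\<Inter>k\<in>{..m}. S k f) = A \<times> C" for m
        proof (induction m)
          case 0
          then show ?case
            using suslin_schemeD(1)[OF S, of 0 f] unfolding compact_rectangles_def by auto
        next
          case (Suc m)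
          then obtain A C where AC: "A \<in> sets N" "compact C" "(\<Inter>k\<in>{..m}. S k f) = A \<times> C"
            by blast
          obtain A' C' where AC': "A' \<in> sets N" "compact C'" "S (Suc m) f = A' \<times> C'"
            using suslin_schemeD(1)[OF S, of "Suc m" f] unfolding compact_rectangles_def by auto
          have "(\<Inter>k\<in>{..Suc m}. S k f) = (A \<times> C) \<inter> (A' \<times> C')"
            unfolding atMost_Suc INT_insert AC(3) AC'(3) by (rule Int_commute)
          then have "(\<Inter>k\<in>{..Suc m}. S k f) = (A \<inter> A') \<times> (C \<inter> C')"
            by (simp add: Times_Int_Times)
          then show ?case
            using AC AC' by (intro exI[of _ "A \<inter> A'"] exI[of _ "C \<inter> C'"]) (auto intro: compact_Int)
        qed
        then obtain A C where AC: "A \<in> sets N" "(\<Inter>k\<in>{..m}. S k f) = A \<times> C" by meson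
        have "fst ` (A \<times> C) = (if C = {} then {} else A)" by auto
        then show ?thesis using AC by simp
      qed
      moreover have "fst ` K m = (\<Union>f\<in>R. fst ` (\<Inter>k\<in>{..m}. S k f))"
        by (simp add: K_eq image_UN)
      ultimately have sets_K: "fst ` K m \<in> sets N"
        using \<open>finite R\<close> by auto
      have "W (Bs M) \<subseteq> K m"
      proof
        fix z assume "z \<in> W (Bs M)"
        then obtain f where f: "\<forall>j<M. f j \<le> b j" "\<forall>k. z \<in> S k f"
          unfolding W_def by (auto simp: Bs Bs_nth)
        define f' where "f' j = (if j < M then f j else 0)" for j
        have f': "\<forall>j. f' j \<le> b j" using f(1) by (simp add: f'_def)
        have "S k f = S k f'" if "k \<le> m" for k
          using dM[of k f' f] that f' by (simp add: f'_def)
        with f' f(2) show "z \<in> K m" unfolding K_def by blast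
      qed
      then have "I (W (Bs M)) \<le> I (K m)"
        unfolding I_def by (intro outer_measure_of_mono image_mono)
      then have "a \<le> emeasure N (fst ` K m)"
        using Bs(2)[of M] sets_K by (simp add: I_def)
      with sets_K show ?thesis ..
    qed
    have "decseq (\<lambda>m. fst ` K m)"
      unfolding decseq_def by (intro allI impI image_mono) (auto simp: K_def)
    then have "(INF m. emeasure N (fst ` K m)) = emeasure N (\<Inter>m. fst ` K m)"
      using K by (intro INF_emeasure_decseq) auto
    then have "a \<le> emeasure N (\<Inter>m. fst ` K m)"
      using K by (metis INF_greatest)
    moreover have "(\<Inter>m. fst ` K m) \<subseteq> fst ` E"
    proof
      fix \<omega> assume "\<omega> \<in> (\<Inter>m. fst ` K m)"
      then have "\<exists>x. (\<omega>, x) \<in> K m" for m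
        by force
      then have "\<forall>m. \<exists>x f. (\<forall>j. f j \<le> b j) \<and> (\<forall>k\<le>m. (\<omega>, x) \<in> S k f)"
        unfolding K_def by simp
      \<comment> \<open>The witnesses \<open>X m\<close> vary with \<open>m\<close>. A limit branch
        \<open>f\<close> is found first; for each \<open>k\<close> the late witnesses then lie in
        the compact set \<open>C k\<close> of that branch, and a subsequence has a limit belonging
        to every \<open>C k\<close>.\<close>
      then obtain X F where XF: "\<And>m j. F m j \<le> b j" "\<And>m k. k \<le> m \<Longrightarrow> (\<omega>, X m) \<in> S k (F m)"
        by metis
      obtain r f where r: "strict_mono r" "\<And>j. \<forall>\<^sub>F n in sequentially. F (r n) j = f j"
        using bounded_nat_sequences_compact[of F b] XF(1) by blast
      have ev: "\<forall>\<^sub>F n in sequentially. (\<omega>, X (r n)) \<in> S k f" for k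
      proof -
        obtain m where m: "\<And>g. (\<forall>j<m. g j = f j) \<Longrightarrow> S k g = S k f"
          using suslin_schemeD(2)[OF S, of f k] by blast
        have "\<forall>\<^sub>F n in sequentially. \<forall>j\<in>{..<m}. F (r n) j = f j"
          by (intro eventually_ball_finite) (auto intro: r(2))
        with eventually_ge_at_top[of k] show ?thesis
        proof eventually_elim
          case (elim n)
          then have "S k (F (r n)) = S k f" by (intro m) auto
          moreover have "k \<le> r n" using elim seq_suble[OF r(1), of n] by linarith
          ultimately show ?case using XF(2)[of k "r n"] by simp
        qed
      qed
      have "\<exists>A C. S k f = A \<times> C \<and> compact C" for k
        using suslin_schemeD(1)[OF S, of k f] unfolding compact_rectangles_def by blast
      then obtain A C where AC: "\<And>k. S k f = A k \<times> C k" "\<And>k. compact (C k)"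
        by metis
      have evC: "\<forall>\<^sub>F n in sequentially. X (r n) \<in> C k" for k
        using ev[of k] by (simp add: AC(1) eventually_conj_iff)
      have \<omega>A: "\<omega> \<in> A k" for k
        using eventually_happens'[OF sequentially_bot ev[of k]] by (simp add: AC(1) eventually_conj_iff)
      obtain n0 where n0: "\<And>n. n \<ge> n0 \<Longrightarrow> X (r n) \<in> C 0"
        using evC[of 0] unfolding eventually_sequentially by blast
      have "seq_compact (C 0)" by (rule compact_imp_seq_compact[OF AC(2)])
      moreover have "\<forall>n. X (r (n + n0)) \<in> C 0" using n0 by simp
      ultimately obtain x s where xs: "strict_mono s" "((\<lambda>n. X (r (n + n0))) \<circ> s) \<longlonglongrightarrow> x"
        by (rule seq_compactE)
      have "x \<in> C k" for k
      proof (rule Lim_in_closed_set[OF compact_imp_closed[OF AC(2)] _ sequentially_bot xs(2)])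
        have "filterlim (\<lambda>n. s n + n0) sequentially sequentially"
          by (rule filterlim_compose[OF filterlim_add_const_nat_at_top filterlim_subseq[OF xs(1)]])
        from eventually_compose_filterlim[OF evC this]
        show "\<forall>\<^sub>F n in sequentially. ((\<lambda>n. X (r (n + n0))) \<circ> s) n \<in> C k"
          by simp
      qed
      with \<omega>A have "(\<omega>, x) \<in> S k f" for k by (simp add: AC(1))
      then have "(\<omega>, x) \<in> E" by (auto simp: E)
      then show "\<omega> \<in> fst ` E" by force
    qed
    ultimately show ?thesis
      using K by (intro bexI[of _ "\<Inter>m. fst ` K m"]) auto
  qed
  \<comment> \<open>By \<open>inner\<close> the supremum of \<open>?L\<close> is the measure of the
    hull \<open>B\<close>; countably many subsets exhaust it, so \<open>B - ?D\<close> is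
    null.\<close>
  let ?L = "emeasure N ` {D \<in> sets N. D \<subseteq> fst ` E}"
  have "?L \<noteq> {}" by auto
  from ennreal_Sup_countable_SUP[OF this] obtain v :: "nat \<Rightarrow> ennreal"
    where v: "range v \<subseteq> ?L" "Sup ?L = (SUP i. v i)"
    by blast
  then have "\<forall>i. \<exists>D. D \<in> sets N \<and> D \<subseteq> fst ` E \<and> v i = emeasure N D" by blast
  then obtain D where D: "\<And>i. D i \<in> sets N" "\<And>i. D i \<subseteq> fst ` E" "\<And>i. v i = emeasure N (D i)"
    by metis
  let ?D = "\<Union>i. D i"
  obtain B where B: "B \<in> sets N" "fst ` E \<subseteq> B" "I E = emeasure N B"
    using outer_measure_of_attain[OF E_space] unfolding I_def by blast
  have "emeasure N B \<le> emeasure N ?D"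
  proof (rule dense_le)
    fix a assume "a < emeasure N B"
    then obtain D' where "D' \<in> sets N" "D' \<subseteq> fst ` E" "a \<le> emeasure N D'"
      using inner[of a] B(3) by auto
    then have "a \<le> Sup ?L" by (intro Sup_upper2[of "emeasure N D'"]) auto
    also have "\<dots> \<le> emeasure N ?D"
      unfolding v(2) D(3) using D(1) by (intro SUP_least emeasure_mono) auto
    finally show "a \<le> emeasure N ?D" .
  qed
  moreover have "?D \<subseteq> B" using D(2) B(2) by blast
  ultimately have "emeasure N (B - ?D) = 0"
    using D(1) B(1) by (subst emeasure_Diff) (auto simp: diff_eq_0_iff_ennreal less_top[symmetric])
  then have "fst ` E - ?D \<in> sets N"
    using D(1) B(1,2) by (intro complete[of "B - ?D"]) auto
  moreover have "?D \<in> sets N" using D(1) by auto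
  ultimately have "?D \<union> (fst ` E - ?D) \<in> sets N" by blast
  moreover have "?D \<union> (fst ` E - ?D) = fst ` E" using D(2) by blast
  ultimately show ?thesis by simp
qed

section \<open>Time and processes\<close>

lemma time_set_le: "t \<in> time_set T \<Longrightarrow> s \<le> t \<Longrightarrow> s \<in> time_set T"
  by (auto simp: time_set_def)

lemma time_set_subset: "s \<le> T \<Longrightarrow> time_set s \<subseteq> time_set T"
  by (auto simp: time_set_def)

lemma time_set_less: "t < T \<Longrightarrow> t \<in> time_set T"
  by (auto simp: time_set_def top.not_eq_extremum order_less_le_trans)

lemma time_set_min: "t < \<infinity> \<Longrightarrow> min T t \<in> time_set T"
  by (simp add: time_set_def min_less_iff_disj)

lemma sets_time_set [measurable]: "time_set T \<in> sets borel"
proof -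
  have "time_set T = {..T} \<inter> {..<\<infinity>}" by (auto simp: time_set_def)
  then show ?thesis by simp
qed

abbreviation time_borel :: "ennreal \<Rightarrow> ennreal measure" where
  "time_borel T \<equiv> restrict_space borel (time_set T)"

lemma space_time_borel [simp]: "space (time_borel T) = time_set T"
  by (simp add: space_restrict_space)

lemma space_dt [simp]: "space (dt T) = time_set T"
  by (simp add: dt_def)

lemma sets_dt [simp, measurable_cong]: "sets (dt T) = sets (time_borel T)"
  by (simp add: dt_def)

lemma measurable_dt: "measurable (dt T) N = measurable (time_borel T) N"
  by (rule measurable_cong_sets) simp_all

abbreviation real_times :: "ennreal \<Rightarrow> real set" where
  "real_times T \<equiv> {s. 0 \<le> s \<and> ennreal s \<le> T}"

section \<open>Integration over time\<close>

lemma measurable_ennreal_time: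
  "ennreal \<in> restrict_space lborel (real_times T) \<rightarrow>\<^sub>M time_borel T"
  by (rule measurable_restrict_space2)
     (auto simp: time_set_def space_restrict_space intro!: measurable_restrict_space1)

lemma nn_integral_dt:
  assumes "f \<in> borel_measurable (time_borel T)"
  shows "(\<integral>\<^sup>+t. f t \<partial>dt T) = (\<integral>\<^sup>+s. f (ennreal s) * indicator (real_times T) s \<partial>lborel)"
proof -
  have "(\<integral>\<^sup>+t. f t \<partial>dt T) = (\<integral>\<^sup>+s. f (ennreal s) \<partial>restrict_space lborel (real_times T))"
    unfolding dt_def using assms by (intro nn_integral_distr[OF measurable_ennreal_time]) simp
  also have "\<dots> = (\<integral>\<^sup>+s. f (ennreal s) * indicator (real_times T) s \<partial>lborel)"
    by (rule nn_integral_restrict_space) simp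
  finally show ?thesis .
qed

lemma emeasure_dt:
  assumes "A \<in> sets (time_borel T)"
  shows "emeasure (dt T) A = emeasure lborel {s. 0 \<le> s \<and> ennreal s \<in> A}"
proof -
  have A: "A \<subseteq> time_set T" "A \<in> sets borel"
    using assms by (auto simp: sets_restrict_space_iff)
  have "emeasure (dt T) A = (\<integral>\<^sup>+t. indicator A t \<partial>dt T)"
    using assms by simp
  also have "\<dots> = (\<integral>\<^sup>+s. indicator A (ennreal s) * indicator (real_times T) s \<partial>lborel)"
    using assms by (intro nn_integral_dt) simp
  also have "\<dots> = (\<integral>\<^sup>+s. indicator {s. 0 \<le> s \<and> ennreal s \<in> A} s \<partial>lborel)"
    using A by (intro nn_integral_cong) (auto simp: indicator_def time_set_def)
  also have "\<dots> = emeasure lborel {s. 0 \<le> s \<and> ennreal s \<in> A}"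
  proof (rule nn_integral_indicator)
    have "{s. 0 \<le> s \<and> ennreal s \<in> A} = {0..} \<inter> ennreal -` A" by auto
    also have "\<dots> \<in> sets borel"
      using measurable_sets_borel[OF measurable_ennreal A(2)] by auto
    finally show "{s. 0 \<le> s \<and> ennreal s \<in> A} \<in> sets lborel" by simp
  qed
  finally show ?thesis .
qed

lemma emeasure_dt_le:
  assumes "a \<le> b" "b \<in> time_set T"
  shows "emeasure (dt T) {a..b} = b - a"
proof -
  from assms have fin: "a < \<infinity>" "b < \<infinity>" by (auto simp: time_set_def order_le_less_trans)
  then obtain x y where xy: "a = ennreal x" "b = ennreal y" "0 \<le> x" "0 \<le> y"
    by (metis infinity_ennreal_def ennreal_cases less_irrefl)
  have "{a..b} \<in> sets (time_borel T)"
    using assms by (auto simp: sets_restrict_space_iff intro: time_set_le)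
  then have "emeasure (dt T) {a..b} = emeasure lborel {s. 0 \<le> s \<and> ennreal s \<in> {a..b}}"
    by (rule emeasure_dt)
  also have "{s. 0 \<le> s \<and> ennreal s \<in> {a..b}} = {x..y}"
    using xy by auto
  also have "emeasure lborel {x..y} = b - a"
    using xy assms by (simp add: ennreal_minus)
  finally show ?thesis .
qed

lemma sigma_finite_dt: "sigma_finite_measure (dt T)"
proof
  let ?A = "\<lambda>n::nat. {0..min T (of_nat n)}"
  have le: "min T (of_nat n) \<in> time_set T" for n :: nat
    by (intro time_set_min) (simp add: of_nat_less_top)
  show "\<exists>A. countable A \<and> A \<subseteq> sets (dt T) \<and> \<Union> A = space (dt T) \<and> (\<forall>a\<in>A. emeasure (dt T) a \<noteq> \<infinity>)"
  proof (intro exI[of _ "range ?A"] conjI ballI)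
    have sub: "?A n \<subseteq> time_set T" for n
      using time_set_le[OF le] by (auto simp del: min.bounded_iff)
    then show "range ?A \<subseteq> sets (dt T)"
      by (auto simp: sets_restrict_space_iff simp del: min.bounded_iff)
    have "time_set T \<subseteq> \<Union> (range ?A)"
    proof
      fix t assume "t \<in> time_set T"
      then have t: "t \<le> T" "t \<noteq> \<top>" by (auto simp: time_set_def)
      then obtain x where x: "t = ennreal x" by (cases t) auto
      obtain n :: nat where "x \<le> real n" using real_arch_simple by blast
      then have "t \<le> of_nat n" unfolding x by (simp add: ennreal_of_nat_eq_real_of_nat ennreal_leI)
      with t(1) have "t \<in> ?A n" by simp
      then show "t \<in> \<Union> (range ?A)" by blast
    qed
    with sub show "\<Union> (range ?A) = space (dt T)" by (simp add: UN_subset_iff subset_antisym)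
    fix a assume "a \<in> range ?A"
    then obtain n where "a = ?A n" by blast
    then have "emeasure (dt T) a = min T (of_nat n)"
      using emeasure_dt_le[OF _ le, of 0 n] by simp
    with le[of n] show "emeasure (dt T) a \<noteq> \<infinity>"
      by (auto simp: time_set_def)
  qed simp
qed

interpretation dt: sigma_finite_measure "dt T" for T
  by (rule sigma_finite_dt)

lemma AE_dt_neq: "AE t in dt T. t \<noteq> s"
proof (cases "s \<in> time_set T")
  case True
  then have "emeasure (dt T) {s} = 0"
    using emeasure_dt_le[of s s T] by (simp add: time_set_def diff_eq_0_iff_ennreal)
  then show ?thesis
    using True by (intro AE_I[of _ _ "{s}"]) (auto simp: sets_restrict_space_iff)
qed (auto intro!: AE_I2)

text \<open>The integral in \<open>cum\<close> uses a different measure for every upper limit; this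
  brings all of them to \<open>dt T\<close>.\<close>

lemma nn_integral_dt_restrict:
  assumes f: "f \<in> borel_measurable (time_borel T)" and "s \<le> T"
  shows "(\<integral>\<^sup>+t. f t \<partial>dt s) = (\<integral>\<^sup>+t. f t * indicator {..s} t \<partial>dt T)"
proof -
  have "f \<in> borel_measurable (time_borel s)"
    using measurable_restrict_mono[OF f[unfolded measurable_def[symmetric]] time_set_subset[OF assms(2)]] f
    by (meson measurable_restrict_mono time_set_subset assms(2))
  then have "(\<integral>\<^sup>+t. f t \<partial>dt s) = (\<integral>\<^sup>+x. f (ennreal x) * indicator (real_times s) x \<partial>lborel)"
    by (rule nn_integral_dt)
  also have "\<dots> = (\<integral>\<^sup>+x. (f (ennreal x) * indicator {..s} (ennreal x)) * indicator (real_times T) x \<partial>lborel)"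
    using assms(2) by (intro nn_integral_cong) (auto simp: indicator_def)
  also have "\<dots> = (\<integral>\<^sup>+t. f t * indicator {..s} t \<partial>dt T)"
  proof (intro nn_integral_dt[symmetric] borel_measurable_times_ennreal f)
    show "indicator {..s} \<in> borel_measurable (time_borel T)"
      by (rule measurable_restrict_space1) simp
  qed
  finally show ?thesis .
qed

text \<open>\<open>Suc\<close> puts the rounded time strictly after \<open>t\<close>, so that right
  limits apply; the cap at \<open>R\<close> keeps it within the horizon.\<close>

definition dyadic_above :: "ennreal \<Rightarrow> nat \<Rightarrow> ennreal \<Rightarrow> ennreal" where
  "dyadic_above R k t = min R (ennreal (real (Suc (nat \<lfloor>2 ^ k * enn2real t\<rfloor>)) / 2 ^ k))"

lemma dyadic_above:
  assumes "t \<in> time_set R"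
  shows "dyadic_above R k t \<in> time_set R" "t \<le> dyadic_above R k t"
    "t < R \<Longrightarrow> t < dyadic_above R k t" "dyadic_above R k t \<le> t + ennreal (1 / 2 ^ k)"
proof -
  from assms have t: "t \<le> R" "t < \<infinity>" by (auto simp: time_set_def)
  define x where "x = enn2real t"
  have x: "t = ennreal x" "0 \<le> x" using t(2) by (auto simp: x_def)
  define y where "y = real (Suc (nat \<lfloor>2 ^ k * x\<rfloor>)) / 2 ^ k"
  have d: "dyadic_above R k t = min R (ennreal y)"
    by (simp add: dyadic_above_def y_def x_def)
  have "x < y"
    unfolding y_def using x(2) by (simp add: pos_less_divide_eq mult.commute) linarith
  have "real (nat \<lfloor>2 ^ k * x\<rfloor>) \<le> 2 ^ k * x"
    using x(2) by simp
  then have "y \<le> (2 ^ k * x + 1) / 2 ^ k"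
    unfolding y_def by (intro divide_right_mono) auto
  also have "\<dots> = x + 1 / 2 ^ k"
    by (simp add: field_simps)
  finally have "y \<le> x + 1 / 2 ^ k" .
  then have "ennreal y \<le> t + ennreal (1 / 2 ^ k)"
    using x by (simp add: ennreal_plus[symmetric] del: ennreal_plus)
  then show "dyadic_above R k t \<le> t + ennreal (1 / 2 ^ k)" by (auto simp: d min_le_iff_disj)
  have "t < ennreal y" using \<open>x < y\<close> x by (simp add: ennreal_less_iff)
  then show "t \<le> dyadic_above R k t" "t < R \<Longrightarrow> t < dyadic_above R k t" using t(1) by (auto simp: d)
  show "dyadic_above R k t \<in> time_set R"
    unfolding d by (intro time_set_min) simp
qed

text \<open>With time rounded up to dyadic points only countably many sections of \<open>Y\<close>
  are involved, and right-continuity recovers \<open>Y\<close> in the limit. At \<open>t = R\<close>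
  there is no right limit, but the cap makes the approximation constant.\<close>

lemma right_continuous_jointly_measurable:
  assumes meas: "\<And>t. t \<in> time_set R \<Longrightarrow> Y t \<in> borel_measurable N"
    and rc: "\<And>\<omega>. \<omega> \<in> space N \<Longrightarrow> right_continuous_path R (\<lambda>t. Y t \<omega>)"
  shows "(\<lambda>(\<omega>, t). Y t \<omega>) \<in> borel_measurable (N \<Otimes>\<^sub>M time_borel R)"
proof (rule borel_measurable_LIMSEQ_real)
  let ?d = "dyadic_above R"
  fix k
  show "(\<lambda>(\<omega>, t). Y (?d k t) \<omega>) \<in> borel_measurable (N \<Otimes>\<^sub>M time_borel R)"
  proof -
    let ?q = "\<lambda>i::nat. min R (ennreal (real (Suc i) / 2 ^ k))"
    have "?q i \<in> time_set R" for i
      by (intro time_set_min) simp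
    then have [measurable]: "Y (?q i) \<in> borel_measurable N" for i
      by (rule meas)
    have e: "enn2real \<in> borel_measurable (time_borel R)"
      by (rule measurable_restrict_space1) simp
    then have [measurable]: "(\<lambda>z. nat \<lfloor>2 ^ k * enn2real (snd z)\<rfloor>) \<in>
        N \<Otimes>\<^sub>M time_borel R \<rightarrow>\<^sub>M count_space UNIV"
      by measurable
    have "(\<lambda>z. Y (?q (nat \<lfloor>2 ^ k * enn2real (snd z)\<rfloor>)) (fst z)) \<in>
        borel_measurable (N \<Otimes>\<^sub>M time_borel R)"
      by measurable
    then show ?thesis
      by (simp add: dyadic_above_def case_prod_beta)
  qed
next
  let ?d = "dyadic_above R"
  fix z assume "z \<in> space (N \<Otimes>\<^sub>M time_borel R)"
  then obtain \<omega> t where z: "z = (\<omega>, t)" "\<omega> \<in> space N" "t \<in> time_set R"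
    by (auto simp: space_pair_measure)
  show "(\<lambda>k. case z of (\<omega>, t) \<Rightarrow> Y (?d k t) \<omega>) \<longlonglongrightarrow> (case z of (\<omega>, t) \<Rightarrow> Y t \<omega>)"
  proof (cases "t < R")
    case True
    have "(\<lambda>k. t + ennreal (1 / 2 ^ k)) \<longlonglongrightarrow> t + ennreal 0"
      by (intro tendsto_intros) (auto intro!: LIMSEQ_divide_realpow_zero)
    then have lim: "(\<lambda>k. t + ennreal (1 / 2 ^ k)) \<longlonglongrightarrow> t" by simp
    have "(\<lambda>k. ?d k t) \<longlonglongrightarrow> t"
    proof (rule tendsto_sandwich[OF _ _ tendsto_const lim])
      show "\<forall>\<^sub>F k in sequentially. t \<le> ?d k t"
        by (intro always_eventually allI dyadic_above(2) z(3))
      show "\<forall>\<^sub>F k in sequentially. ?d k t \<le> t + ennreal (1 / 2 ^ k)"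
        by (intro always_eventually allI dyadic_above(4) z(3))
    qed
    then have "filterlim (\<lambda>k. ?d k t) (at_right t) sequentially"
      unfolding filterlim_at using dyadic_above(3)[OF z(3) True]
      by (auto simp: less_imp_neq[THEN not_sym] intro!: always_eventually)
    moreover have "((\<lambda>s. Y s \<omega>) \<longlongrightarrow> Y t \<omega>) (at_right t)"
      using rc[OF z(2)] z(3) True unfolding right_continuous_path_def continuous_within by blast
    ultimately have "(\<lambda>k. Y (?d k t) \<omega>) \<longlonglongrightarrow> Y t \<omega>"
      by (rule filterlim_compose[rotated])
    then show ?thesis by (simp add: z(1))
  next
    case False
    then have "t = R" using z(3) by (auto simp: time_set_def)
    then have "?d k t = t" for k
      using dyadic_above(1,2)[OF z(3), of k] by (auto simp: time_set_def)
    then show ?thesis by (simp add: z(1))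
  qed
qed

lemma right_continuous_path_mono:
  assumes "right_continuous_path T X" "R \<le> T"
  shows "right_continuous_path R X"
  using assms time_set_subset[OF assms(2)] unfolding right_continuous_path_def
  by (meson order_less_le_trans subset_iff)

section \<open>The optional sigma-algebra\<close>

lemma space_optional_sigma [simp]: "space (optional_sigma M F T) = space M \<times> time_set T"
  unfolding optional_sigma_def by (intro space_measure_of) auto

text \<open>Checked on the generators, which are jointly measurable. With \<open>F t\<close> for
  \<open>N\<close> and \<open>t\<close> for \<open>R\<close> this is progressive measurability of
  optional processes; with \<open>M\<close> and \<open>T\<close> it is joint measurability.\<close>

lemma optional_sigma_measurable_id:
  assumes "R \<le> T" "space N = space M"
    and sub: "\<And>t. t \<in> time_set R \<Longrightarrow> space (F t) = space M \<and> sets (F t) \<subseteq> sets N"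
  shows "(\<lambda>z. z) \<in> N \<Otimes>\<^sub>M time_borel R \<rightarrow>\<^sub>M optional_sigma M F T"
  unfolding optional_sigma_def
proof (rule measurable_measure_of)
  show "(\<lambda>z. z) \<in> space (N \<Otimes>\<^sub>M time_borel R) \<rightarrow> space M \<times> time_set T"
    using time_set_subset[OF assms(1)] assms(2) by (auto simp: space_pair_measure)
next
  fix A assume "A \<in> {{(\<omega>, t). (\<omega>, t) \<in> space M \<times> time_set T \<and> Y t \<omega> \<in> B} | Y B.
        B \<in> sets borel \<and> adapted F T Y \<and>
        (\<forall>\<omega>\<in>space M. right_continuous_path T (\<lambda>t. Y t \<omega>))}"
  then obtain Y B where A: "A = {(\<omega>, t). (\<omega>, t) \<in> space M \<times> time_set T \<and> Y t \<omega> \<in> B}"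
    and B: "B \<in> sets borel" and Y: "adapted F T Y" "\<forall>\<omega>\<in>space M. right_continuous_path T (\<lambda>t. Y t \<omega>)"
    by blast
  have m: "(\<lambda>(\<omega>, t). Y t \<omega>) \<in> borel_measurable (N \<Otimes>\<^sub>M time_borel R)"
  proof (rule right_continuous_jointly_measurable)
    fix t assume t: "t \<in> time_set R"
    then have "Y t \<in> borel_measurable (F t)"
      using Y(1) time_set_subset[OF assms(1)] unfolding adapted_def by blast
    moreover have "subalgebra N (F t)"
      using sub[OF t] assms(2) by (auto simp: subalgebra_def)
    ultimately show "Y t \<in> borel_measurable N"
      by (rule measurable_from_subalg[rotated])
  next
    fix \<omega> assume "\<omega> \<in> space N"
    then show "right_continuous_path R (\<lambda>t. Y t \<omega>)"
      using Y(2) assms(1,2) right_continuous_path_mono by metis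
  qed
  have "(\<lambda>z. z) -` A \<inter> space (N \<Otimes>\<^sub>M time_borel R) =
      (\<lambda>(\<omega>, t). Y t \<omega>) -` B \<inter> space (N \<Otimes>\<^sub>M time_borel R)"
    using time_set_subset[OF assms(1)] assms(2) by (auto simp: A space_pair_measure)
  also have "\<dots> \<in> sets (N \<Otimes>\<^sub>M time_borel R)"
    by (rule measurable_sets[OF m B])
  finally show "(\<lambda>z. z) -` A \<inter> space (N \<Otimes>\<^sub>M time_borel R) \<in> sets (N \<Otimes>\<^sub>M time_borel R)" .
qed auto

lemma (in sigma_finite_measure) borel_measurable_integral_path:
  assumes "(\<lambda>(\<omega>, s). \<rho> s \<omega>) \<in> borel_measurable (N \<Otimes>\<^sub>M M)"
  shows "(\<lambda>\<omega>. \<integral>s. (\<rho> s \<omega> :: real) \<partial>M) \<in> borel_measurable N"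
  using borel_measurable_lebesgue_integral[of "\<lambda>\<omega> s. \<rho> s \<omega>" N] assms by simp

section \<open>The integrated discount rate\<close>

lemma cum_cong:
  assumes "\<And>s. s \<in> time_set t \<Longrightarrow> \<rho> s \<omega> = \<rho>' s \<omega>"
  shows "cum \<rho> t \<omega> = cum \<rho>' t \<omega>"
  unfolding cum_def by (rule Bochner_Integration.integral_cong) (use assms in auto)

text \<open>From \<open>t\<close> to \<open>s\<close> the integral grows by at most
  \<open>K * (s - t)\<close>. The squeeze is done for the nonnegative integral \<open>G\<close>,
  where no integrability is at stake; finiteness of \<open>G t\<close> transfers the limit to real
  values.\<close>

lemma cum_right_continuous:
  assumes meas: "(\<lambda>s. \<rho> s \<omega>) \<in> borel_measurable (time_borel T)"
    and bounds: "\<And>s. 0 \<le> \<rho> s \<omega>" "\<And>s. \<rho> s \<omega> \<le> K"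
  shows "right_continuous_path T (\<lambda>t. cum \<rho> t \<omega>)"
  unfolding right_continuous_path_def
proof (intro ballI impI)
  fix t assume t: "t \<in> time_set T" "t < T"
  define G where "G s = (\<integral>\<^sup>+v. ennreal (\<rho> v \<omega>) \<partial>dt s)" for s
  have K: "0 \<le> K" using bounds[of 0] by linarith
  have meas_s: "(\<lambda>v. \<rho> v \<omega>) \<in> borel_measurable (dt s)" if "s \<le> T" for s
  proof -
    have "(\<lambda>v. \<rho> v \<omega>) \<in> borel_measurable (time_borel s)"
      by (rule measurable_restrict_mono[OF meas time_set_subset[OF that]])
    then show ?thesis by simp
  qed
  have cum_G: "cum \<rho> s \<omega> = enn2real (G s)" if "s \<le> T" for s
    unfolding cum_def G_def using bounds(1) meas_s[OF that] by (intro integral_eq_nn_integral) auto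
  have G_eq: "G s = (\<integral>\<^sup>+v. ennreal (\<rho> v \<omega>) * indicator {..s} v \<partial>dt T)" if "s \<le> T" for s
    unfolding G_def using meas that by (intro nn_integral_dt_restrict) auto
  have G_fin: "G s \<le> ennreal K * s" if "s \<in> time_set T" for s
  proof -
    have "G s \<le> (\<integral>\<^sup>+v. ennreal K * indicator {0..s} v \<partial>dt T)"
      unfolding G_eq[OF that[unfolded time_set_def, simplified, THEN conjunct1]]
      using bounds(2) by (intro nn_integral_mono) (auto simp: indicator_def ennreal_leI)
    also have "\<dots> = ennreal K * s"
    proof -
      have "{0..s} \<in> sets (dt T)"
        using that by (auto simp: sets_restrict_space_iff intro: time_set_le)
      then show ?thesis
        using emeasure_dt_le[OF _ that, of 0] by (simp add: nn_integral_cmult_indicator)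
    qed
    finally show ?thesis .
  qed
  have G_le: "G s \<le> G t + ennreal K * (s - t)" and G_mono: "G t \<le> G s"
    if s: "s \<in> time_set T" "t < s" for s
  proof -
    have sT: "s \<le> T" and tT: "t \<le> T" using s t by (auto simp: time_set_def)
    have ts: "{t..s} \<in> sets (dt T)"
      using s by (auto simp: sets_restrict_space_iff intro: time_set_le)
    have m: "(\<lambda>v. ennreal (\<rho> v \<omega>) * indicator {..t} v) \<in> borel_measurable (dt T)"
    proof (rule borel_measurable_times_ennreal)
      have "(indicator {..t} :: _ \<Rightarrow> ennreal) \<in> borel_measurable (time_borel T)"
        by (rule measurable_restrict_space1) simp
      then show "(indicator {..t} :: _ \<Rightarrow> ennreal) \<in> borel_measurable (dt T)" by (simp only: measurable_dt)
    qed (use meas_s[OF order_refl] in simp)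
    have "G s \<le> (\<integral>\<^sup>+v. ennreal (\<rho> v \<omega>) * indicator {..t} v + ennreal K * indicator {t..s} v \<partial>dt T)"
      unfolding G_eq[OF sT] using bounds(2)
      by (intro nn_integral_mono) (auto simp: indicator_def ennreal_leI)
    also have "\<dots> = G t + ennreal K * (s - t)"
      unfolding G_eq[OF tT]
      using m ts emeasure_dt_le[OF less_imp_le[OF s(2)] s(1)]
      by (subst nn_integral_add) (auto simp: nn_integral_cmult_indicator)
    finally show "G s \<le> G t + ennreal K * (s - t)" .
    show "G t \<le> G s"
      unfolding G_eq[OF sT] G_eq[OF tT]
      using s(2) by (intro nn_integral_mono) (auto simp: indicator_def)
  qed
  have "G t < \<infinity>"
    using G_fin[OF t(1)] t(1) by (auto simp: time_set_def ennreal_mult_less_top order_le_less_trans)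
  have "\<forall>\<^sub>F s in at_right t. s \<in> time_set T \<and> t < s"
    unfolding eventually_at_right[OF t(2)] by (intro exI[of _ T]) (auto simp: t(2) time_set_less)
  then have ev: "\<forall>\<^sub>F s in at_right t. G t \<le> G s \<and> G s \<le> G t + ennreal K * (s - t)"
    by eventually_elim (use G_le G_mono in auto)
  have "((\<lambda>s. s - t) \<longlongrightarrow> t - t) (at_right t)"
    using t by (intro tendsto_diff_ennreal tendsto_ident_at tendsto_const) (auto simp: time_set_def)
  moreover have "t - t = 0" using t by (auto simp: time_set_def diff_eq_0_iff_ennreal)
  ultimately have "((\<lambda>s. s - t) \<longlongrightarrow> 0) (at_right t)" by simp
  then have "((\<lambda>s. G t + ennreal K * (s - t)) \<longlongrightarrow> G t + ennreal K * 0) (at_right t)"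
    by (intro tendsto_add tendsto_const tendsto_mult_ennreal) auto
  then have lim: "((\<lambda>s. G t + ennreal K * (s - t)) \<longlongrightarrow> G t) (at_right t)"
    by simp
  have "(G \<longlongrightarrow> G t) (at_right t)"
  proof (rule tendsto_sandwich[OF _ _ tendsto_const lim])
    show "\<forall>\<^sub>F s in at_right t. G t \<le> G s" using ev by (rule eventually_mono) simp
    show "\<forall>\<^sub>F s in at_right t. G s \<le> G t + ennreal K * (s - t)" using ev by (rule eventually_mono) simp
  qed
  then have "((\<lambda>s. enn2real (G s)) \<longlongrightarrow> enn2real (G t)) (at_right t)"
    using \<open>G t < \<infinity>\<close> by (intro tendsto_enn2real) auto
  moreover have "\<forall>\<^sub>F s in at_right t. enn2real (G s) = cum \<rho> s \<omega>"
    using \<open>\<forall>\<^sub>F s in at_right t. s \<in> time_set T \<and> t < s\<close>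
    by eventually_elim (simp add: cum_G time_set_def)
  ultimately have "((\<lambda>s. cum \<rho> s \<omega>) \<longlongrightarrow> enn2real (G t)) (at_right t)"
    by (rule Lim_transform_eventually)
  then have "((\<lambda>s. cum \<rho> s \<omega>) \<longlongrightarrow> cum \<rho> t \<omega>) (at_right t)"
    by (simp only: cum_G[OF less_imp_le[OF t(2)]])
  then show "continuous (at_right t) (\<lambda>t. cum \<rho> t \<omega>)"
    by (simp add: continuous_within)
qed

section \<open>Processes under the usual conditions and their regular versions\<close>

context usual_filtered_space
begin

lemma space_F_eq [simp]: "space (F t) = space M"
  by (rule space_F)

lemma sets_F_subset: "sets (F t) \<subseteq> sets M"
  using subalg[of t] by (simp add: subalgebra_def)

lemma measurable_F: "X \<in> borel_measurable (F t) \<Longrightarrow> X \<in> borel_measurable M"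
  by (rule measurable_from_subalg[OF subalg])

lemma null_sets_F: "B \<in> null_sets M \<Longrightarrow> A \<subseteq> B \<Longrightarrow> A \<in> sets (F t)"
  using complete[of B A] sets_F_mono[of 0 t] by auto

text \<open>Completeness puts every subset of a null set into \<open>F t\<close>, so changes on null
  sets do not disturb adaptedness.\<close>

lemma borel_measurable_F_AE:
  fixes X X' :: "'a \<Rightarrow> real"
  assumes X: "X \<in> borel_measurable (F t)" and "AE \<omega> in M. X \<omega> = X' \<omega>"
  shows "X' \<in> borel_measurable (F t)"
proof (rule measurableI)
  obtain N where N: "{\<omega> \<in> space M. X \<omega> \<noteq> X' \<omega>} \<subseteq> N" "N \<in> null_sets M"
    using assms(2) by (auto elim!: AE_E simp: null_sets_def)
  fix B :: "real set" assume "B \<in> sets borel"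
  then have B: "X -` B \<inter> space M \<in> sets (F t)"
    using measurable_sets[OF X] by simp
  have "X' -` B \<inter> space (F t) = (X -` B \<inter> space M - N) \<union> (X' -` B \<inter> space M \<inter> N)"
    using N(1) by auto
  also have "\<dots> \<in> sets (F t)"
    using B null_sets_F[OF N(2)] by (intro sets.Un sets.Diff) auto
  finally show "X' -` B \<inter> space (F t) \<in> sets (F t)" .
qed simp

lemma optional_progressive:
  assumes "f \<in> borel_measurable (optional_sigma M F T)" "t \<in> time_set T"
  shows "f \<in> borel_measurable (F t \<Otimes>\<^sub>M time_borel t)"
proof -
  have "(\<lambda>z. z) \<in> F t \<Otimes>\<^sub>M time_borel t \<rightarrow>\<^sub>M optional_sigma M F T"
    using assms(2) sets_F_mono by (intro optional_sigma_measurable_id) (auto simp: time_set_def)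
  from measurable_compose[OF this assms(1)] show ?thesis .
qed

lemma optional_jointly_measurable:
  assumes "f \<in> borel_measurable (optional_sigma M F T)"
  shows "f \<in> borel_measurable (M \<Otimes>\<^sub>M time_borel T)"
proof -
  have "(\<lambda>z. z) \<in> M \<Otimes>\<^sub>M time_borel T \<rightarrow>\<^sub>M optional_sigma M F T"
    using sets_F_subset by (intro optional_sigma_measurable_id) auto
  from measurable_compose[OF this assms] show ?thesis .
qed

lemma optional_adapted:
  assumes "optional M F T X"
  shows "adapted F T X"
  unfolding adapted_def
proof
  fix t assume t: "t \<in> time_set T"
  obtain Y where Y: "(\<lambda>(\<omega>, t). Y t \<omega>) \<in> borel_measurable (optional_sigma M F T)"
    "AE \<omega> in M. \<forall>t\<in>time_set T. X t \<omega> = Y t \<omega>"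
    using assms unfolding optional_def by blast
  have "t \<in> space (time_borel t)" using t by (simp add: time_set_def)
  then have "(\<lambda>\<omega>. (\<omega>, t)) \<in> F t \<rightarrow>\<^sub>M F t \<Otimes>\<^sub>M time_borel t" by simp
  from measurable_compose[OF this optional_progressive[OF Y(1) t]]
  have "Y t \<in> borel_measurable (F t)" by simp
  moreover have "AE \<omega> in M. Y t \<omega> = X t \<omega>"
    using Y(2) t by auto
  ultimately show "X t \<in> borel_measurable (F t)"
    by (rule borel_measurable_F_AE)
qed

text \<open>Turns an almost sure path property into one of all paths: on a single null set, common
  to all times, the path is replaced by the zero path, which has to satisfy \<open>Q\<close> as
  well.\<close>

lemma regular_version:
  assumes "adapted F T X" "AE \<omega> in M. Q (\<lambda>t. X t \<omega>)" "Q (\<lambda>_. 0)"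
  obtains Y where "adapted F T Y" "\<And>\<omega>. \<omega> \<in> space M \<Longrightarrow> Q (\<lambda>t. Y t \<omega>)" "AE \<omega> in M. \<forall>t. X t \<omega> = Y t \<omega>"
proof -
  obtain N where N: "{\<omega> \<in> space M. \<not> Q (\<lambda>t. X t \<omega>)} \<subseteq> N" "N \<in> null_sets M"
    using assms(2) by (auto elim!: AE_E simp: null_sets_def)
  define Y where "Y t \<omega> = (if \<omega> \<in> N then 0 else X t \<omega>)" for t \<omega>
  have AE: "AE \<omega> in M. \<forall>t. X t \<omega> = Y t \<omega>"
    using AE_not_in[OF N(2)] by eventually_elim (simp add: Y_def)
  show ?thesis
  proof
    show "adapted F T Y"
      unfolding adapted_def
    proof
      fix t assume "t \<in> time_set T"
      then have "X t \<in> borel_measurable (F t)" using assms(1) by (simp add: adapted_def)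
      moreover have "AE \<omega> in M. X t \<omega> = Y t \<omega>" using AE by auto
      ultimately show "Y t \<in> borel_measurable (F t)" by (rule borel_measurable_F_AE)
    qed
    show "Q (\<lambda>t. Y t \<omega>)" if "\<omega> \<in> space M" for \<omega>
      using N(1) that assms(3) by (cases "\<omega> \<in> N") (auto simp: Y_def)
  qed (rule AE)
qed

lemma right_continuous_optional_sigma:
  assumes "adapted F T Y" "\<And>\<omega>. \<omega> \<in> space M \<Longrightarrow> right_continuous_path T (\<lambda>t. Y t \<omega>)"
  shows "(\<lambda>(\<omega>, t). Y t \<omega>) \<in> borel_measurable (optional_sigma M F T)"
proof (rule measurableI)
  fix B :: "real set" assume B: "B \<in> sets borel"
  have "(\<lambda>(\<omega>, t). Y t \<omega>) -` B \<inter> space (optional_sigma M F T) =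
      {(\<omega>, t) \<in> space M \<times> time_set T. Y t \<omega> \<in> B}"
    by auto
  also have "\<dots> \<in> sets (optional_sigma M F T)"
    unfolding optional_sigma_def using assms B by (intro in_measure_of) blast+
  finally show "(\<lambda>(\<omega>, t). Y t \<omega>) -` B \<inter> space (optional_sigma M F T) \<in> sets (optional_sigma M F T)" .
qed simp

lemma right_continuous_path_0: "right_continuous_path T (\<lambda>_. 0)"
  by (simp add: right_continuous_path_def)

text \<open>Progressive measurability makes the integral up to \<open>t\<close> an
  \<open>F t\<close>-measurable variable, and boundedness makes it right-continuous. Both are
  applied to a truncation of an optional version of \<open>r\<close>.\<close>

lemma discount_version:
  assumes "optional M F T r" "strictly_positive_bounded M T r"
  obtains R where "adapted F T R" "\<And>\<omega>. \<omega> \<in> space M \<Longrightarrow> right_continuous_path T (\<lambda>t. R t \<omega>)"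
    "AE \<omega> in M. \<forall>t\<in>time_set T. cum r t \<omega> = R t \<omega>"
proof -
  obtain Y where Y: "(\<lambda>(\<omega>, t). Y t \<omega>) \<in> borel_measurable (optional_sigma M F T)"
    "AE \<omega> in M. \<forall>t\<in>time_set T. r t \<omega> = Y t \<omega>"
    using assms(1) unfolding optional_def by blast
  obtain K where K: "AE \<omega> in M. \<forall>t\<in>time_set T. 0 < r t \<omega> \<and> r t \<omega> \<le> K"
    using assms(2) unfolding strictly_positive_bounded_def by blast
  \<comment> \<open>Truncation makes the bounds hold everywhere instead of almost surely; the
    absolute value is taken because nothing is known about the sign of \<open>K\<close>.\<close>
  define \<rho> where "\<rho> t \<omega> = max 0 (min (Y t \<omega>) \<bar>K\<bar>)" for t \<omega>
  have [measurable]: "(\<lambda>(\<omega>, t). \<rho> t \<omega>) \<in> borel_measurable (optional_sigma M F T)"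
    using Y(1) unfolding \<rho>_def split_beta' by measurable
  show ?thesis
  proof
    show "adapted F T (cum \<rho>)"
      unfolding adapted_def cum_def
    proof
      fix t assume "t \<in> time_set T"
      then have "(\<lambda>(\<omega>, s). \<rho> s \<omega>) \<in> borel_measurable (F t \<Otimes>\<^sub>M time_borel t)"
        by (intro optional_progressive) measurable
      then have "(\<lambda>(\<omega>, s). \<rho> s \<omega>) \<in> borel_measurable (F t \<Otimes>\<^sub>M dt t)"
        by (simp cong: measurable_cong_sets sets_pair_measure_cong)
      then show "(\<lambda>\<omega>. \<integral>s. \<rho> s \<omega> \<partial>dt t) \<in> borel_measurable (F t)"
        by (rule dt.borel_measurable_integral_path)
    qed
    show "right_continuous_path T (\<lambda>t. cum \<rho> t \<omega>)" if "\<omega> \<in> space M" for \<omega>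
    proof (rule cum_right_continuous[of _ _ _ "\<bar>K\<bar>"])
      have "(\<lambda>(\<omega>, t). \<rho> t \<omega>) \<in> borel_measurable (M \<Otimes>\<^sub>M time_borel T)"
        by (intro optional_jointly_measurable) measurable
      from measurable_compose[OF measurable_Pair1'[OF that] this]
      show "(\<lambda>s. \<rho> s \<omega>) \<in> borel_measurable (time_borel T)" by simp
    qed (auto simp: \<rho>_def)
    show "AE \<omega> in M. \<forall>t\<in>time_set T. cum r t \<omega> = cum \<rho> t \<omega>"
      using Y(2) K
    proof eventually_elim
      case (elim \<omega>)
      show ?case
      proof
        fix t assume t: "t \<in> time_set T"
        show "cum r t \<omega> = cum \<rho> t \<omega>"
        proof (rule cum_cong)
          fix s assume "s \<in> time_set t"
          then have s: "s \<in> time_set T" using t by (auto simp: time_set_def)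
          with elim(2) have "0 < r s \<omega>" "r s \<omega> \<le> K" by auto
          with elim(1) s show "r s \<omega> = \<rho> s \<omega>"
            by (simp add: \<rho>_def)
        qed
      qed
    qed
  qed
qed

end

section \<open>Concave utility\<close>

lemma utilityD:
  assumes "utility_function u"
  shows utility_nonneg: "0 \<le> x \<Longrightarrow> 0 \<le> c \<Longrightarrow> 0 \<le> u x c"
    and utility_mono: "0 \<le> x \<Longrightarrow> 0 \<le> c \<Longrightarrow> x \<le> x' \<Longrightarrow> c \<le> c' \<Longrightarrow> u x c \<le> u x' c'"
    and utility_strictly_concave: "0 \<le> x \<Longrightarrow> 0 \<le> c \<Longrightarrow> 0 \<le> x' \<Longrightarrow> 0 \<le> c' \<Longrightarrow> (x, c) \<noteq> (x', c') \<Longrightarrow>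
        0 < a \<Longrightarrow> a < 1 \<Longrightarrow>
        (1 - a) * u x c + a * u x' c' < u ((1 - a) * x + a * x') ((1 - a) * c + a * c')"
    and utility_partials: "has_continuous_partials u"
    and utility_inada: "0 < c \<Longrightarrow> filterlim (\<lambda>x. D\<^sub>x u x c) at_top (at_right 0)"
      "0 < c \<Longrightarrow> ((\<lambda>x. D\<^sub>x u x c) \<longlongrightarrow> 0) at_top"
proof -
  note 1 = assms[unfolded utility_function_def]
  note 2 = 1[THEN conjunct2] note 3 = 2[THEN conjunct2] note 4 = 3[THEN conjunct2]
  note 7 = 4[THEN conjunct2, THEN conjunct2, THEN conjunct2, THEN conjunct2]
  show "0 \<le> x \<Longrightarrow> 0 \<le> c \<Longrightarrow> 0 \<le> u x c"
    using 1[THEN conjunct1] by simp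
  show "0 \<le> x \<Longrightarrow> 0 \<le> c \<Longrightarrow> x \<le> x' \<Longrightarrow> c \<le> c' \<Longrightarrow> u x c \<le> u x' c'"
    using 2[THEN conjunct1] by blast
  show "0 \<le> x \<Longrightarrow> 0 \<le> c \<Longrightarrow> 0 \<le> x' \<Longrightarrow> 0 \<le> c' \<Longrightarrow> (x, c) \<noteq> (x', c') \<Longrightarrow> 0 < a \<Longrightarrow> a < 1 \<Longrightarrow>
      (1 - a) * u x c + a * u x' c' < u ((1 - a) * x + a * x') ((1 - a) * c + a * c')"
    using 3[THEN conjunct1] by simp
  show "has_continuous_partials u"
    using 4[THEN conjunct1] .
  show "0 < c \<Longrightarrow> filterlim (\<lambda>x. D\<^sub>x u x c) at_top (at_right 0)"
    "0 < c \<Longrightarrow> ((\<lambda>x. D\<^sub>x u x c) \<longlongrightarrow> 0) at_top"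
    using 7 by simp_all
qed

text \<open>Total differentiability is what allows \<open>u\<close> to be differentiated along
  segments in arbitrary directions. It follows from both partials together with continuity of the
  second.\<close>

lemma has_continuous_partials_has_derivative:
  assumes u: "has_continuous_partials u" and "0 < x" "0 < c"
  shows "((\<lambda>(x, c). u x c) has_derivative (\<lambda>(a, b). D\<^sub>x u x c * a + D\<^sub>c u x c * b)) (at (x, c))"
proof -
  have c: "isCont (\<lambda>(x, c). D\<^sub>c u x c) (x, c)"
  proof -
    have "continuous_on ({0<..} \<times> {0<..}) (\<lambda>(x, c). D\<^sub>c u x c)"
      using u by (simp add: has_continuous_partials_def)
    moreover have "open ({0<..} \<times> {0<..} :: (real \<times> real) set)"
      by (intro open_Times) auto
    ultimately show ?thesis
      using assms(2,3) by (subst (asm) continuous_on_eq_continuous_at) auto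
  qed
  have "((\<lambda>(x, c). u x c) has_derivative
      (\<lambda>(a, b). D\<^sub>x u x c * a + blinfun_apply (blinfun_mult_right (D\<^sub>c u x c)) b))
      (at (x, c) within {0<..} \<times> {0<..})"
  proof (rule has_derivative_partialsI)
    have "((\<lambda>y. u y c) has_field_derivative D\<^sub>x u x c) (at x)"
      using u assms(2,3) unfolding has_continuous_partials_def D\<^sub>x_def
      by (auto simp: DERIV_deriv_iff_field_differentiable)
    then show "((\<lambda>y. u y c) has_derivative (*) (D\<^sub>x u x c)) (at x within {0<..})"
      by (auto simp: has_field_derivative_def intro: has_derivative_at_withinI)
  next
    fix y d :: real assume "y \<in> {0<..}" "d \<in> {0<..}"
    then have "((\<lambda>d. u y d) has_field_derivative D\<^sub>c u y d) (at d)"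
      using u unfolding has_continuous_partials_def D\<^sub>c_def
      by (auto simp: DERIV_deriv_iff_field_differentiable)
    then show "(u y has_derivative blinfun_apply (blinfun_mult_right (D\<^sub>c u y d))) (at d within {0<..})"
      by (auto simp: has_field_derivative_def intro: has_derivative_at_withinI)
  next
    have "continuous (at (x, c)) (\<lambda>z. blinfun_mult_right (case z of (x, c) \<Rightarrow> D\<^sub>c u x c))"
      by (rule bounded_linear.continuous[OF bounded_linear_blinfun_mult_right c])
    moreover have "(\<lambda>z. blinfun_mult_right (case z of (x, c) \<Rightarrow> D\<^sub>c u x c)) =
        (\<lambda>(x, c). blinfun_mult_right (D\<^sub>c u x c))"
      by (auto simp: fun_eq_iff)
    ultimately show "continuous (at (x, c) within {0<..} \<times> {0<..}) (\<lambda>(x, c). blinfun_mult_right (D\<^sub>c u x c))"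
      by (metis continuous_at_imp_continuous_at_within)
  qed (use assms in auto)
  moreover have "at (x, c) within {0<..} \<times> {0<..} = at (x, c)"
    by (rule at_within_open) (use assms in \<open>auto intro!: open_Times\<close>)
  ultimately show ?thesis by simp
qed

text \<open>Along the segment to \<open>(x', c')\<close> concavity bounds the chord by the
  difference quotients at the starting point, which tend to the directional derivative. Only
  \<open>(x, c)\<close> has to be interior; the target may lie on the axes, where derivatives need
  not exist.\<close>

lemma utility_supergradient:
  assumes u: "utility_function u" and pos: "0 < x" "0 < c" and nonneg: "0 \<le> x'" "0 \<le> c'"
  shows "u x' c' \<le> u x c + D\<^sub>x u x c * (x' - x) + D\<^sub>c u x c * (c' - c)"
proof (cases "(x, c) = (x', c')")
  case False
  define \<phi> where "\<phi> t = u (x + t * (x' - x)) (c + t * (c' - c))" for t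
  define d where "d = D\<^sub>x u x c * (x' - x) + D\<^sub>c u x c * (c' - c)"
  have "((\<lambda>t. (x + t * (x' - x), c + t * (c' - c))) has_derivative
      (\<lambda>t. (t * (x' - x), t * (c' - c)))) (at 0)"
    by (auto intro!: derivative_eq_intros)
  moreover have "((\<lambda>(x, c). u x c) has_derivative (\<lambda>(a, b). D\<^sub>x u x c * a + D\<^sub>c u x c * b))
      (at (x + 0 * (x' - x), c + 0 * (c' - c)))"
    using has_continuous_partials_has_derivative[OF utility_partials[OF u] pos] by simp
  ultimately have "((\<lambda>t. case (x + t * (x' - x), c + t * (c' - c)) of (x, c) \<Rightarrow> u x c) has_derivative
      (\<lambda>t. case (t * (x' - x), t * (c' - c)) of (a, b) \<Rightarrow> D\<^sub>x u x c * a + D\<^sub>c u x c * b)) (at 0)"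
    by (rule has_derivative_compose)
  then have "(\<phi> has_derivative (\<lambda>t. d * t)) (at 0)"
    by (simp add: \<phi>_def[abs_def] d_def algebra_simps)
  then have "(\<phi> has_field_derivative d) (at 0)"
    by (simp add: has_field_derivative_def)
  then have "((\<lambda>t. (\<phi> t - \<phi> 0) / t) \<longlongrightarrow> d) (at_right 0)"
    unfolding has_field_derivative_iff by (auto intro: filterlim_mono[OF _ order_refl at_le])
  moreover have "\<forall>\<^sub>F t in at_right 0. u x' c' - u x c \<le> (\<phi> t - \<phi> 0) / t"
    unfolding eventually_at_right_field
  proof (intro exI[of _ 1] conjI allI impI)
    fix t :: real assume t: "0 < t" "t < 1"
    have "(1 - t) * u x c + t * u x' c' < u ((1 - t) * x + t * x') ((1 - t) * c + t * c')"
      using utility_strictly_concave[OF u _ _ nonneg False t] pos by simp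
    moreover have "(1 - t) * x + t * x' = x + t * (x' - x)" "(1 - t) * c + t * c' = c + t * (c' - c)"
      by (simp_all add: algebra_simps)
    ultimately have "t * (u x' c' - u x c) \<le> \<phi> t - \<phi> 0"
      by (simp add: \<phi>_def algebra_simps)
    then show "u x' c' - u x c \<le> (\<phi> t - \<phi> 0) / t"
      using t by (simp add: pos_le_divide_eq mult.commute)
  qed simp
  ultimately have "u x' c' - u x c \<le> d"
    by (intro tendsto_lowerbound) auto
  then show ?thesis by (simp add: d_def)
qed simp

text \<open>At the midpoint strict concavity gains strictly over the chord, and the weak inequality
  is applied there.\<close>

lemma utility_supergradient_strict:
  assumes u: "utility_function u" and pos: "0 < x" "0 < c" and nonneg: "0 \<le> x'" "0 \<le> c'"
    and neq: "(x, c) \<noteq> (x', c')"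
  shows "u x' c' < u x c + D\<^sub>x u x c * (x' - x) + D\<^sub>c u x c * (c' - c)"
proof -
  have "(1 - 1/2) * u x c + (1/2) * u x' c' < u ((1 - 1/2) * x + (1/2) * x') ((1 - 1/2) * c + (1/2) * c')"
    using pos nonneg neq by (intro utility_strictly_concave[OF u]) auto
  also have "\<dots> \<le> u x c + D\<^sub>x u x c * ((1 - 1/2) * x + (1/2) * x' - x)
      + D\<^sub>c u x c * ((1 - 1/2) * c + (1/2) * c' - c)"
    using pos nonneg by (intro utility_supergradient[OF u]) auto
  also have "\<dots> = u x c + (D\<^sub>x u x c * (x' - x) + D\<^sub>c u x c * (c' - c)) / 2"
    by (simp add: field_simps)
  finally show ?thesis by (simp add: field_simps)
qed

text \<open>Sum of the two strict supergradient inequalities between the points.\<close>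

lemma D\<^sub>x_strict_antimono:
  assumes u: "utility_function u" and "0 < x" "x < x'" "0 < c"
  shows "D\<^sub>x u x' c < D\<^sub>x u x c"
proof -
  have "u x' c < u x c + D\<^sub>x u x c * (x' - x) + D\<^sub>c u x c * (c - c)"
    by (rule utility_supergradient_strict[OF u]) (use assms in auto)
  moreover have "u x c < u x' c + D\<^sub>x u x' c * (x - x') + D\<^sub>c u x' c * (c - c)"
    by (rule utility_supergradient_strict[OF u]) (use assms in auto)
  ultimately have "D\<^sub>x u x' c * (x' - x) < D\<^sub>x u x c * (x' - x)"
    by (simp add: algebra_simps)
  with assms show ?thesis by simp
qed

lemma D\<^sub>c_nonneg:
  assumes "utility_function u" "0 < x" "0 < c"
  shows "0 \<le> D\<^sub>c u x c"
  using utility_supergradient[OF assms, of x "c + 1"] utility_mono[OF assms(1), of x c x "c + 1"] assms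
  by simp

section \<open>The inverse \<open>g\<close> of marginal utility and the function
  \<open>h\<close>\<close>

lemma continuous_on_D\<^sub>x:
  assumes "utility_function u" "0 < c"
  shows "continuous_on {0<..} (\<lambda>x. D\<^sub>x u x c)"
proof -
  have "continuous_on ({0<..} \<times> {0<..}) (\<lambda>(x, c). D\<^sub>x u x c)"
    using utility_partials[OF assms(1)] by (simp add: has_continuous_partials_def)
  moreover have "continuous_on {0<..} (\<lambda>x. (x, c))"
    by (intro continuous_intros)
  moreover have "(\<lambda>x. (x, c)) ` {0<..} \<subseteq> {0<..} \<times> {0<..}"
    using assms(2) by auto
  ultimately have "continuous_on {0<..} (\<lambda>x. case (x, c) of (x, c) \<Rightarrow> D\<^sub>x u x c)"
    by (rule continuous_on_compose2)
  then show ?thesis by simp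
qed

text \<open>The limits of \<open>D\<^sub>x u\<close> at \<open>0\<close> and at infinity and the
  intermediate value theorem give existence, its strict decrease uniqueness.\<close>

lemma g_inv:
  assumes u: "utility_function u" and "0 < \<psi>" "0 < c"
  shows g_inv_pos: "0 < g_inv u \<psi> c" and D\<^sub>x_g_inv: "D\<^sub>x u (g_inv u \<psi> c) c = \<psi>"
proof -
  have "\<forall>\<^sub>F x in at_right 0. \<psi> < D\<^sub>x u x c"
    using utility_inada(1)[OF u \<open>0 < c\<close>] by (simp add: filterlim_at_top_dense)
  then obtain b where b: "0 < b" "\<And>x. 0 < x \<Longrightarrow> x < b \<Longrightarrow> \<psi> < D\<^sub>x u x c"
    unfolding eventually_at_right_field by auto
  have "\<forall>\<^sub>F x in at_top. D\<^sub>x u x c < \<psi>"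
    using utility_inada(2)[OF u \<open>0 < c\<close>] \<open>0 < \<psi>\<close> by (rule order_tendstoD(2))
  then obtain N where N: "\<And>x. N \<le> x \<Longrightarrow> D\<^sub>x u x c < \<psi>"
    unfolding eventually_at_top_linorder by blast
  \<comment> \<open>\<open>b / 2\<close> lies inside the interval where the derivative exceeds
    \<psi>; the maximum with \<open>b\<close> keeps the endpoints ordered, as \<open>N\<close> may
    be small or negative.\<close>
  have "\<exists>x\<ge>b/2. x \<le> max N b \<and> D\<^sub>x u x c = \<psi>"
  proof (rule IVT2')
    show "D\<^sub>x u (max N b) c \<le> \<psi>" using N[of "max N b"] by simp
    show "\<psi> \<le> D\<^sub>x u (b/2) c" using b(1) b(2)[of "b/2"] by simp
    show "continuous_on {b/2..max N b} (\<lambda>x. D\<^sub>x u x c)"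
      by (rule continuous_on_subset[OF continuous_on_D\<^sub>x[OF u \<open>0 < c\<close>]]) (use b(1) in auto)
  qed (use b(1) in auto)
  then obtain x where x: "b / 2 \<le> x" "D\<^sub>x u x c = \<psi>" by blast
  with b(1) have "0 < x" by linarith
  note x = this x(2)
  have "y = x" if "0 < y" "D\<^sub>x u y c = \<psi>" for y
    using D\<^sub>x_strict_antimono[OF u, of x y c] D\<^sub>x_strict_antimono[OF u, of y x c] x that \<open>0 < c\<close>
    by (cases x y rule: linorder_cases) auto
  then have "\<exists>!x. 0 < x \<and> D\<^sub>x u x c = \<psi>"
    using x by blast
  from theI'[OF this] show "0 < g_inv u \<psi> c" "D\<^sub>x u (g_inv u \<psi> c) c = \<psi>"
    using assms(2,3) by (auto simp: g_inv_def)
qed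

lemma g_inv_nonneg:
  assumes "utility_function u"
  shows "0 \<le> g_inv u \<psi> c"
  using g_inv_pos[OF assms, of \<psi> c] by (cases "0 < \<psi> \<and> 0 < c") (auto simp: g_inv_def)

lemma h_fun_nonneg:
  assumes "utility_function u" "0 < \<psi>" "0 < c"
  shows "0 \<le> h_fun u \<psi> c"
  unfolding h_fun_def using D\<^sub>c_nonneg[OF assms(1) g_inv_pos[OF assms] assms(3)] .

text \<open>Since \<open>u\<^sub>x\<close> takes the same value \<open>\<psi>\<close> at both points \<open>(g(\<psi>, c), c)\<close>, monotonicity of the
  supergradient of the concave \<open>u\<close> reduces to that of \<open>u\<^sub>c\<close>.\<close>

lemma h_fun_antimono:
  assumes u: "utility_function u" and "0 < \<psi>" "0 < c" "c \<le> c'"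
  shows "h_fun u \<psi> c' \<le> h_fun u \<psi> c"
proof (cases "c = c'")
  case False
  define x x' where "x = g_inv u \<psi> c" and "x' = g_inv u \<psi> c'"
  have x: "0 < x" "D\<^sub>x u x c = \<psi>" "0 < x'" "D\<^sub>x u x' c' = \<psi>"
    unfolding x_def x'_def using g_inv[OF u] assms by auto
  have "u x' c' \<le> u x c + \<psi> * (x' - x) + h_fun u \<psi> c * (c' - c)"
    "u x c \<le> u x' c' + \<psi> * (x - x') + h_fun u \<psi> c' * (c - c')"
    using utility_supergradient[OF u x(1) \<open>0 < c\<close>, of x' c']
      utility_supergradient[OF u x(3), of c' x c] x assms
    by (simp_all add: h_fun_def x_def x'_def)
  then have "h_fun u \<psi> c' * (c' - c) \<le> h_fun u \<psi> c * (c' - c)"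
    by (simp add: algebra_simps)
  with False assms show ?thesis by simp
qed simp

section \<open>Measurability of the utility and of the functions derived from it\<close>

lemma borel_measurable_continuous_on_quadrant:
  fixes f :: "real \<Rightarrow> real \<Rightarrow> real"
  assumes "continuous_on ({0<..} \<times> {0<..}) (\<lambda>(x, c). f x c)"
  shows "(\<lambda>z. if 0 < fst z \<and> 0 < snd z then f (fst z) (snd z) else 0)
    \<in> borel_measurable (borel \<Otimes>\<^sub>M borel)"
proof -
  have "(\<lambda>z. if z \<in> {0<..} \<times> {0<..} then (\<lambda>(x, c). f x c) z else 0) \<in> borel_measurable borel"
    by (rule borel_measurable_continuous_on_if) (use assms in \<open>auto intro!: borel_open open_Times\<close>)
  then show ?thesis by (simp add: mem_Times_iff split_beta' borel_prod cong: if_cong)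
qed

text \<open>Inside the quadrant \<open>u\<close> is differentiable, hence continuous. On the axes no
  continuity is assumed, but there \<open>u\<close> is a monotone function of one variable. The
  maxima extend it to all real arguments.\<close>

lemma borel_measurable_utility:
  assumes u: "utility_function u"
  shows "(\<lambda>(x, c). u (max x 0) (max c 0)) \<in> borel_measurable (borel \<Otimes>\<^sub>M borel)"
proof -
  have "continuous_on ({0<..} \<times> {0<..}) (\<lambda>(x, c). u x c)"
  proof (rule has_derivative_continuous_on)
    fix z :: "real \<times> real" assume "z \<in> {0<..} \<times> {0<..}"
    then have "((\<lambda>(x, c). u x c) has_derivative
        (\<lambda>(a, b). D\<^sub>x u (fst z) (snd z) * a + D\<^sub>c u (fst z) (snd z) * b)) (at (fst z, snd z))"
      by (intro has_continuous_partials_has_derivative utility_partials[OF u]) auto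
    then show "((\<lambda>(x, c). u x c) has_derivative
        (\<lambda>(a, b). D\<^sub>x u (fst z) (snd z) * a + D\<^sub>c u (fst z) (snd z) * b)) (at z within {0<..} \<times> {0<..})"
      by (auto intro: has_derivative_at_withinI)
  qed
  from borel_measurable_continuous_on_quadrant[OF this]
  have 1: "(\<lambda>z. if 0 < fst z \<and> 0 < snd z then u (fst z) (snd z) else 0) \<in> borel_measurable (borel \<Otimes>\<^sub>M borel)" .
  have "mono (\<lambda>x. u (max x 0) 0)" "mono (\<lambda>c. u 0 (max c 0))"
    by (auto intro!: monoI utility_mono[OF u])
  then have [measurable]: "(\<lambda>x. u (max x 0) 0) \<in> borel_measurable borel" "(\<lambda>c. u 0 (max c 0)) \<in> borel_measurable borel"
    by (auto intro: borel_measurable_mono)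
  note 1 [measurable]
  have "(\<lambda>z. if 0 < fst z \<and> 0 < snd z then (if 0 < fst z \<and> 0 < snd z then u (fst z) (snd z) else 0)
      else if 0 < fst z then u (max (fst z) 0) 0 else u 0 (max (snd z) 0)) \<in> borel_measurable (borel \<Otimes>\<^sub>M borel)"
    by measurable
  then show ?thesis
    by (rule measurable_cong[THEN iffD1, rotated]) (auto simp: max_def)
qed

text \<open>Since \<open>D\<^sub>x u\<close> decreases strictly in \<open>x\<close>, for positive
  \<open>y\<close> the inequality \<open>y < g_inv u \<psi> c\<close> means
  \<open>\<psi> < D\<^sub>x u y c\<close>, which is measurable in both variables.\<close>

lemma borel_measurable_g_inv:
  assumes u: "utility_function u"
  shows "(\<lambda>(\<psi>, c). g_inv u \<psi> c) \<in> borel_measurable (borel \<Otimes>\<^sub>M borel)"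
proof (rule borel_measurableI_greater)
  fix y :: real
  let ?d = "\<lambda>z::real\<times>real. if 0 < fst z \<and> 0 < snd z then D\<^sub>x u (fst z) (snd z) else 0"
  have "continuous_on ({0<..} \<times> {0<..}) (\<lambda>(x, c). D\<^sub>x u x c)"
    using utility_partials[OF u] by (simp add: has_continuous_partials_def)
  note borel_measurable_continuous_on_quadrant[OF this, measurable]
  have iff: "y < g_inv u \<psi> c \<longleftrightarrow> y < 0 \<or> (0 < \<psi> \<and> 0 < c \<and> (y \<le> 0 \<or> \<psi> < ?d (y, c)))" for \<psi> c
  proof (cases "0 < \<psi> \<and> 0 < c")
    case True
    note g = g_inv[OF u True[THEN conjunct1] True[THEN conjunct2]]
    show ?thesis
    proof (cases "0 < y")
      case y: True
      have "y < g_inv u \<psi> c \<longleftrightarrow> \<psi> < D\<^sub>x u y c"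
        using D\<^sub>x_strict_antimono[OF u, of y "g_inv u \<psi> c" c]
          D\<^sub>x_strict_antimono[OF u, of "g_inv u \<psi> c" y c] g True y
        by (cases y "g_inv u \<psi> c" rule: linorder_cases) auto
      with True y show ?thesis by simp
    qed (use g True in auto)
  qed (auto simp: g_inv_def)
  have "{z \<in> space (borel \<Otimes>\<^sub>M borel). y < 0 \<or> (0 < fst z \<and> 0 < snd z \<and> (y \<le> 0 \<or> fst z < ?d (y, snd z)))}
      \<in> sets (borel \<Otimes>\<^sub>M borel)"
    by measurable
  moreover have "(y < (case z of (\<psi>, c) \<Rightarrow> g_inv u \<psi> c)) \<longleftrightarrow>
      y < 0 \<or> (0 < fst z \<and> 0 < snd z \<and> (y \<le> 0 \<or> fst z < ?d (y, snd z)))" for z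
    by (cases z) (simp only: case_prod_conv fst_conv snd_conv iff)
  ultimately show "{z \<in> space (borel \<Otimes>\<^sub>M borel). y < (case z of (\<psi>, c) \<Rightarrow> g_inv u \<psi> c)} \<in> sets (borel \<Otimes>\<^sub>M borel)"
    by (simp only:)
qed

text \<open>Outside the quadrant \<open>h\<close> is a derivative at a boundary point and may be ill-behaved.\<close>

lemma borel_measurable_h_fun:
  assumes u: "utility_function u"
  shows "(\<lambda>(\<psi>, c). if 0 < \<psi> \<and> 0 < c then h_fun u \<psi> c else 0) \<in> borel_measurable (borel \<Otimes>\<^sub>M borel)"
proof -
  let ?d = "\<lambda>z::real\<times>real. if 0 < fst z \<and> 0 < snd z then D\<^sub>c u (fst z) (snd z) else 0"
  have "continuous_on ({0<..} \<times> {0<..}) (\<lambda>(x, c). D\<^sub>c u x c)"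
    using utility_partials[OF u] by (simp add: has_continuous_partials_def)
  note borel_measurable_continuous_on_quadrant[OF this, measurable]
  note borel_measurable_g_inv[OF u, measurable]
  have "(\<lambda>z. if 0 < fst z \<and> 0 < snd z then ?d ((\<lambda>(\<psi>, c). g_inv u \<psi> c) z, snd z) else 0)
      \<in> borel_measurable (borel \<Otimes>\<^sub>M borel)"
    by measurable
  then show ?thesis
    by (rule measurable_cong[THEN iffD1, rotated]) (auto simp: h_fun_def g_inv_pos[OF u])
qed

section \<open>Hitting times and Stieltjes measures\<close>

text \<open>Inserting \<open>T\<close> gives the value \<open>T\<close> to levels that are never
  reached, so this value does not tell whether the level is reached at \<open>T\<close>.\<close>

definition hit :: "ennreal \<Rightarrow> (ennreal \<Rightarrow> real) \<Rightarrow> real \<Rightarrow> ennreal" where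
  "hit T C a = Inf (insert T {t \<in> time_set T. a \<le> C t})"

lemma hit_le: "hit T C a \<le> T"
  by (auto simp: hit_def intro: Inf_lower)

text \<open>Right-continuity makes the infimum attained. At \<open>t = T\<close> the left side would
  always hold.\<close>

lemma hit_le_iff:
  assumes C: "right_continuous_path T C" "mono_on (time_set T) C" and t: "t < T"
  shows "hit T C a \<le> t \<longleftrightarrow> a \<le> C t"
proof
  assume "a \<le> C t"
  then show "hit T C a \<le> t"
    unfolding hit_def using time_set_less[OF t] by (intro Inf_lower) simp
next
  assume le: "hit T C a \<le> t"
  show "a \<le> C t"
  proof (rule ccontr)
    assume "\<not> a \<le> C t"
    then have lt: "C t < a" by simp
    have "(C \<longlongrightarrow> C t) (at_right t)"
      using C(1) t time_set_less[OF t] by (auto simp: right_continuous_path_def continuous_within)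
    from order_tendstoD(2)[OF this lt]
    obtain b where b: "t < b" "\<And>s. t < s \<Longrightarrow> s < b \<Longrightarrow> C s < a"
      unfolding eventually_at_right[OF t] by blast
    have "min b T \<le> s" if s: "s \<in> insert T {t \<in> time_set T. a \<le> C t}" for s
    proof (cases "s = T")
      case False
      with s have s': "s \<in> time_set T" "a \<le> C s" by auto
      have "\<not> s \<le> t"
        using mono_onD[OF C(2) s'(1) time_set_less[OF t]] s'(2) lt by auto
      then have "\<not> s < b" using b(2)[of s] s'(2) by (auto simp: not_le)
      then show ?thesis by (simp add: min_le_iff_disj not_less)
    qed simp
    then have "min b T \<le> hit T C a"
      unfolding hit_def by (intro Inf_greatest)
    with le b(1) t show False
      by (meson leD min_less_iff_conj order_less_le_trans not_le)
  qed
qed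

lemma hit_less_iff:
  assumes C: "right_continuous_path T C" "mono_on (time_set T) C"
  shows "hit T C a < T \<longleftrightarrow> (\<exists>t<T. a \<le> C t)"
proof
  assume "hit T C a < T"
  then show "\<exists>t<T. a \<le> C t"
    using hit_le_iff[OF C, of "hit T C a" a] by auto
next
  assume "\<exists>t<T. a \<le> C t"
  then obtain t where "t < T" "a \<le> C t" by blast
  then show "hit T C a < T"
    using hit_le_iff[OF C, of t a] by (auto intro: order_le_less_trans)
qed

text \<open>Quantile transform: the generalized inverse \<rho> pulls the interval from
  \<open>s\<close> to \<open>t\<close> back to the levels from \<open>F s\<close> to
  \<open>F t\<close>, whose Lebesgue measure is the increment of \<open>F\<close>. Positive levels
  suffice because \<open>F\<close> starts from \<open>0\<close>.\<close>

lemma interval_measure_eq_distr: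
  fixes F :: "real \<Rightarrow> real"
  assumes mono: "\<And>x y. x \<le> y \<Longrightarrow> F x \<le> F y" and rc: "\<And>a. continuous (at_right a) F"
    and neg: "\<And>t. t < 0 \<Longrightarrow> F t = 0"
  defines "A \<equiv> {a. 0 < a \<and> (\<exists>t. a \<le> F t)}" and "\<rho> \<equiv> \<lambda>a. Inf {t. a \<le> F t}"
  shows "A \<in> sets borel"
    and "\<And>a s. a \<in> A \<Longrightarrow> \<rho> a \<le> s \<longleftrightarrow> a \<le> F s"
    and "\<rho> \<in> borel_measurable (restrict_space lborel A)"
    and "interval_measure F = distr (restrict_space lborel A) borel \<rho>"
proof -
  have F_nonneg: "0 \<le> F t" for t
    using mono[of "min t (- 1)" t] neg[of "min t (- 1)"] by simp
  have "A = (\<Union>n::nat. {0<..F (real n)})"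
  proof (intro set_eqI iffI)
    fix a assume "a \<in> A"
    then obtain t where "0 < a" "a \<le> F t" by (auto simp: A_def)
    moreover obtain n :: nat where "t \<le> real n" using real_arch_simple by blast
    ultimately have "a \<in> {0<..F (real n)}"
      using mono[of t "real n"] by auto
    then show "a \<in> (\<Union>n::nat. {0<..F (real n)})" by blast
  qed (auto simp: A_def)
  then show A: "A \<in> sets borel" by simp
  show \<rho>: "\<rho> a \<le> s \<longleftrightarrow> a \<le> F s" if a: "a \<in> A" for a s
  proof -
    have ne: "{t. a \<le> F t} \<noteq> {}" and pos: "0 < a" using a by (auto simp: A_def)
    have bdd: "bdd_below {t. a \<le> F t}"
      using neg pos by (intro bdd_belowI[of _ 0]) (metis mem_Collect_eq not_le order_less_le_trans)
    show ?thesis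
    proof
      assume "a \<le> F s"
      then show "\<rho> a \<le> s" unfolding \<rho>_def by (intro cInf_lower bdd) simp
    next
      assume le: "\<rho> a \<le> s"
      show "a \<le> F s"
      proof (rule ccontr)
        assume "\<not> a \<le> F s"
        then have lt: "F s < a" by simp
        have "(F \<longlongrightarrow> F s) (at_right s)" using rc[of s] by (simp add: continuous_within)
        from order_tendstoD(2)[OF this lt]
        obtain b where b: "s < b" "\<And>t. s < t \<Longrightarrow> t < b \<Longrightarrow> F t < a"
          unfolding eventually_at_right_field by blast
        have "b \<le> t" if "a \<le> F t" for t
        proof (rule ccontr)
          assume "\<not> b \<le> t"
          then show False
            using that b(2)[of t] mono[of t s] lt by (cases "s < t") auto
        qed
        then have "b \<le> \<rho> a" unfolding \<rho>_def by (intro cInf_greatest ne) simp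
        with le b(1) show False by simp
      qed
    qed
  qed
  show meas: "\<rho> \<in> borel_measurable (restrict_space lborel A)"
  proof (rule borel_measurableI_le)
    fix s
    have "{a \<in> space (restrict_space lborel A). \<rho> a \<le> s} = A \<inter> {..F s}"
      using \<rho> by (auto simp: space_restrict_space)
    then show "{a \<in> space (restrict_space lborel A). \<rho> a \<le> s} \<in> sets (restrict_space lborel A)"
      using A by (simp add: sets_restrict_space)
  qed
  have Ioc: "emeasure (distr (restrict_space lborel A) borel \<rho>) {s<..t} = ennreal (F t - F s)" if "s \<le> t" for s t
  proof -
    have "emeasure (distr (restrict_space lborel A) borel \<rho>) {s<..t} =
        emeasure (restrict_space lborel A) (\<rho> -` {s<..t} \<inter> A)"
      using meas by (subst emeasure_distr) (auto simp: space_restrict_space)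
    also have "\<rho> -` {s<..t} \<inter> A = {F s<..F t}"
    proof (intro set_eqI)
      fix a
      have "F s < a \<Longrightarrow> 0 < a" using F_nonneg[of s] by linarith
      then have "a \<in> {F s<..F t} \<Longrightarrow> a \<in> A" by (auto simp: A_def)
      moreover have "a \<in> A \<Longrightarrow> a \<in> \<rho> -` {s<..t} \<longleftrightarrow> a \<in> {F s<..F t}"
        using \<rho>[of a s] \<rho>[of a t] by auto
      ultimately show "a \<in> \<rho> -` {s<..t} \<inter> A \<longleftrightarrow> a \<in> {F s<..F t}" by blast
    qed
    also have "emeasure (restrict_space lborel A) {F s<..F t} = emeasure lborel {F s<..F t}"
    proof (rule emeasure_restrict_space)
      show "{F s<..F t} \<subseteq> A" using F_nonneg[of s] by (auto simp: A_def)
    qed (use A in simp)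
    also have "\<dots> = ennreal (F t - F s)"
      using mono[OF that] by simp
    finally show ?thesis .
  qed
  show "interval_measure F = distr (restrict_space lborel A) borel \<rho>"
  proof (rule measure_eqI_generator_eq)
    let ?E = "range (\<lambda>(i::real, j). {i<..j})"
    show "Int_stable ?E"
      by (auto simp: Int_stable_def intro!: range_eqI[of _ _ "(max _ _, min _ _)"])
    show "?E \<subseteq> Pow UNIV" by simp
    show "sets (interval_measure F) = sigma_sets UNIV ?E"
      "sets (distr (restrict_space lborel A) borel \<rho>) = sigma_sets UNIV ?E"
      by (simp_all add: borel_sigma_sets_Ioc)
    show "range (\<lambda>n::nat. {- real n<..real n}) \<subseteq> ?E" by force
    show "(\<Union>n::nat. {- real n<..real n}) = UNIV"
    proof (intro set_eqI iffI UNIV_I)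
      fix x :: real
      obtain n :: nat where "\<bar>x\<bar> < real n" using reals_Archimedean2 by blast
      then show "x \<in> (\<Union>n::nat. {- real n<..real n})" by (auto simp: abs_less_iff intro!: exI[of _ n])
    qed
    show "emeasure (interval_measure F) {- real n<..real n} \<noteq> \<infinity>" for n :: nat
      by (simp add: emeasure_interval_measure_Ioc[OF _ mono rc])
    fix X assume "X \<in> ?E"
    then obtain i j where X: "X = {i<..j}" by auto
    show "emeasure (interval_measure F) X = emeasure (distr (restrict_space lborel A) borel \<rho>) X"
    proof (cases "i \<le> j")
      case True
      then show ?thesis by (simp add: X emeasure_interval_measure_Ioc[OF _ mono rc] Ioc)
    qed (simp add: X)
  qed
qed

text \<open>Change of variables from times to levels. The point mass at time \<open>0\<close>
  corresponds to the levels between \<open>0\<close> and \<open>C 0\<close>, all of which are hit at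
  \<open>0\<close>.\<close>

lemma nn_integral_stieltjes:
  assumes C: "right_continuous_path T C" "mono_on (time_set T) C" "\<And>t. t \<in> time_set T \<Longrightarrow> 0 \<le> C t"
    and f: "f \<in> borel_measurable (time_borel T)"
  shows "(\<integral>\<^sup>+t. f t \<partial>stieltjes T C) =
    (\<integral>\<^sup>+a. f (hit T C a) * indicator {a. 0 < a \<and> (\<exists>t\<in>time_set T. a \<le> C t)} a \<partial>lborel)"
proof -
  define F where "F t = (if t < 0 then 0 else C (min (ennreal t) T))" for t :: real
  have ts: "min (ennreal t) T \<in> time_set T" for t
    using time_set_min[of "ennreal t" T] by (simp add: min.commute)
  have mono: "F x \<le> F y" if "x \<le> y" for x y
  proof -
    have "C (min (ennreal x) T) \<le> C (min (ennreal y) T)"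
      by (rule mono_onD[OF C(2) ts ts]) (intro min.mono ennreal_leI that order_refl)
    then show ?thesis using that C(3)[OF ts[of y]] by (simp add: F_def)
  qed
  have rc: "continuous (at_right a) F" for a
  proof -
    have "(F \<longlongrightarrow> F a) (at_right a)"
    proof (cases "a < 0")
      case True
      have "\<forall>\<^sub>F t in at_right a. 0 = F t"
        unfolding eventually_at_right_field using True by (intro exI[of _ 0]) (auto simp: F_def)
      then show ?thesis
        using True by (intro Lim_transform_eventually[OF tendsto_const]) (simp_all add: F_def)
    next
      case a: False
      have ev: "\<forall>\<^sub>F t in at_right a. a < t" by (rule eventually_at_right_less)
      show ?thesis
      proof (cases "ennreal a < T")
        case True
        have "((\<lambda>t. min (ennreal t) T) \<longlongrightarrow> min (ennreal a) T) (at_right a)"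
          by (intro tendsto_min tendsto_ennrealI tendsto_ident_at tendsto_const)
        moreover have "\<forall>\<^sub>F t in at_right a. ennreal a < min (ennreal t) T"
          using ev by eventually_elim (use a True in \<open>auto simp: ennreal_less_iff\<close>)
        moreover have "min (ennreal a) T = ennreal a" using True by simp
        ultimately have "filterlim (\<lambda>t. min (ennreal t) T) (at_right (ennreal a)) (at_right a)"
          unfolding filterlim_at by (auto elim!: eventually_mono simp del: min_less_iff_conj)
        moreover have "(C \<longlongrightarrow> C (ennreal a)) (at_right (ennreal a))"
          using C(1) time_set_less[OF True] True by (auto simp: right_continuous_path_def continuous_within)
        ultimately have "((\<lambda>t. C (min (ennreal t) T)) \<longlongrightarrow> C (ennreal a)) (at_right a)"
          by (rule filterlim_compose[rotated])
        moreover have "\<forall>\<^sub>F t in at_right a. C (min (ennreal t) T) = F t"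
          using ev by eventually_elim (use a in \<open>auto simp: F_def\<close>)
        ultimately show ?thesis
          using a \<open>min (ennreal a) T = ennreal a\<close> by (simp add: F_def Lim_transform_eventually)
      next
        case False
        have "\<forall>\<^sub>F t in at_right a. F a = F t"
          using ev
        proof eventually_elim
          case (elim t)
          then have "ennreal a \<le> ennreal t" by (intro ennreal_leI) simp
          with False have "min (ennreal t) T = T" "min (ennreal a) T = T" by auto
          with elim a show ?case by (simp add: F_def)
        qed
        then show ?thesis by (rule Lim_transform_eventually[OF tendsto_const])
      qed
    qed
    then show ?thesis by (simp add: continuous_within)
  qed
  have neg: "F t = 0" if "t < 0" for t using that by (simp add: F_def)
  define A where "A = {a. 0 < a \<and> (\<exists>t. a \<le> F t)}"
  define \<rho> where "\<rho> a = Inf {t. a \<le> F t}" for a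
  have I1: "A \<in> sets borel"
    unfolding A_def by (rule interval_measure_eq_distr(1)) (use mono rc neg in auto)
  have I2: "\<rho> a \<le> s \<longleftrightarrow> a \<le> F s" if "a \<in> A" for a s
    unfolding \<rho>_def
    by (rule interval_measure_eq_distr(2)) (use mono rc neg that in \<open>auto simp: A_def\<close>)
  have I3: "\<rho> \<in> borel_measurable (restrict_space lborel A)"
    unfolding \<rho>_def[abs_def] A_def by (rule interval_measure_eq_distr(3)) (use mono rc neg in auto)
  have I4: "interval_measure F = distr (restrict_space lborel A) borel \<rho>"
    unfolding \<rho>_def[abs_def] A_def by (rule interval_measure_eq_distr(4)) (use mono rc neg in auto)
  have A_eq: "A = {a. 0 < a \<and> (\<exists>t\<in>time_set T. a \<le> C t)}"
  proof (intro set_eqI iffI)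
    fix a assume "a \<in> A"
    then obtain t where "0 < a" "a \<le> F t" by (auto simp: A_def)
    then show "a \<in> {a. 0 < a \<and> (\<exists>t\<in>time_set T. a \<le> C t)}"
      using ts[of t] by (auto simp: F_def split: if_splits)
  next
    fix a assume "a \<in> {a. 0 < a \<and> (\<exists>t\<in>time_set T. a \<le> C t)}"
    then obtain t where t: "0 < a" "t \<in> time_set T" "a \<le> C t" by auto
    then have "ennreal (enn2real t) = t" "t \<le> T" by (auto simp: time_set_def)
    then have "F (enn2real t) = C t" using enn2real_nonneg[of t] by (simp add: F_def not_less[symmetric])
    with t show "a \<in> A" by (auto simp: A_def intro!: exI[of _ "enn2real t"])
  qed
  \<comment> \<open>Both sides have the same upper bounds: before \<open>T\<close> both being at
    most \<open>t\<close> means \<open>a \<le> C t\<close>, and from \<open>T\<close> on both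
    inequalities hold trivially.\<close>
  have hit: "min (ennreal (\<rho> a)) T = hit T C a" if a: "a \<in> A" for a
  proof -
    have "0 \<le> \<rho> a"
      using I2[OF a, of "\<rho> a"] neg[of "\<rho> a"] a by (force simp: A_def)
    have "min (ennreal (\<rho> a)) T \<le> t \<longleftrightarrow> hit T C a \<le> t" for t
    proof (cases "t < T")
      case True
      then have t: "ennreal (enn2real t) = t" using time_set_less[OF True] by (auto simp: time_set_def)
      have "min (ennreal (\<rho> a)) T \<le> t \<longleftrightarrow> ennreal (\<rho> a) \<le> ennreal (enn2real t)"
        using True by (auto simp: t min_le_iff_disj dest: leD)
      also have "\<dots> \<longleftrightarrow> \<rho> a \<le> enn2real t"
        by (rule ennreal_le_iff) simp
      also have "\<dots> \<longleftrightarrow> a \<le> F (enn2real t)"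
        by (rule I2[OF a])
      also have "F (enn2real t) = C t"
        using True t enn2real_nonneg[of t] by (simp add: F_def not_less[symmetric])
      also have "a \<le> C t \<longleftrightarrow> hit T C a \<le> t"
        using hit_le_iff[OF C(1,2) True] by simp
      finally show ?thesis .
    next
      case False
      then show ?thesis using hit_le[of T C a] by (auto simp: min_le_iff_disj intro: order_trans)
    qed
    then show ?thesis by (intro antisym) blast+
  qed
  have mmin: "(\<lambda>t. min (ennreal t) T) \<in> borel \<rightarrow>\<^sub>M time_borel T"
    using ts by (intro measurable_restrict_space2) auto
  have "(\<integral>\<^sup>+t. f t \<partial>stieltjes T C) = (\<integral>\<^sup>+t. f (min (ennreal t) T) \<partial>interval_measure F)"
    unfolding stieltjes_def F_def[abs_def, symmetric] using f mmin
    by (intro nn_integral_distr) (auto simp: measurable_cong_sets[OF sets_interval_measure refl])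
  also have "\<dots> = (\<integral>\<^sup>+a. f (min (ennreal (\<rho> a)) T) \<partial>restrict_space lborel A)"
    unfolding I4 using measurable_compose[OF mmin f]
    by (intro nn_integral_distr I3) simp
  also have "\<dots> = (\<integral>\<^sup>+a. f (min (ennreal (\<rho> a)) T) * indicator A a \<partial>lborel)"
    using I1 by (intro nn_integral_restrict_space) simp
  also have "\<dots> = (\<integral>\<^sup>+a. f (hit T C a) * indicator A a \<partial>lborel)"
    using hit by (intro nn_integral_cong) (auto simp: indicator_def)
  finally show ?thesis by (simp only: A_eq)
qed

section \<open>Running suprema of optional processes\<close>

definition contribution_path :: "ennreal \<Rightarrow> (ennreal \<Rightarrow> real) \<Rightarrow> bool" where
  "contribution_path T C \<longleftrightarrow> right_continuous_path T C \<and> mono_on (time_set T) C \<and>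
     (\<forall>t\<in>time_set T. 0 \<le> C t)"

text \<open>Shortly after \<open>t\<close> upper right-continuity keeps \<open>l\<close> below
  \<open>l t + e / 2\<close>, which is at most \<open>C t + e / 2\<close>, and earlier values are at
  most \<open>C t\<close>; hence the supremum cannot jump upwards.\<close>

lemma running_sup_contribution_path:
  fixes l :: "ennreal \<Rightarrow> real"
  assumes usc: "\<forall>t<T. ((\<lambda>s. SUP v\<in>{t..<s}. ereal (l v)) \<longlongrightarrow> ereal (l t)) (at_right t)"
    and bdd: "\<forall>t\<in>time_set T. bdd_above (l ` {0..t})"
  shows "contribution_path T (\<lambda>t. max (SUP s\<in>{0..t}. l s) 0)"
proof -
  define C where "C t = max (SUP s\<in>{0..t}. l s) 0" for t
  have l_le: "l s \<le> C t" if "t \<in> time_set T" "s \<le> t" for s t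
    using cSUP_upper[of s "{0..t}" l] bdd that by (auto simp: C_def intro: max.coboundedI1)
  have C_le: "C t \<le> b" if "\<And>s. s \<le> t \<Longrightarrow> l s \<le> b" "0 \<le> b" for t b
    using that by (auto simp: C_def intro!: cSUP_least)
  have nonneg: "0 \<le> C t" for t by (simp add: C_def)
  have mono: "C s \<le> C t" if "t \<in> time_set T" "s \<le> t" for s t
    using l_le[OF that(1)] that(2) nonneg by (intro C_le) (auto intro: order_trans)
  have "right_continuous_path T C"
    unfolding right_continuous_path_def
  proof (intro ballI impI)
    fix t assume t: "t \<in> time_set T" "t < T"
    have "(C \<longlongrightarrow> C t) (at_right t)"
    proof (rule tendstoI)
      fix e :: real assume e: "0 < e"
      have "\<forall>\<^sub>F s in at_right t. (SUP v\<in>{t..<s}. ereal (l v)) < ereal (l t + e / 2)"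
        using usc t(2) e by (intro order_tendstoD(2)[of _ "ereal (l t)"]) auto
      moreover have "\<forall>\<^sub>F s in at_right t. s < T"
        unfolding eventually_at_right[OF t(2)] using t(2) by auto
      ultimately have "\<forall>\<^sub>F s in at_right t. (SUP v\<in>{t..<s}. ereal (l v)) < ereal (l t + e / 2) \<and> s < T"
        by (rule eventually_conj)
      then obtain b where b: "t < b"
          "\<And>s. t < s \<Longrightarrow> s < b \<Longrightarrow> (SUP v\<in>{t..<s}. ereal (l v)) < ereal (l t + e / 2) \<and> s < T"
        unfolding eventually_at_right[OF t(2)] by blast
      obtain c where c: "t < c" "c < b" using dense[OF b(1)] by blast
      have near: "l v \<le> l t + e / 2" if "t \<le> v" "v < c" for v
      proof -
        have "ereal (l v) \<le> (SUP v\<in>{t..<c}. ereal (l v))" using that by (intro SUP_upper) auto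
        also have "\<dots> < ereal (l t + e / 2)" using b(2)[OF c] by simp
        finally show ?thesis by simp
      qed
      have "dist (C s) (C t) < e" if s: "t < s" "s < c" for s
      proof -
        have "s < T" using b(2)[OF c] s(2) by auto
        then have sT: "s \<in> time_set T" by (rule time_set_less)
        have "C s \<le> C t + e / 2"
        proof (rule C_le)
          fix v assume "v \<le> s"
          show "l v \<le> C t + e / 2"
          proof (cases "v \<le> t")
            case True
            then show ?thesis using l_le[OF t(1), of v] e by simp
          next
            case False
            then have "l v \<le> l t + e / 2"
              using s(2) \<open>v \<le> s\<close> by (intro near) auto
            with l_le[OF t(1), of t] show ?thesis by simp
          qed
        qed (use nonneg[of t] e in simp)
        moreover have "C t \<le> C s" using mono[OF sT] s(1) by simp
        ultimately show ?thesis using e by (simp add: dist_real_def)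
      qed
      then show "\<forall>\<^sub>F s in at_right t. dist (C s) (C t) < e"
        unfolding eventually_at_right[OF t(2)] using c(1) by blast
    qed
    then show "continuous (at_right t) C" by (simp add: continuous_within)
  qed
  then have "contribution_path T C"
    using mono nonneg by (auto simp: contribution_path_def intro!: mono_onI)
  then show ?thesis by (simp add: C_def[abs_def])
qed

section \<open>Adaptedness of the running supremum and optionality of the candidate\<close>

context usual_filtered_space
begin

text \<open>An upper right-continuous path may exceed a level only at isolated times, so the supremum cannot
  be taken along countably many times; measurability rests on the projection theorem.\<close>

lemma exceedance_measurable:
  assumes f: "(\<lambda>(\<omega>, t). Y t \<omega>) \<in> borel_measurable (optional_sigma M F T)" and t: "t \<in> time_set T"
  shows "{\<omega> \<in> space M. \<exists>s\<in>{0..t}. (a :: real) < Y s \<omega>} \<in> sets (F t)"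
proof -
  \<comment> \<open>The projection is taken in the measure space over \<open>F t\<close> itself; it
    is complete since \<open>F t\<close> contains all subsets of null sets.\<close>
  define N where "N = restr_to_subalg M (F t)"
  have N: "sets N = sets (F t)" "space N = space M"
    using subalg by (auto simp: N_def sets_restr_to_subalg space_restr_to_subalg)
  have "finite_measure N"
    unfolding N_def by (rule finite_measure_restr_to_subalg) (use subalg finite_measure_axioms in auto)
  moreover have "A \<in> sets N" if "B \<in> null_sets N" "A \<subseteq> B" for A B
  proof -
    have "B \<in> null_sets M"
      using that(1) N sets_F_subset subalg unfolding N_def
      by (auto simp: null_sets_def emeasure_restr_to_subalg)
    with that(2) show ?thesis using null_sets_F N(1) by simp
  qed
  \<comment> \<open>Times are parametrized by real numbers, because the projection runs along a
    Euclidean space; the minimum with \<open>t\<close> covers exactly the times up to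
    \<open>t\<close>.\<close>
  moreover define E where "E = {z \<in> space (N \<Otimes>\<^sub>M (borel :: real measure)).
      a < (\<lambda>(\<omega>, s). Y s \<omega>) (fst z, min t (ennreal (snd z)))}"
  have "E \<in> sets (N \<Otimes>\<^sub>M borel)"
  proof -
    have "(\<lambda>(\<omega>, s). Y s \<omega>) \<in> borel_measurable (F t \<Otimes>\<^sub>M time_borel t)"
      by (rule optional_progressive[OF f t])
    then have m: "(\<lambda>(\<omega>, s). Y s \<omega>) \<in> borel_measurable (N \<Otimes>\<^sub>M time_borel t)"
      by (simp add: measurable_cong_sets[OF sets_pair_measure_cong[OF N(1) refl] refl])
    have "(\<lambda>x::real. min t (ennreal x)) \<in> borel \<rightarrow>\<^sub>M time_borel t"
      using time_set_min by (intro measurable_restrict_space2) auto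
    then have "(\<lambda>z. (fst z, min t (ennreal (snd z)))) \<in> N \<Otimes>\<^sub>M (borel :: real measure) \<rightarrow>\<^sub>M N \<Otimes>\<^sub>M time_borel t"
      by measurable
    from measurable_compose[OF this m] show ?thesis
      unfolding E_def by measurable
  qed
  ultimately have "fst ` E \<in> sets N"
    by (rule measurable_projection)
  moreover have "fst ` E = {\<omega> \<in> space M. \<exists>s\<in>{0..t}. a < Y s \<omega>}"
  proof (intro set_eqI iffI)
    fix \<omega> assume "\<omega> \<in> fst ` E"
    then obtain x where "\<omega> \<in> space M" "a < Y (min t (ennreal x)) \<omega>"
      by (auto simp: E_def space_pair_measure N(2))
    then show "\<omega> \<in> {\<omega> \<in> space M. \<exists>s\<in>{0..t}. a < Y s \<omega>}"
      by (auto intro!: bexI[of _ "min t (ennreal x)"])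
  next
    fix \<omega> assume "\<omega> \<in> {\<omega> \<in> space M. \<exists>s\<in>{0..t}. a < Y s \<omega>}"
    then obtain s where s: "\<omega> \<in> space M" "s \<le> t" "a < Y s \<omega>" by auto
    then have "s < \<infinity>" using t by (auto simp: time_set_def)
    then have "min t (ennreal (enn2real s)) = s" using s(2) by simp
    with s have "(\<omega>, enn2real s) \<in> E" by (simp add: E_def space_pair_measure N(2))
    then show "\<omega> \<in> fst ` E" by force
  qed
  ultimately show ?thesis using N(1) by simp
qed

text \<open>For a level \<open>c \<ge> 0\<close> the supremum of a bounded path exceeds
  \<open>c\<close> exactly if the path does at some time, and for negative \<open>c\<close> the
  maximum with \<open>0\<close> decides. Unbounded paths, where the real \<open>SUP\<close> means
  nothing, lie in the null set on which \<open>Z\<close> is \<open>0\<close>.\<close>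

lemma running_sup_adapted:
  assumes l: "optional M F T l"
    and bdd: "AE \<omega> in M. \<forall>t\<in>time_set T. bdd_above ((\<lambda>s. l s \<omega>) ` {0..t})"
  shows "adapted F T (\<lambda>t \<omega>. max (SUP s\<in>{0..t}. l s \<omega>) 0)"
  unfolding adapted_def
proof
  fix t assume t: "t \<in> time_set T"
  obtain Y where Y: "(\<lambda>(\<omega>, t). Y t \<omega>) \<in> borel_measurable (optional_sigma M F T)"
    "AE \<omega> in M. \<forall>t\<in>time_set T. l t \<omega> = Y t \<omega>"
    using l unfolding optional_def by blast
  have "AE \<omega> in M. (\<forall>t\<in>time_set T. l t \<omega> = Y t \<omega>) \<and> bdd_above ((\<lambda>s. l s \<omega>) ` {0..t})"
    using Y(2) bdd by eventually_elim (use t in auto)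
  then obtain N where N: "{\<omega> \<in> space M. \<not> ((\<forall>t\<in>time_set T. l t \<omega> = Y t \<omega>) \<and>
      bdd_above ((\<lambda>s. l s \<omega>) ` {0..t}))} \<subseteq> N" "N \<in> null_sets M"
    unfolding eventually_ae_filter by blast
  define Z where "Z \<omega> = (if \<omega> \<in> N then 0 else max (SUP s\<in>{0..t}. l s \<omega>) 0)" for \<omega>
  have "Z \<in> borel_measurable (F t)"
  proof (rule borel_measurableI_greater)
    fix c :: real
    show "{\<omega> \<in> space (F t). c < Z \<omega>} \<in> sets (F t)"
    proof (cases "c < 0")
      case True
      then have "{\<omega> \<in> space (F t). c < Z \<omega>} = space (F t)"
        by (auto simp: Z_def less_max_iff_disj)
      then show ?thesis by (metis sets.top)
    next
      case False
      have "c < Z \<omega> \<longleftrightarrow> (\<exists>s\<in>{0..t}. c < Y s \<omega>)" if "\<omega> \<in> space M - N" for \<omega>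
      proof -
        have lY: "l s \<omega> = Y s \<omega>" if "s \<in> {0..t}" for s
          using N(1) \<open>\<omega> \<in> space M - N\<close> time_set_le[OF t] that by auto
        have bdd: "bdd_above ((\<lambda>s. l s \<omega>) ` {0..t})"
          using N(1) that by auto
        have "c < Z \<omega> \<longleftrightarrow> c < (SUP s\<in>{0..t}. l s \<omega>)"
          using that False by (auto simp: Z_def less_max_iff_disj)
        also have "\<dots> \<longleftrightarrow> (\<exists>s\<in>{0..t}. c < l s \<omega>)"
          by (rule less_cSUP_iff) (use bdd in auto)
        finally show ?thesis using lY by auto
      qed
      then have "{\<omega> \<in> space (F t). c < Z \<omega>} = {\<omega> \<in> space M. \<exists>s\<in>{0..t}. c < Y s \<omega>} - N"
        using False by (auto simp: Z_def)
      then show ?thesis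
        using exceedance_measurable[OF Y(1) t, of c] null_sets_F[OF N(2) order_refl] by auto
    qed
  qed
  moreover have "AE \<omega> in M. Z \<omega> = max (SUP s\<in>{0..t}. l s \<omega>) 0"
    using AE_not_in[OF N(2)] by eventually_elim (simp add: Z_def)
  ultimately show "(\<lambda>\<omega>. max (SUP s\<in>{0..t}. l s \<omega>) 0) \<in> borel_measurable (F t)"
    by (rule borel_measurable_F_AE)
qed

lemma right_continuous_optional:
  assumes "adapted F T X" "AE \<omega> in M. right_continuous_path T (\<lambda>t. X t \<omega>)"
  shows "optional M F T X"
proof -
  obtain Y where Y: "adapted F T Y" "\<And>\<omega>. \<omega> \<in> space M \<Longrightarrow> right_continuous_path T (\<lambda>t. Y t \<omega>)"
    "AE \<omega> in M. \<forall>t. X t \<omega> = Y t \<omega>"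
    using regular_version[OF assms right_continuous_path_0] by blast
  have "AE \<omega> in M. \<forall>t\<in>time_set T. X t \<omega> = Y t \<omega>"
    using Y(3) by eventually_elim simp
  with right_continuous_optional_sigma[OF Y(1,2)] show ?thesis
    unfolding optional_def by blast
qed

text \<open>Optionality comes from composing the versions with the Borel function
  \<open>g_inv\<close>; right-continuity of the composite is not claimed.\<close>

lemma private_good_optional:
  assumes u: "utility_function u"
    and r: "optional M F T r" "strictly_positive_bounded M T r"
    and \<psi>: "adapted F T \<psi>" "AE \<omega> in M. right_continuous_path T (\<lambda>t. \<psi> t \<omega>)"
    and C: "adapted F T C" "AE \<omega> in M. right_continuous_path T (\<lambda>t. C t \<omega>)"
  shows "optional M F T (\<lambda>t \<omega>. g_inv u (lam * exp (cum r t \<omega>) * \<psi> t \<omega>) (k * C t \<omega>))"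
proof -
  obtain R where R: "adapted F T R" "\<And>\<omega>. \<omega> \<in> space M \<Longrightarrow> right_continuous_path T (\<lambda>t. R t \<omega>)"
    "AE \<omega> in M. \<forall>t\<in>time_set T. cum r t \<omega> = R t \<omega>"
    using discount_version[OF r] by blast
  obtain P where P: "adapted F T P" "\<And>\<omega>. \<omega> \<in> space M \<Longrightarrow> right_continuous_path T (\<lambda>t. P t \<omega>)"
    "AE \<omega> in M. \<forall>t. \<psi> t \<omega> = P t \<omega>"
    using regular_version[OF \<psi> right_continuous_path_0] by blast
  obtain S where S: "adapted F T S" "\<And>\<omega>. \<omega> \<in> space M \<Longrightarrow> right_continuous_path T (\<lambda>t. S t \<omega>)"
    "AE \<omega> in M. \<forall>t. C t \<omega> = S t \<omega>"
    using regular_version[OF C right_continuous_path_0] by blast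
  note [measurable] = right_continuous_optional_sigma[OF R(1,2)] right_continuous_optional_sigma[OF P(1,2)]
    right_continuous_optional_sigma[OF S(1,2)] borel_measurable_g_inv[OF u]
  have "(\<lambda>z. (\<lambda>(\<psi>, c). g_inv u \<psi> c)
      (lam * exp ((\<lambda>(\<omega>, t). R t \<omega>) z) * (\<lambda>(\<omega>, t). P t \<omega>) z, k * (\<lambda>(\<omega>, t). S t \<omega>) z))
      \<in> borel_measurable (optional_sigma M F T)"
    by measurable
  then have "(\<lambda>(\<omega>, t). g_inv u (lam * exp (R t \<omega>) * P t \<omega>) (k * S t \<omega>))
      \<in> borel_measurable (optional_sigma M F T)"
    by (simp add: case_prod_beta)
  moreover have "AE \<omega> in M. \<forall>t\<in>time_set T. g_inv u (lam * exp (cum r t \<omega>) * \<psi> t \<omega>) (k * C t \<omega>) =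
      g_inv u (lam * exp (R t \<omega>) * P t \<omega>) (k * S t \<omega>)"
    using R(3) P(3) S(3) by eventually_elim simp
  ultimately show ?thesis
    unfolding optional_def
    by (intro exI[of _ "\<lambda>t \<omega>. g_inv u (lam * exp (R t \<omega>) * P t \<omega>) (k * S t \<omega>)"] conjI)
qed

end

section \<open>Decomposition of contributions by levels\<close>

context usual_filtered_space
begin

lemma hit_stopping_time:
  assumes C: "adapted F T C" "\<And>\<omega>. \<omega> \<in> space M \<Longrightarrow> contribution_path T (\<lambda>t. C t \<omega>)"
  shows "stopping_time F (\<lambda>\<omega>. hit T (\<lambda>t. C t \<omega>) a)"
proof
  fix t
  show "Measurable.pred (F t) (\<lambda>\<omega>. hit T (\<lambda>t. C t \<omega>) a \<le> t)"
  proof (cases "t < T")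
    case True
    then have m: "C t \<in> borel_measurable (F t)"
      using C(1) time_set_less by (auto simp: adapted_def)
    have p: "Measurable.pred (F t) (\<lambda>\<omega>. a \<le> C t \<omega>)"
      using m by measurable
    have iff: "a \<le> C t \<omega> \<longleftrightarrow> hit T (\<lambda>t. C t \<omega>) a \<le> t" if "\<omega> \<in> space (F t)" for \<omega>
      using C(2)[of \<omega>] that hit_le_iff[OF _ _ True] by (auto simp: contribution_path_def)
    show ?thesis
      using measurable_cong[OF iff] p by (rule iffD1)
  next
    case False
    then have "hit T (\<lambda>t. C t \<omega>) a \<le> t" for \<omega>
      using hit_le[of T "\<lambda>t. C t \<omega>" a] by (auto intro: order_trans)
    then show ?thesis by simp
  qed
qed

lemma hit_measurable:
  assumes C: "adapted F T C" "\<And>\<omega>. \<omega> \<in> space M \<Longrightarrow> contribution_path T (\<lambda>t. C t \<omega>)"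
  shows "(\<lambda>z. hit T (\<lambda>t. C t (fst z)) (snd z)) \<in> borel_measurable (M \<Otimes>\<^sub>M lborel)"
proof (rule borel_measurableI_le)
  fix t
  show "{z \<in> space (M \<Otimes>\<^sub>M lborel). hit T (\<lambda>t. C t (fst z)) (snd z) \<le> t} \<in> sets (M \<Otimes>\<^sub>M lborel)"
  proof (cases "t < T")
    case True
    then have [measurable]: "C t \<in> borel_measurable M"
      using C(1) time_set_less[OF True] unfolding adapted_def by (intro measurable_F) blast
    have "{z \<in> space (M \<Otimes>\<^sub>M lborel). snd z \<le> C t (fst z)} \<in> sets (M \<Otimes>\<^sub>M lborel)"
      by measurable
    also have "{z \<in> space (M \<Otimes>\<^sub>M lborel). snd z \<le> C t (fst z)} =
        {z \<in> space (M \<Otimes>\<^sub>M lborel). hit T (\<lambda>t. C t (fst z)) (snd z) \<le> t}"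
      using C(2) hit_le_iff[OF _ _ True] by (auto simp: contribution_path_def space_pair_measure)
    finally show ?thesis .
  next
    case False
    then have "hit T (\<lambda>t. C t \<omega>) a \<le> t" for \<omega> a
      using hit_le[of T "\<lambda>t. C t \<omega>" a] by (auto intro: order_trans)
    then have "{z \<in> space (M \<Otimes>\<^sub>M lborel). hit T (\<lambda>t. C t (fst z)) (snd z) \<le> t} = space (M \<Otimes>\<^sub>M lborel)"
      by simp
    then show ?thesis by (simp only: sets.top)
  qed
qed

text \<open>The share of level \<open>a\<close> in the cost, without the mass at \<open>T\<close>:
  the condition \<open>\<tau> < T\<close> removes both the levels first reached at \<open>T\<close>
  and those never reached.\<close>

definition price_at_hit :: "('a \<times> ennreal \<Rightarrow> real) \<Rightarrow> 'a process \<Rightarrow> real \<Rightarrow> 'a \<Rightarrow> ennreal" where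
  "price_at_hit p C a \<omega> =
     (let \<tau> = hit T (\<lambda>t. C t \<omega>) a in if 0 < a \<and> \<tau> < T then ennreal (p (\<omega>, \<tau>)) else 0)"

lemma price_at_hit_measurable:
  assumes C: "adapted F T C" "\<And>\<omega>. \<omega> \<in> space M \<Longrightarrow> contribution_path T (\<lambda>t. C t \<omega>)"
    and p [measurable]: "p \<in> borel_measurable (M \<Otimes>\<^sub>M time_borel T)"
  shows "(\<lambda>z. price_at_hit p C (snd z) (fst z)) \<in> borel_measurable (M \<Otimes>\<^sub>M lborel)"
proof -
  note [measurable] = hit_measurable[OF C]
  \<comment> \<open>The default time \<open>0\<close> keeps the map inside
    \<open>time_set T\<close>, to which \<open>T\<close> does not belong if it is infinite.\<close>
  let ?s = "\<lambda>z. if hit T (\<lambda>t. C t (fst z)) (snd z) < T then hit T (\<lambda>t. C t (fst z)) (snd z) else 0"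
  have [measurable]: "?s \<in> M \<Otimes>\<^sub>M lborel \<rightarrow>\<^sub>M time_borel T"
  proof (rule measurable_restrict_space2)
    show "?s \<in> borel_measurable (M \<Otimes>\<^sub>M lborel)" by measurable
    show "?s \<in> space (M \<Otimes>\<^sub>M lborel) \<rightarrow> time_set T"
      using time_set_less by (auto simp: time_set_def)
  qed
  have "(\<lambda>z. if 0 < snd z \<and> hit T (\<lambda>t. C t (fst z)) (snd z) < T then ennreal (p (fst z, ?s z)) else 0)
      \<in> borel_measurable (M \<Otimes>\<^sub>M lborel)"
    by measurable
  then show ?thesis
    by (rule measurable_cong[THEN iffD1, rotated]) (auto simp: price_at_hit_def Let_def)
qed

text \<open>Levels first reached at \<open>T\<close> carry cost but are dropped on the other side,
  hence the inequality. If all positive levels below \<open>C T\<close> are reached earlier, only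
  the single level \<open>C T\<close> remains, and it is null.\<close>

lemma stieltjes_price:
  assumes C: "contribution_path T (\<lambda>t. C t \<omega>)"
    and p: "(\<lambda>t. p (\<omega>, t)) \<in> borel_measurable (time_borel T)"
  shows "(\<integral>\<^sup>+a. price_at_hit p C a \<omega> \<partial>lborel) \<le> (\<integral>\<^sup>+t. ennreal (p (\<omega>, t)) \<partial>stieltjes T (\<lambda>t. C t \<omega>))"
    and "(T < \<infinity> \<Longrightarrow> \<forall>a. 0 < a \<longrightarrow> a < C T \<omega> \<longrightarrow> (\<exists>t<T. a \<le> C t \<omega>)) \<Longrightarrow>
      (\<integral>\<^sup>+t. ennreal (p (\<omega>, t)) \<partial>stieltjes T (\<lambda>t. C t \<omega>)) = (\<integral>\<^sup>+a. price_at_hit p C a \<omega> \<partial>lborel)"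
proof -
  let ?C = "\<lambda>t. C t \<omega>"
  let ?A = "{a. 0 < a \<and> (\<exists>t\<in>time_set T. a \<le> ?C t)}"
  have rc: "right_continuous_path T ?C" "mono_on (time_set T) ?C" "\<And>t. t \<in> time_set T \<Longrightarrow> 0 \<le> ?C t"
    using C by (auto simp: contribution_path_def)
  have eq: "(\<integral>\<^sup>+t. ennreal (p (\<omega>, t)) \<partial>stieltjes T ?C) =
      (\<integral>\<^sup>+a. ennreal (p (\<omega>, hit T ?C a)) * indicator ?A a \<partial>lborel)"
    using p by (intro nn_integral_stieltjes rc) auto
  have le: "price_at_hit p C a \<omega> \<le> ennreal (p (\<omega>, hit T ?C a)) * indicator ?A a" for a
    using hit_less_iff[OF rc(1,2), of a] time_set_less
    by (auto simp: price_at_hit_def Let_def indicator_def)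
  show "(\<integral>\<^sup>+a. price_at_hit p C a \<omega> \<partial>lborel) \<le> (\<integral>\<^sup>+t. ennreal (p (\<omega>, t)) \<partial>stieltjes T ?C)"
    unfolding eq by (intro nn_integral_mono le)
  assume no_jump: "T < \<infinity> \<Longrightarrow> \<forall>a. 0 < a \<longrightarrow> a < C T \<omega> \<longrightarrow> (\<exists>t<T. a \<le> C t \<omega>)"
  have "AE a in lborel. ennreal (p (\<omega>, hit T ?C a)) * indicator ?A a = price_at_hit p C a \<omega>"
    using AE_lborel_singleton[of "C T \<omega>"]
  proof eventually_elim
    case (elim a)
    have "hit T ?C a < T" if a: "a \<in> ?A"
    proof -
      obtain t where t: "0 < a" "t \<in> time_set T" "a \<le> ?C t" using a by blast
      have "\<exists>t<T. a \<le> ?C t"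
      proof (cases "t < T")
        case False
        then have "t = T" "T < \<infinity>" using t(2) by (auto simp: time_set_def)
        with t elim no_jump show ?thesis by auto
      qed (use t in blast)
      then show ?thesis using hit_less_iff[OF rc(1,2)] by blast
    qed
    moreover have "a \<in> ?A" if "0 < a" "hit T ?C a < T"
      using that hit_less_iff[OF rc(1,2), of a] time_set_less by auto
    ultimately show ?case by (auto simp: price_at_hit_def Let_def indicator_def)
  qed
  then show "(\<integral>\<^sup>+t. ennreal (p (\<omega>, t)) \<partial>stieltjes T ?C) = (\<integral>\<^sup>+a. price_at_hit p C a \<omega> \<partial>lborel)"
    unfolding eq by (rule nn_integral_cong_AE)
qed

definition benefit_after_hit :: "('a \<times> ennreal \<Rightarrow> ennreal) \<Rightarrow> 'a process \<Rightarrow> real \<Rightarrow> 'a \<Rightarrow> ennreal" where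
  "benefit_after_hit H C a \<omega> =
     (\<integral>\<^sup>+t. H (\<omega>, t) * (if hit T (\<lambda>t. C t \<omega>) a \<le> t then 1 else 0) \<partial>dt T)"

text \<open>Fubini for \<open>C t = \<integral>\<^sub>0\<^sup>\<infinity> 1{hit a \<le> t} da\<close>.\<close>

lemma nn_integral_benefit:
  assumes C: "adapted F T C" "\<And>\<omega>. \<omega> \<in> space M \<Longrightarrow> contribution_path T (\<lambda>t. C t \<omega>)"
    and H: "H \<in> borel_measurable (M \<Otimes>\<^sub>M time_borel T)"
  shows "(\<integral>\<^sup>+\<omega>. \<integral>\<^sup>+t. H (\<omega>, t) * ennreal (C t \<omega>) \<partial>dt T \<partial>M) =
    (\<integral>\<^sup>+a. indicator {0<..} a * (\<integral>\<^sup>+\<omega>. benefit_after_hit H C a \<omega> \<partial>M) \<partial>lborel)"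
proof -
  interpret AD: pair_sigma_finite "lborel :: real measure" "dt T"
    by (intro pair_sigma_finite.intro sigma_finite_dt lborel.sigma_finite_measure_axioms)
  interpret MA: pair_sigma_finite M "lborel :: real measure"
    by (intro pair_sigma_finite.intro lborel.sigma_finite_measure_axioms sigma_finite_measure_axioms)
  define G where "G \<omega> a t = indicator {0<..} a * (H (\<omega>, t) * (if hit T (\<lambda>t. C t \<omega>) a \<le> t then 1 else 0))"
    for \<omega> t and a :: real
  have H' [measurable]: "H \<in> borel_measurable (M \<Otimes>\<^sub>M dt T)"
    using H by (simp add: measurable_cong_sets[OF sets_pair_measure_cong[OF refl sets_dt] refl])
  note [measurable] = hit_measurable[OF C]
  have [measurable]: "(\<lambda>x. x) \<in> dt T \<rightarrow>\<^sub>M borel"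
    unfolding measurable_dt by (rule measurable_restrict_space1) simp
  have "(\<lambda>z. indicator {0<..} (snd (fst z)) * (H (fst (fst z), snd z) *
      (if hit T (\<lambda>t. C t (fst (fst z))) (snd (fst z)) \<le> snd z then 1 else 0)))
      \<in> borel_measurable ((M \<Otimes>\<^sub>M lborel) \<Otimes>\<^sub>M dt T)"
    by measurable
  then have mG: "(\<lambda>(z, t). G (fst z) (snd z) t) \<in> borel_measurable ((M \<Otimes>\<^sub>M lborel) \<Otimes>\<^sub>M dt T)"
    by (simp add: G_def case_prod_beta)
  have mG\<omega>: "(\<lambda>(a, t). G \<omega> a t) \<in> borel_measurable (lborel \<Otimes>\<^sub>M dt T)" if \<omega>: "\<omega> \<in> space M" for \<omega>
  proof -
    have "(\<lambda>z. ((\<omega>, fst z), snd z)) \<in> lborel \<Otimes>\<^sub>M dt T \<rightarrow>\<^sub>M (M \<Otimes>\<^sub>M lborel) \<Otimes>\<^sub>M dt T"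
      using \<omega> by measurable
    from measurable_compose[OF this mG] show ?thesis by (simp add: case_prod_beta)
  qed
  have "(\<integral>\<^sup>+\<omega>. \<integral>\<^sup>+t. H (\<omega>, t) * ennreal (C t \<omega>) \<partial>dt T \<partial>M) = (\<integral>\<^sup>+\<omega>. \<integral>\<^sup>+t. \<integral>\<^sup>+a. G \<omega> a t \<partial>lborel \<partial>dt T \<partial>M)"
  proof (rule nn_integral_cong)
    fix \<omega> assume \<omega>: "\<omega> \<in> space M"
    have c: "contribution_path T (\<lambda>t. C t \<omega>)" by (rule C(2)[OF \<omega>])
    \<comment> \<open>At \<open>t = T\<close> every level counts as hit, so the two integrands may
      differ there; a single time is null.\<close>
    have "AE t in dt T. H (\<omega>, t) * ennreal (C t \<omega>) = (\<integral>\<^sup>+a. G \<omega> a t \<partial>lborel)"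
      using AE_dt_neq[of T T] AE_space
    proof eventually_elim
      case (elim t)
      then have t: "t \<in> time_set T" "t < T" by (auto simp: time_set_def)
      have "G \<omega> a t = H (\<omega>, t) * indicator {0<..C t \<omega>} a" for a
        using hit_le_iff[OF _ _ t(2), of "\<lambda>t. C t \<omega>" a] c
        by (auto simp: G_def indicator_def contribution_path_def)
      then have "(\<integral>\<^sup>+a. G \<omega> a t \<partial>lborel) = H (\<omega>, t) * emeasure lborel {0<..C t \<omega>}"
        by (simp add: nn_integral_cmult_indicator)
      also have "emeasure lborel {0<..C t \<omega>} = ennreal (C t \<omega>)"
        using c t(1) by (simp add: contribution_path_def)
      finally show ?case by simp
    qed
    then show "(\<integral>\<^sup>+t. H (\<omega>, t) * ennreal (C t \<omega>) \<partial>dt T) = (\<integral>\<^sup>+t. \<integral>\<^sup>+a. G \<omega> a t \<partial>lborel \<partial>dt T)"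
      by (rule nn_integral_cong_AE)
  qed
  also have "\<dots> = (\<integral>\<^sup>+\<omega>. \<integral>\<^sup>+a. \<integral>\<^sup>+t. G \<omega> a t \<partial>dt T \<partial>lborel \<partial>M)"
    by (intro nn_integral_cong AD.Fubini' mG\<omega>)
  also have "\<dots> = (\<integral>\<^sup>+a. \<integral>\<^sup>+\<omega>. \<integral>\<^sup>+t. G \<omega> a t \<partial>dt T \<partial>M \<partial>lborel)"
  proof (rule MA.Fubini'[symmetric])
    show "(\<lambda>(\<omega>, a). \<integral>\<^sup>+t. G \<omega> a t \<partial>dt T) \<in> borel_measurable (M \<Otimes>\<^sub>M lborel)"
      using dt.borel_measurable_nn_integral[OF mG] by (simp add: case_prod_beta)
  qed
  also have "\<dots> = (\<integral>\<^sup>+a. indicator {0<..} a * (\<integral>\<^sup>+\<omega>. benefit_after_hit H C a \<omega> \<partial>M) \<partial>lborel)"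
  proof (rule nn_integral_cong)
    fix a :: real
    show "(\<integral>\<^sup>+\<omega>. \<integral>\<^sup>+t. G \<omega> a t \<partial>dt T \<partial>M) =
        indicator {0<..} a * (\<integral>\<^sup>+\<omega>. benefit_after_hit H C a \<omega> \<partial>M)"
      by (cases "0 < a") (simp_all add: G_def benefit_after_hit_def)
  qed
  finally show ?thesis .
qed

text \<open>Taking expectations requires \<Phi> to be measurable, which is not known, as it contains
  suprema over uncountably many times. Otherwise \<open>nn_cond_exp\<close> has the default value
  \<open>0\<close>; the equation then makes the price vanish where \<open>\<tau> < T\<close>, and
  since prices are positive, \<open>\<tau> = T\<close> almost surely.\<close>

lemma backward_equation_expectation:
  assumes eq: "solves_backward_equation M F T \<psi>\<^sub>x \<psi>\<^sub>c r n u lam l" and "0 < lam"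
    and \<psi>\<^sub>c: "AE \<omega> in M. \<forall>t\<in>time_set T. 0 < \<psi>\<^sub>c t \<omega>"
    and \<tau>: "stopping_time F \<tau>" "\<And>\<omega>. \<omega> \<in> space M \<Longrightarrow> \<tau> \<omega> \<le> T"
  defines "\<Phi> \<equiv> \<lambda>\<omega>. \<integral>\<^sup>+t\<in>{\<tau> \<omega>..T}.
      ennreal (exp (- cum r t \<omega>) * h_fun u (lam * exp (cum r t \<omega>) * \<psi>\<^sub>x t \<omega>)
        (real n * (SUP s\<in>{\<tau> \<omega>..t}. l s \<omega>))) \<partial>dt T"
  shows "(\<integral>\<^sup>+\<omega>. \<Phi> \<omega> \<partial>M) = (\<integral>\<^sup>+\<omega>. ennreal (lam * \<psi>\<^sub>c (\<tau> \<omega>) \<omega> * (if \<tau> \<omega> < T then 1 else 0)) \<partial>M)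
    \<or> (AE \<omega> in M. \<tau> \<omega> = T)"
proof -
  let ?G = "pre_sigma \<tau>"
  have ae: "AE \<omega> in M. nn_cond_exp M ?G \<Phi> \<omega> =
      ennreal (lam * \<psi>\<^sub>c (\<tau> \<omega>) \<omega> * (if \<tau> \<omega> < T then 1 else 0))"
    using eq \<tau> unfolding solves_backward_equation_def \<Phi>_def by blast
  have "subalgebra M ?G"
  proof -
    have "A \<in> sets M" if "A \<in> sets ?G" for A
      using sets_pre_sigmaD[OF \<tau>(1) that, of top] sets_F_subset by auto
    then show ?thesis by (auto simp: subalgebra_def space_pre_sigma)
  qed
  then interpret G: finite_measure_subalgebra M ?G
    by unfold_locales
  show ?thesis
  proof (cases "\<Phi> \<in> borel_measurable M")
    case True
    have "(\<integral>\<^sup>+\<omega>. \<Phi> \<omega> \<partial>M) = (\<integral>\<^sup>+\<omega>. nn_cond_exp M ?G \<Phi> \<omega> \<partial>M)"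
      using G.nn_cond_exp_intg[of "\<lambda>_. 1" \<Phi>] True by simp
    also have "\<dots> = (\<integral>\<^sup>+\<omega>. ennreal (lam * \<psi>\<^sub>c (\<tau> \<omega>) \<omega> * (if \<tau> \<omega> < T then 1 else 0)) \<partial>M)"
      using ae by (rule nn_integral_cong_AE)
    finally show ?thesis ..
  next
    case False
    then have "nn_cond_exp M ?G \<Phi> = (\<lambda>_. 0)" by (simp add: nn_cond_exp_def)
    with ae have "AE \<omega> in M. ennreal (lam * \<psi>\<^sub>c (\<tau> \<omega>) \<omega> * (if \<tau> \<omega> < T then 1 else 0)) = 0" by simp
    with \<psi>\<^sub>c AE_space have "AE \<omega> in M. \<tau> \<omega> = T"
    proof eventually_elim
      case (elim \<omega>)
      show ?case
      proof (rule ccontr)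
        assume "\<tau> \<omega> \<noteq> T"
        with \<tau>(2)[OF elim(2)] have "\<tau> \<omega> < T" by auto
        with elim(1) time_set_less have "0 < \<psi>\<^sub>c (\<tau> \<omega>) \<omega>" by blast
        with elim(3) \<open>\<tau> \<omega> < T\<close> \<open>0 < lam\<close> show False
          by (auto simp: ennreal_eq_0_iff mult_le_0_iff)
      qed
    qed
    then show ?thesis ..
  qed
qed

end

section \<open>Optimality of the candidate\<close>

text \<open>\<open>S\<close>, \<open>R\<close>, \<open>p\<^sub>x\<close>, \<open>p\<^sub>c\<close> are versions of the running supremum of \<open>l\<close>, of \<open>cum r\<close> and of the prices with
  regular paths everywhere.\<close>

locale regular_candidate = usual_filtered_space M F T
  for M :: "'a measure" and F and T +
  fixes \<psi>\<^sub>x \<psi>\<^sub>c r :: "'a process" and n :: nat and u :: "real \<Rightarrow> real \<Rightarrow> real" and lam :: real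
    and l S R p\<^sub>x p\<^sub>c :: "'a process"
  assumes u: "utility_function u" and n: "1 < n" and lam: "0 < lam"
    and S: "adapted F T S" "\<And>\<omega>. \<omega> \<in> space M \<Longrightarrow> contribution_path T (\<lambda>t. S t \<omega>)"
    and R: "adapted F T R" "\<And>\<omega>. \<omega> \<in> space M \<Longrightarrow> right_continuous_path T (\<lambda>t. R t \<omega>)"
    and p\<^sub>x: "adapted F T p\<^sub>x" "\<And>\<omega>. \<omega> \<in> space M \<Longrightarrow> right_continuous_path T (\<lambda>t. p\<^sub>x t \<omega>)"
    and p\<^sub>c: "adapted F T p\<^sub>c" "\<And>\<omega>. \<omega> \<in> space M \<Longrightarrow> right_continuous_path T (\<lambda>t. p\<^sub>c t \<omega>)"
    and versions: "AE \<omega> in M. \<forall>t\<in>time_set T. cum r t \<omega> = R t \<omega> \<and> \<psi>\<^sub>x t \<omega> = p\<^sub>x t \<omega> \<and> \<psi>\<^sub>c t \<omega> = p\<^sub>c t \<omega> \<and>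
      0 < p\<^sub>x t \<omega> \<and> 0 < p\<^sub>c t \<omega>"
    and S_eq: "AE \<omega> in M. \<forall>t\<in>time_set T. S t \<omega> = max (SUP s\<in>{0..t}. l s \<omega>) 0 \<and>
      bdd_above ((\<lambda>s. l s \<omega>) ` {0..t})"
    and l_T: "AE \<omega> in M. l T \<omega> = 0"
    and solves: "solves_backward_equation M F T \<psi>\<^sub>x \<psi>\<^sub>c r n u lam l"
begin

section \<open>Measurable versions of the quantities at the candidate\<close>

lemma jointly_measurable:
  assumes "adapted F T Y" "\<And>\<omega>. \<omega> \<in> space M \<Longrightarrow> right_continuous_path T (\<lambda>t. Y t \<omega>)"
  shows "(\<lambda>z. Y (snd z) (fst z)) \<in> borel_measurable (M \<Otimes>\<^sub>M time_borel T)"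
  using optional_jointly_measurable[OF right_continuous_optional_sigma[OF assms]]
  by (simp add: case_prod_beta)

lemma contribution_path_right_continuous:
  "contribution_path T C \<Longrightarrow> right_continuous_path T C"
  by (simp add: contribution_path_def)

lemmas measurable_versions [measurable] =
  jointly_measurable[OF S(1) contribution_path_right_continuous[OF S(2)]]
  jointly_measurable[OF R] jointly_measurable[OF p\<^sub>x] jointly_measurable[OF p\<^sub>c]

text \<open>The value of \<open>D\<^sub>x u\<close> at the candidate by the first order condition;
  the exponential undoes the discounting.\<close>

definition shadow_price :: "'a \<times> ennreal \<Rightarrow> real" where
  "shadow_price z = lam * exp (R (snd z) (fst z)) * p\<^sub>x (snd z) (fst z)"

text \<open>The discounted marginal utility of the public good at the candidate, set to
  \<open>0\<close> outside the quadrant to be jointly measurable.\<close>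

definition marginal :: "'a \<times> ennreal \<Rightarrow> real" where
  "marginal z = exp (- R (snd z) (fst z)) *
     (\<lambda>(\<psi>, c). if 0 < \<psi> \<and> 0 < c then h_fun u \<psi> c else 0)
       (shadow_price z, real n * S (snd z) (fst z))"

definition private_good :: "'a \<times> ennreal \<Rightarrow> real" where
  "private_good z = (\<lambda>(\<psi>, c). g_inv u \<psi> c) (shadow_price z, real n * S (snd z) (fst z))"

text \<open>Written with the original processes instead of the versions, so that the backward
  equation applies to it literally.\<close>

definition future :: "('a \<Rightarrow> ennreal) \<Rightarrow> 'a \<Rightarrow> ennreal" where
  "future \<tau> \<omega> = (\<integral>\<^sup>+t\<in>{\<tau> \<omega>..T}. ennreal (exp (- cum r t \<omega>) *
     h_fun u (lam * exp (cum r t \<omega>) * \<psi>\<^sub>x t \<omega>) (real n * (SUP s\<in>{\<tau> \<omega>..t}. l s \<omega>))) \<partial>dt T)"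

abbreviation benefit :: "'a process \<Rightarrow> real \<Rightarrow> 'a \<Rightarrow> ennreal" where
  "benefit \<equiv> benefit_after_hit (\<lambda>z. ennreal (marginal z))"

abbreviation contribution_price :: "'a process \<Rightarrow> real \<Rightarrow> 'a \<Rightarrow> ennreal" where
  "contribution_price \<equiv> price_at_hit (\<lambda>z. p\<^sub>c (snd z) (fst z))"

lemma measurable_shadow_price [measurable]: "shadow_price \<in> borel_measurable (M \<Otimes>\<^sub>M time_borel T)"
  unfolding shadow_price_def[abs_def] by measurable

lemma measurable_marginal [measurable]: "marginal \<in> borel_measurable (M \<Otimes>\<^sub>M time_borel T)"
  unfolding marginal_def[abs_def] using borel_measurable_h_fun[OF u] by measurable

lemma measurable_private_good [measurable]: "private_good \<in> borel_measurable (M \<Otimes>\<^sub>M time_borel T)"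
  unfolding private_good_def[abs_def] using borel_measurable_g_inv[OF u] by measurable

lemma marginal_nonneg: "0 \<le> marginal z"
  using h_fun_nonneg[OF u] by (auto simp: marginal_def split: prod.split)

section \<open>Benefit and price of a single level\<close>

lemma AE_sup_pos:
  assumes "stopping_time F \<tau>" "\<And>\<omega>. \<tau> \<omega> \<le> T"
  shows "AE \<omega> in M. AE t in dt T. \<tau> \<omega> \<le> t \<longrightarrow> 0 < (SUP s\<in>{\<tau> \<omega>..t}. l s \<omega>)"
  using solves assms unfolding solves_backward_equation_def by blast

text \<open>Positivity of the restarted supremum passes to the full one, which makes the truncation
  at \<open>0\<close> inactive. Boundedness is essential: the real \<open>SUP\<close> is monotone
  only on bounded sets.\<close>

lemma S_eq_sup:
  assumes S: "S t \<omega> = max (SUP s\<in>{0..t}. l s \<omega>) 0" "bdd_above ((\<lambda>s. l s \<omega>) ` {0..t})"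
    and "\<tau> \<le> t" "0 < (SUP s\<in>{\<tau>..t}. l s \<omega>)"
  shows "(SUP s\<in>{\<tau>..t}. l s \<omega>) \<le> S t \<omega>" "S t \<omega> = (SUP s\<in>{0..t}. l s \<omega>)" "0 < S t \<omega>"
proof -
  have "(SUP s\<in>{\<tau>..t}. l s \<omega>) \<le> (SUP s\<in>{0..t}. l s \<omega>)"
    using assms by (intro cSUP_subset_mono) auto
  with assms show "(SUP s\<in>{\<tau>..t}. l s \<omega>) \<le> S t \<omega>" "S t \<omega> = (SUP s\<in>{0..t}. l s \<omega>)" "0 < S t \<omega>"
    by simp_all
qed

lemma marginal_eq:
  assumes "cum r t \<omega> = R t \<omega>" "\<psi>\<^sub>x t \<omega> = p\<^sub>x t \<omega>" "0 < p\<^sub>x t \<omega>" "0 < S t \<omega>"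
  shows "marginal (\<omega>, t) = exp (- cum r t \<omega>) * h_fun u (lam * exp (cum r t \<omega>) * \<psi>\<^sub>x t \<omega>) (real n * S t \<omega>)"
  using assms lam n by (simp add: marginal_def shadow_price_def)

lemma benefit_le_future:
  assumes C: "adapted F T C" "\<And>\<omega>. \<omega> \<in> space M \<Longrightarrow> contribution_path T (\<lambda>t. C t \<omega>)"
  shows "AE \<omega> in M. benefit C a \<omega> \<le> future (\<lambda>\<omega>. hit T (\<lambda>t. C t \<omega>) a) \<omega>"
proof -
  have "stopping_time F (\<lambda>\<omega>. hit T (\<lambda>t. C t \<omega>) a)"
    by (rule hit_stopping_time) (use C in auto)
  from AE_sup_pos[OF this hit_le] versions S_eq show ?thesis
  proof eventually_elim
    case (elim \<omega>)
    let ?\<tau> = "hit T (\<lambda>t. C t \<omega>) a"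
    show ?case
      unfolding benefit_after_hit_def future_def
    proof (rule nn_integral_mono_AE)
      show "AE t in dt T. ennreal (marginal (\<omega>, t)) * (if ?\<tau> \<le> t then 1 else 0) \<le>
        ennreal (exp (- cum r t \<omega>) * h_fun u (lam * exp (cum r t \<omega>) * \<psi>\<^sub>x t \<omega>)
          (real n * (SUP s\<in>{?\<tau>..t}. l s \<omega>))) * indicator {?\<tau>..T} t"
        using elim(1) AE_space
      proof eventually_elim
        case (elim t)
        note t = elim
        show ?case
        proof (cases "?\<tau> \<le> t")
          case True
          have tT: "t \<in> time_set T" using t(2) by simp
          note v = \<open>\<forall>t\<in>time_set T. cum r t \<omega> = R t \<omega> \<and> _\<close>[rule_format, OF tT]
          note s = \<open>\<forall>t\<in>time_set T. S t \<omega> = _ \<and> _\<close>[rule_format, OF tT]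
          have pos: "0 < (SUP s\<in>{?\<tau>..t}. l s \<omega>)" using t(1) True by blast
          note sup = S_eq_sup[OF conjunct1[OF s] conjunct2[OF s] True pos]
          have "marginal (\<omega>, t) = exp (- cum r t \<omega>) *
              h_fun u (lam * exp (cum r t \<omega>) * \<psi>\<^sub>x t \<omega>) (real n * S t \<omega>)"
            using v sup(3) by (intro marginal_eq) auto
          also have "\<dots> \<le> exp (- cum r t \<omega>) * h_fun u (lam * exp (cum r t \<omega>) * \<psi>\<^sub>x t \<omega>)
              (real n * (SUP s\<in>{?\<tau>..t}. l s \<omega>))"
            using v lam n pos sup(1) by (intro mult_left_mono h_fun_antimono[OF u]) auto
          finally have "marginal (\<omega>, t) \<le> exp (- cum r t \<omega>) * h_fun u (lam * exp (cum r t \<omega>) * \<psi>\<^sub>x t \<omega>)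
              (real n * (SUP s\<in>{?\<tau>..t}. l s \<omega>))" .
          then show ?thesis
            using True tT by (simp add: ennreal_leI time_set_def)
        qed simp
      qed
    qed
  qed
qed

text \<open>Before the hitting time \<open>l\<close> stays below \<open>a\<close>. As
  \<open>a < S t \<omega>\<close>, the values of \<open>l\<close> that approach the supremum occur
  after it, so restarting there loses nothing.\<close>

lemma sup_after_hit:
  assumes S: "\<And>t. t \<in> time_set T \<Longrightarrow> S t \<omega> = max (SUP s\<in>{0..t}. l s \<omega>) 0 \<and> bdd_above ((\<lambda>s. l s \<omega>) ` {0..t})"
    and path: "contribution_path T (\<lambda>t. S t \<omega>)"
    and t: "t \<in> time_set T" "t < T" "hit T (\<lambda>t. S t \<omega>) a \<le> t" and a: "0 < a" "a < S t \<omega>"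
  shows "(SUP s\<in>{hit T (\<lambda>t. S t \<omega>) a..t}. l s \<omega>) = S t \<omega>"
proof -
  let ?\<tau> = "hit T (\<lambda>t. S t \<omega>) a"
  let ?b = "SUP s\<in>{?\<tau>..t}. l s \<omega>"
  have bdd: "bdd_above ((\<lambda>s. l s \<omega>) ` {0..t})" using S[OF t(1)] by simp
  have S_t: "S t \<omega> = (SUP s\<in>{0..t}. l s \<omega>)" using S[OF t(1)] a by auto
  have before: "l s \<omega> < a" if "s < ?\<tau>" for s
  proof -
    have s: "s < T" using that hit_le[of T "\<lambda>t. S t \<omega>" a] by (rule order_less_le_trans)
    have sT: "s \<in> time_set T" by (rule time_set_less[OF s])
    have "S s \<omega> < a"
      using hit_le_iff[OF _ _ s, of "\<lambda>t. S t \<omega>" a] path that by (auto simp: contribution_path_def not_le[symmetric])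
    moreover have "l s \<omega> \<le> (SUP s\<in>{0..s}. l s \<omega>)"
      using S[OF sT] by (intro cSUP_upper) auto
    ultimately show ?thesis using S[OF sT] by auto
  qed
  have "?b \<le> S t \<omega>"
    unfolding S_t using t(3) bdd by (intro cSUP_subset_mono) auto
  moreover have "S t \<omega> \<le> ?b"
  proof (rule ccontr)
    assume "\<not> S t \<omega> \<le> ?b"
    with a(2) have "max ?b a < S t \<omega>" by simp
    then have "max ?b a < (SUP s\<in>{0..t}. l s \<omega>)" by (simp only: S_t)
    then obtain s where s: "s \<in> {0..t}" "max ?b a < l s \<omega>"
      using less_cSUP_iff[of "{0..t}" "\<lambda>s. l s \<omega>" "max ?b a"] bdd by (auto simp del: max_less_iff_conj)
    then have "?\<tau> \<le> s" using before[of s] by (auto simp: not_less[symmetric])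
    then have "l s \<omega> \<le> ?b"
      using s(1) by (intro cSUP_upper bdd_above_mono[OF bdd]) auto
    with s(2) show False by simp
  qed
  ultimately show ?thesis by (rule antisym)
qed

lemma benefit_eq_future:
  "AE a in lborel. 0 < a \<longrightarrow> (AE \<omega> in M. benefit S a \<omega> = future (\<lambda>\<omega>. hit T (\<lambda>t. S t \<omega>) a) \<omega>)"
proof -
  interpret MA: pair_sigma_finite M "lborel :: real measure"
    by (intro pair_sigma_finite.intro lborel.sigma_finite_measure_axioms sigma_finite_measure_axioms)
  obtain D :: "ennreal set" where D: "countable D" "\<And>X. open X \<Longrightarrow> X \<noteq> {} \<Longrightarrow> \<exists>d\<in>D. d \<in> X"
    using countable_dense_exists by blast
  \<comment> \<open>For each outcome only the one level \<open>S q \<omega>\<close> is excluded;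
    Fubini turns this into almost every level.\<close>
  have "AE a in lborel. AE \<omega> in M. S q \<omega> \<noteq> a" if q: "q \<in> time_set T" for q
  proof -
    have [measurable]: "S q \<in> borel_measurable M"
      using S(1) q unfolding adapted_def by (intro measurable_F) blast
    have "{z \<in> space (M \<Otimes>\<^sub>M lborel). S q (fst z) \<noteq> snd z} \<in> sets (M \<Otimes>\<^sub>M lborel)"
      by measurable
    moreover have "AE \<omega> in M. AE a in lborel. S q \<omega> \<noteq> a"
    proof (rule AE_I2)
      fix \<omega>
      show "AE a in lborel. S q \<omega> \<noteq> a"
        using AE_lborel_singleton[of "S q \<omega>"] by eventually_elim auto
    qed
    ultimately show ?thesis
      using MA.AE_commute[of "\<lambda>\<omega> a. S q \<omega> \<noteq> a"] by blast
  qed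
  text \<open>If \<open>S\<close> rests on the level \<open>a\<close> for some time, then \<open>S q = a\<close> for some \<open>q \<in> D\<close>.\<close>
  then have "AE a in lborel. \<forall>q\<in>D \<inter> time_set T. AE \<omega> in M. S q \<omega> \<noteq> a"
    using D(1) by (subst AE_ball_countable) auto
  then show ?thesis
  proof eventually_elim
    case (elim a)
    show ?case
    proof
      assume a: "0 < a"
      have "AE \<omega> in M. \<forall>q\<in>D \<inter> time_set T. S q \<omega> \<noteq> a"
        using elim D(1) by (subst AE_ball_countable) auto
      moreover have "stopping_time F (\<lambda>\<omega>. hit T (\<lambda>t. S t \<omega>) a)"
        by (rule hit_stopping_time) (use S in auto)
      note AE_sup_pos[OF this hit_le] versions S_eq AE_space
      ultimately show "AE \<omega> in M. benefit S a \<omega> = future (\<lambda>\<omega>. hit T (\<lambda>t. S t \<omega>) a) \<omega>"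
      proof eventually_elim
        case (elim \<omega>)
        let ?\<tau> = "hit T (\<lambda>t. S t \<omega>) a"
        have path: "contribution_path T (\<lambda>t. S t \<omega>)" by (rule S(2)) fact
        show ?case
          unfolding benefit_after_hit_def future_def
        proof (rule nn_integral_cong_AE)
          show "AE t in dt T. ennreal (marginal (\<omega>, t)) * (if ?\<tau> \<le> t then 1 else 0) =
            ennreal (exp (- cum r t \<omega>) * h_fun u (lam * exp (cum r t \<omega>) * \<psi>\<^sub>x t \<omega>)
              (real n * (SUP s\<in>{?\<tau>..t}. l s \<omega>))) * indicator {?\<tau>..T} t"
            \<comment> \<open>Discarding the hitting time leaves room for a point of
              \<open>D\<close> strictly between it and \<open>t\<close>; \<open>T\<close> is
              discarded because \<open>hit_le_iff\<close> speaks only of earlier times.\<close>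
            using AE_dt_neq[of ?\<tau>] AE_dt_neq[of T] AE_space
          proof eventually_elim
            case t: (elim t)
            show ?case
            proof (cases "?\<tau> \<le> t")
              case True
              have tT: "t \<in> time_set T" "t < T" using t by (auto simp: time_set_def)
              have less: "?\<tau> < t" using True t(1) by auto
              have "a \<le> S t \<omega>"
                using hit_le_iff[OF _ _ tT(2), of "\<lambda>t. S t \<omega>" a] path True by (auto simp: contribution_path_def)
              moreover have "S t \<omega> \<noteq> a"
              proof
                assume eq: "S t \<omega> = a"
                have "{?\<tau><..<t} \<noteq> {}" using dense[OF less] by auto
                then obtain q where q: "q \<in> D" "?\<tau> < q" "q < t"
                  using D(2)[of "{?\<tau><..<t}"] by auto
                then have qT: "q < T" "q \<in> time_set T" using tT by (auto intro: time_set_less)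
                have "a \<le> S q \<omega>"
                  using hit_le_iff[OF _ _ qT(1), of "\<lambda>t. S t \<omega>" a] path q(2) by (auto simp: contribution_path_def)
                moreover have "S q \<omega> \<le> S t \<omega>"
                  using path q(3) qT tT by (auto simp: contribution_path_def intro: mono_onD)
                ultimately show False using eq elim(1) q(1) qT(2) by force
              qed
              ultimately have less_S: "a < S t \<omega>" by simp
              note v = elim(3)[rule_format, OF tT(1)]
              have sup: "(SUP s\<in>{?\<tau>..t}. l s \<omega>) = S t \<omega>"
                using elim(4) by (intro sup_after_hit path tT True a less_S) (erule (1) bspec)
              have "marginal (\<omega>, t) = exp (- cum r t \<omega>) *
                  h_fun u (lam * exp (cum r t \<omega>) * \<psi>\<^sub>x t \<omega>) (real n * S t \<omega>)"
                using v a less_S by (intro marginal_eq) auto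
              then show ?thesis
                using True tT unfolding sup by (simp add: time_set_def)
            qed simp
          qed
        qed
      qed
    qed
  qed
qed

lemma measurable_contribution_price:
  assumes C: "adapted F T C" "\<And>\<omega>. \<omega> \<in> space M \<Longrightarrow> contribution_path T (\<lambda>t. C t \<omega>)"
  shows "(\<lambda>z. contribution_price C (snd z) (fst z)) \<in> borel_measurable (M \<Otimes>\<^sub>M lborel)"
  by (rule price_at_hit_measurable) (use C measurable_versions in auto)

lemma measurable_contribution_price_level:
  assumes C: "adapted F T C" "\<And>\<omega>. \<omega> \<in> space M \<Longrightarrow> contribution_path T (\<lambda>t. C t \<omega>)"
  shows "contribution_price C a \<in> borel_measurable M"
proof -
  have "(\<lambda>\<omega>. (\<omega>, a)) \<in> M \<rightarrow>\<^sub>M M \<Otimes>\<^sub>M lborel" by measurable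
  from measurable_compose[OF this measurable_contribution_price[OF C]] show ?thesis by simp
qed

text \<open>The second alternative is the case that the hitting time is almost surely
  \<open>T\<close>. Then there is nothing to compare: \<open>dt T\<close> gives no mass to
  \<open>T\<close>, and \<open>price_at_hit\<close> ignores it.\<close>

lemma expectation_future:
  assumes C: "adapted F T C" "\<And>\<omega>. \<omega> \<in> space M \<Longrightarrow> contribution_path T (\<lambda>t. C t \<omega>)"
    and a: "0 < a"
  shows "(\<integral>\<^sup>+\<omega>. future (\<lambda>\<omega>. hit T (\<lambda>t. C t \<omega>) a) \<omega> \<partial>M) = ennreal lam * (\<integral>\<^sup>+\<omega>. contribution_price C a \<omega> \<partial>M)
    \<or> (AE \<omega> in M. benefit C a \<omega> = 0 \<and> contribution_price C a \<omega> = 0)"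
proof -
  let ?\<tau> = "\<lambda>\<omega>. hit T (\<lambda>t. C t \<omega>) a"
  have \<tau>: "stopping_time F ?\<tau>"
    by (rule hit_stopping_time) (use C in auto)
  have pos: "AE \<omega> in M. \<forall>t\<in>time_set T. 0 < \<psi>\<^sub>c t \<omega>"
    using versions by eventually_elim simp
  consider
      "(\<integral>\<^sup>+\<omega>. future ?\<tau> \<omega> \<partial>M) = (\<integral>\<^sup>+\<omega>. ennreal (lam * \<psi>\<^sub>c (?\<tau> \<omega>) \<omega> * (if ?\<tau> \<omega> < T then 1 else 0)) \<partial>M)"
    | "AE \<omega> in M. ?\<tau> \<omega> = T"
    using backward_equation_expectation[OF solves lam pos \<tau> hit_le] unfolding future_def by blast
  then show ?thesis
  proof cases
    case 1
    have "AE \<omega> in M. ennreal (lam * \<psi>\<^sub>c (?\<tau> \<omega>) \<omega> * (if ?\<tau> \<omega> < T then 1 else 0)) =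
        ennreal lam * contribution_price C a \<omega>"
      using versions
    proof eventually_elim
      case (elim \<omega>)
      show ?case
      proof (cases "?\<tau> \<omega> < T")
        case True
        with elim time_set_less have "\<psi>\<^sub>c (?\<tau> \<omega>) \<omega> = p\<^sub>c (?\<tau> \<omega>) \<omega>" "0 < p\<^sub>c (?\<tau> \<omega>) \<omega>"
          by blast+
        with True a lam show ?thesis
          by (simp add: price_at_hit_def Let_def ennreal_mult)
      qed (simp add: price_at_hit_def)
    qed
    then have "(\<integral>\<^sup>+\<omega>. ennreal (lam * \<psi>\<^sub>c (?\<tau> \<omega>) \<omega> * (if ?\<tau> \<omega> < T then 1 else 0)) \<partial>M) =
        (\<integral>\<^sup>+\<omega>. ennreal lam * contribution_price C a \<omega> \<partial>M)"
      by (rule nn_integral_cong_AE)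
    also have "\<dots> = ennreal lam * (\<integral>\<^sup>+\<omega>. contribution_price C a \<omega> \<partial>M)"
      by (rule nn_integral_cmult) (rule measurable_contribution_price_level[OF C])
    finally show ?thesis using 1 by simp
  next
    case 2
    then have "AE \<omega> in M. benefit C a \<omega> = 0 \<and> contribution_price C a \<omega> = 0"
    proof eventually_elim
      case (elim \<omega>)
      have "AE t in dt T. ennreal (marginal (\<omega>, t)) * (if ?\<tau> \<omega> \<le> t then 1 else 0) = 0"
        using AE_dt_neq[of T] AE_space
        by eventually_elim (use elim in \<open>auto simp: time_set_def\<close>)
      then have "benefit C a \<omega> = (\<integral>\<^sup>+t. 0 \<partial>dt T)"
        unfolding benefit_after_hit_def by (rule nn_integral_cong_AE)
      with elim show ?case by (simp add: price_at_hit_def)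
    qed
    then show ?thesis ..
  qed
qed

lemma benefit_le_price:
  assumes C: "adapted F T C" "\<And>\<omega>. \<omega> \<in> space M \<Longrightarrow> contribution_path T (\<lambda>t. C t \<omega>)"
    and a: "0 < a"
  shows "(\<integral>\<^sup>+\<omega>. benefit C a \<omega> \<partial>M) \<le> ennreal lam * (\<integral>\<^sup>+\<omega>. contribution_price C a \<omega> \<partial>M)"
  using expectation_future[OF C a]
proof
  assume "(\<integral>\<^sup>+\<omega>. future (\<lambda>\<omega>. hit T (\<lambda>t. C t \<omega>) a) \<omega> \<partial>M) =
    ennreal lam * (\<integral>\<^sup>+\<omega>. contribution_price C a \<omega> \<partial>M)"
  then show ?thesis
    using nn_integral_mono_AE[OF benefit_le_future[OF C, of a]] by simp
next
  assume "AE \<omega> in M. benefit C a \<omega> = 0 \<and> contribution_price C a \<omega> = 0"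
  then have "(\<integral>\<^sup>+\<omega>. benefit C a \<omega> \<partial>M) = (\<integral>\<^sup>+\<omega>. 0 \<partial>M)"
    by (intro nn_integral_cong_AE) (auto elim: eventually_mono)
  then show ?thesis by simp
qed

lemma price_le_benefit:
  "AE a in lborel. 0 < a \<longrightarrow>
    ennreal lam * (\<integral>\<^sup>+\<omega>. contribution_price S a \<omega> \<partial>M) \<le> (\<integral>\<^sup>+\<omega>. benefit S a \<omega> \<partial>M)"
  using benefit_eq_future
proof eventually_elim
  case (elim a)
  show ?case
  proof
    assume a: "0 < a"
    from expectation_future[OF S a]
    show "ennreal lam * (\<integral>\<^sup>+\<omega>. contribution_price S a \<omega> \<partial>M) \<le> (\<integral>\<^sup>+\<omega>. benefit S a \<omega> \<partial>M)"
    proof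
      assume "(\<integral>\<^sup>+\<omega>. future (\<lambda>\<omega>. hit T (\<lambda>t. S t \<omega>) a) \<omega> \<partial>M) =
        ennreal lam * (\<integral>\<^sup>+\<omega>. contribution_price S a \<omega> \<partial>M)"
      then show ?thesis
        using nn_integral_cong_AE[OF mp[OF elim a]] by simp
    next
      assume "AE \<omega> in M. benefit S a \<omega> = 0 \<and> contribution_price S a \<omega> = 0"
      then have "(\<integral>\<^sup>+\<omega>. contribution_price S a \<omega> \<partial>M) = (\<integral>\<^sup>+\<omega>. 0 \<partial>M)"
        by (intro nn_integral_cong_AE) (auto elim: eventually_mono)
      then show ?thesis by simp
    qed
  qed
qed

section \<open>Integration over all levels\<close>

lemma total_price:
  assumes C: "adapted F T C" "\<And>\<omega>. \<omega> \<in> space M \<Longrightarrow> contribution_path T (\<lambda>t. C t \<omega>)"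
  shows "(\<integral>\<^sup>+a. indicator {0<..} a * (ennreal lam * (\<integral>\<^sup>+\<omega>. contribution_price C a \<omega> \<partial>M)) \<partial>lborel) =
    ennreal lam * (\<integral>\<^sup>+\<omega>. \<integral>\<^sup>+a. contribution_price C a \<omega> \<partial>lborel \<partial>M)"
proof -
  interpret MA: pair_sigma_finite M "lborel :: real measure"
    by (intro pair_sigma_finite.intro lborel.sigma_finite_measure_axioms sigma_finite_measure_axioms)
  have m: "(\<lambda>(\<omega>, a). contribution_price C a \<omega>) \<in> borel_measurable (M \<Otimes>\<^sub>M lborel)"
    using measurable_contribution_price[OF C] by (simp add: case_prod_beta)
  have "(\<integral>\<^sup>+a. indicator {0<..} a * (ennreal lam * (\<integral>\<^sup>+\<omega>. contribution_price C a \<omega> \<partial>M)) \<partial>lborel) =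
      (\<integral>\<^sup>+a. ennreal lam * (\<integral>\<^sup>+\<omega>. contribution_price C a \<omega> \<partial>M) \<partial>lborel)"
    by (intro nn_integral_cong) (auto simp: indicator_def price_at_hit_def)
  also have "\<dots> = ennreal lam * (\<integral>\<^sup>+a. \<integral>\<^sup>+\<omega>. contribution_price C a \<omega> \<partial>M \<partial>lborel)"
  proof (rule nn_integral_cmult)
    have "(\<lambda>(a, \<omega>). contribution_price C a \<omega>) \<in> borel_measurable (lborel \<Otimes>\<^sub>M M)"
      using measurable_pair_swap[OF m] by (simp add: case_prod_beta)
    then show "(\<lambda>a. \<integral>\<^sup>+\<omega>. contribution_price C a \<omega> \<partial>M) \<in> borel_measurable lborel"
      by (rule borel_measurable_nn_integral)
  qed
  also have "(\<integral>\<^sup>+a. \<integral>\<^sup>+\<omega>. contribution_price C a \<omega> \<partial>M \<partial>lborel) =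
      (\<integral>\<^sup>+\<omega>. \<integral>\<^sup>+a. contribution_price C a \<omega> \<partial>lborel \<partial>M)"
    by (rule MA.Fubini'[OF m])
  finally show ?thesis .
qed

lemma total_benefit_le:
  assumes C: "adapted F T C" "\<And>\<omega>. \<omega> \<in> space M \<Longrightarrow> contribution_path T (\<lambda>t. C t \<omega>)"
  shows "(\<integral>\<^sup>+\<omega>. \<integral>\<^sup>+t. ennreal (marginal (\<omega>, t)) * ennreal (C t \<omega>) \<partial>dt T \<partial>M) \<le>
    ennreal lam * (\<integral>\<^sup>+\<omega>. \<integral>\<^sup>+a. contribution_price C a \<omega> \<partial>lborel \<partial>M)"
proof -
  have "(\<integral>\<^sup>+\<omega>. \<integral>\<^sup>+t. ennreal (marginal (\<omega>, t)) * ennreal (C t \<omega>) \<partial>dt T \<partial>M) =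
      (\<integral>\<^sup>+a. indicator {0<..} a * (\<integral>\<^sup>+\<omega>. benefit C a \<omega> \<partial>M) \<partial>lborel)"
    by (rule nn_integral_benefit) (use C in auto)
  also have "\<dots> \<le> (\<integral>\<^sup>+a. indicator {0<..} a * (ennreal lam * (\<integral>\<^sup>+\<omega>. contribution_price C a \<omega> \<partial>M)) \<partial>lborel)"
    by (intro nn_integral_mono) (auto simp: indicator_def intro: benefit_le_price[OF C])
  also have "\<dots> = ennreal lam * (\<integral>\<^sup>+\<omega>. \<integral>\<^sup>+a. contribution_price C a \<omega> \<partial>lborel \<partial>M)"
    by (rule total_price) (use C in auto)
  finally show ?thesis .
qed

lemma total_benefit_ge:
  "ennreal lam * (\<integral>\<^sup>+\<omega>. \<integral>\<^sup>+a. contribution_price S a \<omega> \<partial>lborel \<partial>M) \<le>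
    (\<integral>\<^sup>+\<omega>. \<integral>\<^sup>+t. ennreal (marginal (\<omega>, t)) * ennreal (S t \<omega>) \<partial>dt T \<partial>M)"
proof -
  have "ennreal lam * (\<integral>\<^sup>+\<omega>. \<integral>\<^sup>+a. contribution_price S a \<omega> \<partial>lborel \<partial>M) =
      (\<integral>\<^sup>+a. indicator {0<..} a * (ennreal lam * (\<integral>\<^sup>+\<omega>. contribution_price S a \<omega> \<partial>M)) \<partial>lborel)"
    by (rule total_price[OF S, symmetric])
  also have "\<dots> \<le> (\<integral>\<^sup>+a. indicator {0<..} a * (\<integral>\<^sup>+\<omega>. benefit S a \<omega> \<partial>M) \<partial>lborel)"
  proof (rule nn_integral_mono_AE)
    show "AE a in lborel. indicator {0<..} a * (ennreal lam * (\<integral>\<^sup>+\<omega>. contribution_price S a \<omega> \<partial>M)) \<le>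
        indicator {0<..} a * (\<integral>\<^sup>+\<omega>. benefit S a \<omega> \<partial>M)"
      using price_le_benefit by eventually_elim (auto simp: indicator_def)
  qed
  also have "\<dots> = (\<integral>\<^sup>+\<omega>. \<integral>\<^sup>+t. ennreal (marginal (\<omega>, t)) * ennreal (S t \<omega>) \<partial>dt T \<partial>M)"
    by (rule nn_integral_benefit[symmetric]) (use S in auto)
  finally show ?thesis .
qed

end

section \<open>From concavity to the comparison of payoffs\<close>

context regular_candidate
begin

abbreviation others :: "'a process" where
  "others \<equiv> \<lambda>t \<omega>. (real n - 1) * S t \<omega>"

abbreviation product_time :: "('a \<times> ennreal) measure" where
  "product_time \<equiv> M \<Otimes>\<^sub>M dt T"

lemma measurable_product_time: "measurable product_time N = measurable (M \<Otimes>\<^sub>M time_borel T) N"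
  by (rule measurable_cong_sets[OF sets_pair_measure_cong[OF refl sets_dt] refl])

lemma nn_integral_product_time:
  "f \<in> borel_measurable (M \<Otimes>\<^sub>M time_borel T) \<Longrightarrow>
    (\<integral>\<^sup>+\<omega>. \<integral>\<^sup>+t. f (\<omega>, t) \<partial>dt T \<partial>M) = (\<integral>\<^sup>+z. f z \<partial>product_time)"
  by (intro dt.nn_integral_fst) (simp only: measurable_product_time)

definition discounted_utility :: "('a \<times> ennreal \<Rightarrow> real) \<Rightarrow> ('a \<times> ennreal \<Rightarrow> real) \<Rightarrow> 'a \<times> ennreal \<Rightarrow> real" where
  "discounted_utility x c z = exp (- R (snd z) (fst z)) * (\<lambda>(x, c). u (max x 0) (max c 0)) (x z, c z)"

lemma measurable_discounted_utility:
  assumes [measurable]: "x \<in> borel_measurable (M \<Otimes>\<^sub>M time_borel T)" "c \<in> borel_measurable (M \<Otimes>\<^sub>M time_borel T)"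
  shows "discounted_utility x c \<in> borel_measurable (M \<Otimes>\<^sub>M time_borel T)"
  unfolding discounted_utility_def[abs_def] using borel_measurable_utility[OF u] by measurable

lemma discounted_utility_nonneg: "0 \<le> discounted_utility x c z"
  using utility_nonneg[OF u] by (simp add: discounted_utility_def)

lemma payoff_version:
  assumes "AE \<omega> in M. \<forall>t\<in>time_set T. x' t \<omega> = x (\<omega>, t) \<and> C t \<omega> + C' t \<omega> = c (\<omega>, t) \<and>
      0 \<le> x (\<omega>, t) \<and> 0 \<le> c (\<omega>, t)"
    and "x \<in> borel_measurable (M \<Otimes>\<^sub>M time_borel T)" "c \<in> borel_measurable (M \<Otimes>\<^sub>M time_borel T)"
  shows "payoff M T r u x' C C' = (\<integral>\<^sup>+z. ennreal (discounted_utility x c z) \<partial>product_time)"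
proof -
  have "payoff M T r u x' C C' = (\<integral>\<^sup>+\<omega>. \<integral>\<^sup>+t. ennreal (discounted_utility x c (\<omega>, t)) \<partial>dt T \<partial>M)"
    unfolding payoff_def
  proof (rule nn_integral_cong_AE)
    show "AE \<omega> in M. (\<integral>\<^sup>+t. ennreal (exp (- cum r t \<omega>) * u (x' t \<omega>) (C t \<omega> + C' t \<omega>)) \<partial>dt T) =
        (\<integral>\<^sup>+t. ennreal (discounted_utility x c (\<omega>, t)) \<partial>dt T)"
      using assms(1) versions
      by eventually_elim (intro nn_integral_cong, auto simp: discounted_utility_def max_def)
  qed
  then show ?thesis
    using measurable_discounted_utility[OF assms(2,3)] by (subst nn_integral_product_time[symmetric]) auto
qed

text \<open>\<open>W\<close> is the cost without contributions at \<open>T\<close>. The inequality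
  serves the deviation, the equality the candidate. Unlike in \<open>cost\<close>, the summands of
  \<open>W\<close> are visibly measurable in the outcome and can be integrated separately.\<close>

lemma cost_version:
  fixes x' C' :: "'a process"
  assumes C: "adapted F T C" "\<And>\<omega>. \<omega> \<in> space M \<Longrightarrow> contribution_path T (\<lambda>t. C t \<omega>)"
    and x: "x \<in> borel_measurable (M \<Otimes>\<^sub>M time_borel T)"
    and eq: "AE \<omega> in M. \<forall>t\<in>time_set T. x' t \<omega> = x (\<omega>, t)" "AE \<omega> in M. \<forall>t. C' t \<omega> = C t \<omega>"
  defines "W \<equiv> (\<integral>\<^sup>+z. ennreal (p\<^sub>x (snd z) (fst z) * x z) \<partial>product_time) +
      (\<integral>\<^sup>+\<omega>. \<integral>\<^sup>+a. contribution_price C a \<omega> \<partial>lborel \<partial>M)"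
  shows "W \<le> cost M T \<psi>\<^sub>x \<psi>\<^sub>c x' C'"
    and "AE \<omega> in M. T < \<infinity> \<longrightarrow> (\<forall>a. 0 < a \<longrightarrow> a < C T \<omega> \<longrightarrow> (\<exists>t<T. a \<le> C t \<omega>)) \<Longrightarrow>
      cost M T \<psi>\<^sub>x \<psi>\<^sub>c x' C' = W"
proof -
  let ?E = "\<lambda>z. ennreal (p\<^sub>x (snd z) (fst z) * x z)"
  let ?J = "\<lambda>\<omega>. \<integral>\<^sup>+a. contribution_price C a \<omega> \<partial>lborel"
  note x [measurable]
  have E: "?E \<in> borel_measurable (M \<Otimes>\<^sub>M time_borel T)" by measurable
  have W: "W = (\<integral>\<^sup>+\<omega>. (\<integral>\<^sup>+t. ?E (\<omega>, t) \<partial>dt T) + ?J \<omega> \<partial>M)"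
    unfolding W_def nn_integral_product_time[OF E, symmetric]
  proof (rule nn_integral_add[symmetric])
    show "(\<lambda>\<omega>. \<integral>\<^sup>+t. ?E (\<omega>, t) \<partial>dt T) \<in> borel_measurable M"
      by (rule dt.borel_measurable_nn_integral_fst) (use E in \<open>simp only: measurable_product_time\<close>)
    show "?J \<in> borel_measurable M"
      using measurable_contribution_price[OF C]
      by (intro lborel.borel_measurable_nn_integral) (simp add: case_prod_beta)
  qed
  have cost: "cost M T \<psi>\<^sub>x \<psi>\<^sub>c x' C' = (\<integral>\<^sup>+\<omega>. (\<integral>\<^sup>+t. ?E (\<omega>, t) \<partial>dt T) +
      (\<integral>\<^sup>+t. ennreal (p\<^sub>c t \<omega>) \<partial>stieltjes T (\<lambda>t. C t \<omega>)) \<partial>M)"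
    unfolding cost_def
  proof (rule nn_integral_cong_AE)
    show "AE \<omega> in M. (\<integral>\<^sup>+t. ennreal (\<psi>\<^sub>x t \<omega> * x' t \<omega>) \<partial>dt T) +
        (\<integral>\<^sup>+t. ennreal (\<psi>\<^sub>c t \<omega>) \<partial>stieltjes T (\<lambda>t. C' t \<omega>)) =
      (\<integral>\<^sup>+t. ?E (\<omega>, t) \<partial>dt T) + (\<integral>\<^sup>+t. ennreal (p\<^sub>c t \<omega>) \<partial>stieltjes T (\<lambda>t. C t \<omega>))"
      using eq versions
    proof eventually_elim
      case (elim \<omega>)
      have "(\<lambda>t. C' t \<omega>) = (\<lambda>t. C t \<omega>)" using elim(2) by blast
      moreover have "(\<integral>\<^sup>+t. ennreal (\<psi>\<^sub>x t \<omega> * x' t \<omega>) \<partial>dt T) = (\<integral>\<^sup>+t. ?E (\<omega>, t) \<partial>dt T)"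
        using elim by (intro nn_integral_cong) simp
      moreover have "(\<integral>\<^sup>+t. ennreal (\<psi>\<^sub>c t \<omega>) \<partial>stieltjes T (\<lambda>t. C t \<omega>)) =
          (\<integral>\<^sup>+t. ennreal (p\<^sub>c t \<omega>) \<partial>stieltjes T (\<lambda>t. C t \<omega>))"
        using elim by (intro nn_integral_cong) (simp add: stieltjes_def)
      ultimately show ?case by simp
    qed
  qed
  have pc: "(\<lambda>t. p\<^sub>c t \<omega>) \<in> borel_measurable (time_borel T)" if "\<omega> \<in> space M" for \<omega>
    using measurable_compose[OF measurable_Pair1'[OF that] jointly_measurable[OF p\<^sub>c]] by simp
  note st = stieltjes_price[of C _ "\<lambda>z. p\<^sub>c (snd z) (fst z)", simplified]
  show "W \<le> cost M T \<psi>\<^sub>x \<psi>\<^sub>c x' C'"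
    unfolding W cost by (intro nn_integral_mono add_left_mono st(1) C(2) pc)
  assume no_jump: "AE \<omega> in M. T < \<infinity> \<longrightarrow> (\<forall>a. 0 < a \<longrightarrow> a < C T \<omega> \<longrightarrow> (\<exists>t<T. a \<le> C t \<omega>))"
  show "cost M T \<psi>\<^sub>x \<psi>\<^sub>c x' C' = W"
    unfolding W cost
  proof (rule nn_integral_cong_AE)
    show "AE \<omega> in M. (\<integral>\<^sup>+t. ?E (\<omega>, t) \<partial>dt T) + (\<integral>\<^sup>+t. ennreal (p\<^sub>c t \<omega>) \<partial>stieltjes T (\<lambda>t. C t \<omega>)) =
        (\<integral>\<^sup>+t. ?E (\<omega>, t) \<partial>dt T) + ?J \<omega>"
      using no_jump AE_space
    proof eventually_elim
      case (elim \<omega>)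
      have "(\<integral>\<^sup>+t. ennreal (p\<^sub>c t \<omega>) \<partial>stieltjes T (\<lambda>t. C t \<omega>)) = ?J \<omega>"
        by (rule st(2)[OF C(2)[OF elim(2)] pc[OF elim(2)]]) (use elim(1) in auto)
      then show ?case by simp
    qed
  qed
qed

text \<open>As \<open>l\<close> vanishes at \<open>T\<close>, contributions at \<open>T\<close>, which would yield no utility, do not occur.\<close>

lemma no_terminal_jump:
  "AE \<omega> in M. T < \<infinity> \<longrightarrow> (\<forall>a. 0 < a \<longrightarrow> a < S T \<omega> \<longrightarrow> (\<exists>t<T. a \<le> S t \<omega>))"
  using S_eq l_T
proof eventually_elim
  case (elim \<omega>)
  show ?case
  proof (intro impI allI)
    fix a assume T: "T < \<infinity>" and a: "0 < a" "a < S T \<omega>"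
    then have "T \<in> time_set T" by (simp add: time_set_def)
    note S_T = bspec[OF elim(1) this, THEN conjunct1] bspec[OF elim(1) this, THEN conjunct2]
    have "a < (SUP s\<in>{0..T}. l s \<omega>)" using a S_T(1) by auto
    then obtain s where s: "s \<le> T" "a < l s \<omega>"
      using less_cSUP_iff[OF _ S_T(2)] by auto
    with elim(2) a have "s < T" by (cases "s = T") auto
    then have sT: "s \<in> time_set T" by (rule time_set_less)
    with elim(1) have "l s \<omega> \<le> (SUP s\<in>{0..s}. l s \<omega>)" "S s \<omega> = max (SUP s\<in>{0..s}. l s \<omega>) 0"
      by (auto intro!: cSUP_upper)
    with s \<open>s < T\<close> show "\<exists>t<T. a \<le> S t \<omega>" by (intro exI[of _ s]) auto
  qed
qed

text \<open>The supergradient inequality at the candidate, times the discount factor, with the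
  negative terms moved across so that all terms are nonnegative. The increment in the aggregate is
  \<open>C t \<omega> - S t \<omega>\<close>, as the others' share cancels.\<close>

lemma pointwise_optimality:
  assumes "0 < S t \<omega>" "0 < p\<^sub>x t \<omega>" "0 \<le> x (\<omega>, t)" "0 \<le> C t \<omega>"
  shows "discounted_utility x (\<lambda>z. C (snd z) (fst z) + others (snd z) (fst z)) (\<omega>, t) +
      lam * (p\<^sub>x t \<omega> * private_good (\<omega>, t)) + marginal (\<omega>, t) * S t \<omega> \<le>
    discounted_utility private_good (\<lambda>z. real n * S (snd z) (fst z)) (\<omega>, t) +
      lam * (p\<^sub>x t \<omega> * x (\<omega>, t)) + marginal (\<omega>, t) * C t \<omega>"
proof -
  define \<psi> c k e where "\<psi> = shadow_price (\<omega>, t)" and "c = real n * S t \<omega>"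
    and "k = private_good (\<omega>, t)" and "e = exp (- R t \<omega>)"
  have \<psi>: "0 < \<psi>" "e * \<psi> = lam * p\<^sub>x t \<omega>"
    using assms lam by (simp_all add: \<psi>_def e_def shadow_price_def exp_minus field_simps)
  have c: "0 < c" using assms(1) n by (simp add: c_def)
  have k: "k = g_inv u \<psi> c" by (simp add: k_def private_good_def \<psi>_def c_def)
  have kpos: "0 < k" unfolding k by (rule g_inv_pos[OF u \<psi>(1) c])
  have m: "marginal (\<omega>, t) = e * h_fun u \<psi> c"
    using \<psi>(1) c by (simp add: marginal_def \<psi>_def c_def e_def)
  have c': "0 \<le> C t \<omega> + (real n - 1) * S t \<omega>"
    using assms n by (intro add_nonneg_nonneg mult_nonneg_nonneg) auto
  have "u (x (\<omega>, t)) (C t \<omega> + (real n - 1) * S t \<omega>) \<le>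
      u k c + D\<^sub>x u k c * (x (\<omega>, t) - k) + D\<^sub>c u k c * (C t \<omega> + (real n - 1) * S t \<omega> - c)"
    by (rule utility_supergradient[OF u kpos c assms(3) c'])
  also have "D\<^sub>x u k c = \<psi>" unfolding k by (rule D\<^sub>x_g_inv[OF u \<psi>(1) c])
  also have "D\<^sub>c u k c = h_fun u \<psi> c" by (simp add: k h_fun_def)
  also have "C t \<omega> + (real n - 1) * S t \<omega> - c = C t \<omega> - S t \<omega>"
    by (simp add: c_def algebra_simps)
  finally have "e * u (x (\<omega>, t)) (C t \<omega> + (real n - 1) * S t \<omega>) \<le>
      e * (u k c + \<psi> * (x (\<omega>, t) - k) + h_fun u \<psi> c * (C t \<omega> - S t \<omega>))"
    by (intro mult_left_mono) (simp_all add: e_def)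
  also have "\<dots> = e * u k c + (e * \<psi>) * (x (\<omega>, t) - k) + (e * h_fun u \<psi> c) * (C t \<omega> - S t \<omega>)"
    by (simp add: algebra_simps)
  finally have "e * u (x (\<omega>, t)) (C t \<omega> + (real n - 1) * S t \<omega>) + lam * (p\<^sub>x t \<omega> * k) + marginal (\<omega>, t) * S t \<omega> \<le>
      e * u k c + lam * (p\<^sub>x t \<omega> * x (\<omega>, t)) + marginal (\<omega>, t) * C t \<omega>"
    unfolding \<psi>(2) m[symmetric] by (simp add: algebra_simps)
  moreover have "discounted_utility x (\<lambda>z. C (snd z) (fst z) + others (snd z) (fst z)) (\<omega>, t) =
      e * u (x (\<omega>, t)) (C t \<omega> + (real n - 1) * S t \<omega>)"
    using assms(3) c' by (simp add: discounted_utility_def e_def)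
  moreover have "discounted_utility private_good (\<lambda>z. real n * S (snd z) (fst z)) (\<omega>, t) = e * u k c"
    using kpos c by (simp add: discounted_utility_def e_def k_def c_def)
  ultimately show ?thesis by (simp add: k_def)
qed

text \<open>The benefit of \<open>S\<close> is bounded below and that of \<open>C\<close> above by
  \<lambda> times the respective price, so both can be replaced by prices in the integrated
  inequality without subtracting anything.\<close>

lemma integrated_optimality:
  assumes C: "adapted F T C" "\<And>\<omega>. \<omega> \<in> space M \<Longrightarrow> contribution_path T (\<lambda>t. C t \<omega>)"
    and x: "x \<in> borel_measurable (M \<Otimes>\<^sub>M time_borel T)" "AE \<omega> in M. \<forall>t\<in>time_set T. 0 \<le> x (\<omega>, t)"
  defines "W \<equiv> \<lambda>y C. (\<integral>\<^sup>+z. ennreal (p\<^sub>x (snd z) (fst z) * y z) \<partial>product_time) +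
      (\<integral>\<^sup>+\<omega>. \<integral>\<^sup>+a. contribution_price C a \<omega> \<partial>lborel \<partial>M)"
  shows "(\<integral>\<^sup>+z. ennreal (discounted_utility x (\<lambda>z. C (snd z) (fst z) + others (snd z) (fst z)) z) \<partial>product_time) +
      ennreal lam * W private_good S \<le>
    (\<integral>\<^sup>+z. ennreal (discounted_utility private_good (\<lambda>z. real n * S (snd z) (fst z)) z) \<partial>product_time) +
      ennreal lam * W x C"
proof -
  note [measurable] = x(1) jointly_measurable[OF C(1) contribution_path_right_continuous[OF C(2)]]
  define U\<^sub>1 where "U\<^sub>1 z = ennreal (discounted_utility x (\<lambda>z. C (snd z) (fst z) + others (snd z) (fst z)) z)" for z
  define U\<^sub>2 where "U\<^sub>2 z = ennreal (discounted_utility private_good (\<lambda>z. real n * S (snd z) (fst z)) z)" for z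
  define E where "E y z = ennreal (p\<^sub>x (snd z) (fst z) * y z)" for y :: "'a \<times> ennreal \<Rightarrow> real" and z
  define A where "A D z = ennreal (marginal z) * ennreal (D (snd z) (fst z))" for D :: "'a process" and z
  have U [measurable]: "U\<^sub>1 \<in> borel_measurable (M \<Otimes>\<^sub>M time_borel T)" "U\<^sub>2 \<in> borel_measurable (M \<Otimes>\<^sub>M time_borel T)"
    unfolding U\<^sub>1_def[abs_def] U\<^sub>2_def[abs_def]
    by (intro measurable_compose[OF measurable_discounted_utility measurable_ennreal]; measurable)+
  have E [measurable]: "E private_good \<in> borel_measurable (M \<Otimes>\<^sub>M time_borel T)"
      "E x \<in> borel_measurable (M \<Otimes>\<^sub>M time_borel T)"
    unfolding E_def[abs_def] by measurable
  have A [measurable]: "A S \<in> borel_measurable (M \<Otimes>\<^sub>M time_borel T)" "A C \<in> borel_measurable (M \<Otimes>\<^sub>M time_borel T)"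
    unfolding A_def[abs_def] by measurable
  let ?I = "\<lambda>f. \<integral>\<^sup>+z. f z \<partial>product_time"
  have add: "?I (\<lambda>z. U z + ennreal lam * B z + D z) = ?I U + ennreal lam * ?I B + ?I D"
    if "U \<in> borel_measurable (M \<Otimes>\<^sub>M time_borel T)" "B \<in> borel_measurable (M \<Otimes>\<^sub>M time_borel T)"
      "D \<in> borel_measurable (M \<Otimes>\<^sub>M time_borel T)" for U B D :: "'a \<times> ennreal \<Rightarrow> ennreal"
  proof -
    have m: "U \<in> borel_measurable product_time" "B \<in> borel_measurable product_time" "D \<in> borel_measurable product_time"
      using that by (simp_all only: measurable_product_time)
    then show ?thesis by (simp add: nn_integral_add nn_integral_cmult)
  qed
  have "?I U\<^sub>1 + ennreal lam * ?I (E private_good) + ?I (A S) = ?I (\<lambda>z. U\<^sub>1 z + ennreal lam * E private_good z + A S z)"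
    by (rule add[symmetric]) measurable
  also have "\<dots> = (\<integral>\<^sup>+\<omega>. \<integral>\<^sup>+t. U\<^sub>1 (\<omega>, t) + ennreal lam * E private_good (\<omega>, t) + A S (\<omega>, t) \<partial>dt T \<partial>M)"
    by (rule nn_integral_product_time[symmetric]) measurable
  also have "\<dots> \<le> (\<integral>\<^sup>+\<omega>. \<integral>\<^sup>+t. U\<^sub>2 (\<omega>, t) + ennreal lam * E x (\<omega>, t) + A C (\<omega>, t) \<partial>dt T \<partial>M)"
  proof (rule nn_integral_mono_AE)
    \<comment> \<open>The positivity requirement at the stopping time \<open>0\<close> makes
      \<open>S\<close> positive at almost every time, which puts the candidate inside the quadrant
      where derivatives exist.\<close>
    have "AE \<omega> in M. AE t in dt T. 0 \<le> t \<longrightarrow> 0 < (SUP s\<in>{0..t}. l s \<omega>)"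
      by (rule AE_sup_pos) (auto intro: stopping_time_const)
    then show "AE \<omega> in M. (\<integral>\<^sup>+t. U\<^sub>1 (\<omega>, t) + ennreal lam * E private_good (\<omega>, t) + A S (\<omega>, t) \<partial>dt T) \<le>
        (\<integral>\<^sup>+t. U\<^sub>2 (\<omega>, t) + ennreal lam * E x (\<omega>, t) + A C (\<omega>, t) \<partial>dt T)"
      using x(2) S_eq versions AE_space
    proof eventually_elim
      case \<omega>: (elim \<omega>)
      show ?case
      proof (rule nn_integral_mono_AE)
        show "AE t in dt T. U\<^sub>1 (\<omega>, t) + ennreal lam * E private_good (\<omega>, t) + A S (\<omega>, t) \<le>
            U\<^sub>2 (\<omega>, t) + ennreal lam * E x (\<omega>, t) + A C (\<omega>, t)"
          using \<omega>(1) AE_space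
        proof eventually_elim
          case (elim t)
          have t: "t \<in> time_set T" using elim(2) by simp
          have S_pos: "0 < S t \<omega>" using elim(1) \<omega>(3) t by (auto simp: less_max_iff_disj)
          have px: "0 < p\<^sub>x t \<omega>" using \<omega>(4) t by blast
          have xt: "0 \<le> x (\<omega>, t)" using \<omega>(2) t by blast
          have Ct: "0 \<le> C t \<omega>" using C(2)[OF \<omega>(5)] t by (simp add: contribution_path_def)
          have g: "0 \<le> private_good (\<omega>, t)" by (simp add: private_good_def g_inv_nonneg[OF u])
          have conv: "ennreal U + ennreal lam * ennreal (p\<^sub>x t \<omega> * y) + ennreal (marginal (\<omega>, t)) * ennreal d =
              ennreal (U + lam * (p\<^sub>x t \<omega> * y) + marginal (\<omega>, t) * d)" if "0 \<le> U" "0 \<le> y" "0 \<le> d" for U y d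
            using that px lam marginal_nonneg[of "(\<omega>, t)"] by (simp add: ennreal_plus ennreal_mult)
          show ?case
            unfolding U\<^sub>1_def U\<^sub>2_def E_def A_def fst_conv snd_conv
            unfolding conv[OF discounted_utility_nonneg g less_imp_le[OF S_pos]] conv[OF discounted_utility_nonneg xt Ct]
            by (intro ennreal_leI pointwise_optimality S_pos px xt Ct)
        qed
      qed
    qed
  qed
  also have "\<dots> = ?I (\<lambda>z. U\<^sub>2 z + ennreal lam * E x z + A C z)"
    by (rule nn_integral_product_time) measurable
  also have "\<dots> = ?I U\<^sub>2 + ennreal lam * ?I (E x) + ?I (A C)"
    by (rule add) measurable
  finally have main: "?I U\<^sub>1 + ennreal lam * ?I (E private_good) + ?I (A S) \<le> ?I U\<^sub>2 + ennreal lam * ?I (E x) + ?I (A C)" .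
  have A_S: "ennreal lam * (\<integral>\<^sup>+\<omega>. \<integral>\<^sup>+a. contribution_price S a \<omega> \<partial>lborel \<partial>M) \<le> ?I (A S)"
    using total_benefit_ge nn_integral_product_time[OF A(1)] by (simp add: A_def)
  have A_C: "?I (A C) \<le> ennreal lam * (\<integral>\<^sup>+\<omega>. \<integral>\<^sup>+a. contribution_price C a \<omega> \<partial>lborel \<partial>M)"
    using total_benefit_le[OF C] nn_integral_product_time[OF A(2)] by (simp add: A_def)
  have "?I U\<^sub>1 + ennreal lam * W private_good S =
      ?I U\<^sub>1 + ennreal lam * ?I (E private_good) + ennreal lam * (\<integral>\<^sup>+\<omega>. \<integral>\<^sup>+a. contribution_price S a \<omega> \<partial>lborel \<partial>M)"
    by (simp add: W_def E_def distrib_left add.assoc)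
  also have "\<dots> \<le> ?I U\<^sub>1 + ennreal lam * ?I (E private_good) + ?I (A S)"
    by (intro add_left_mono A_S)
  also note main
  also have "?I U\<^sub>2 + ennreal lam * ?I (E x) + ?I (A C) \<le>
      ?I U\<^sub>2 + ennreal lam * ?I (E x) + ennreal lam * (\<integral>\<^sup>+\<omega>. \<integral>\<^sup>+a. contribution_price C a \<omega> \<partial>lborel \<partial>M)"
    by (intro add_left_mono A_C)
  also have "\<dots> = ?I U\<^sub>2 + ennreal lam * W x C"
    by (simp add: W_def E_def distrib_left add.assoc)
  finally show ?thesis unfolding U\<^sub>1_def U\<^sub>2_def .
qed

text \<open>The candidate exhausts the budget \<open>w\<close> and the deviation costs at most
  \<open>w\<close>, so that both sides acquire the same term \<open>lam * w\<close>.\<close>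

theorem deviation_unprofitable:
  fixes w :: real
  assumes xC: "(x, C) \<in> budget M F T \<psi>\<^sub>x \<psi>\<^sub>c w"
    and xhat: "AE \<omega> in M. \<forall>t\<in>time_set T. xhat t \<omega> = private_good (\<omega>, t)"
    and Chat: "AE \<omega> in M. \<forall>t. Chat t \<omega> = S t \<omega>"
    and C': "AE \<omega> in M. \<forall>t\<in>time_set T. C' t \<omega> = others t \<omega>"
    and cost: "cost M T \<psi>\<^sub>x \<psi>\<^sub>c xhat Chat = ennreal w"
  shows "payoff M T r u x C C' \<le> payoff M T r u xhat Chat C'"
proof -
  have b: "optional M F T x" "optional M F T C" "cost M T \<psi>\<^sub>x \<psi>\<^sub>c x C \<le> ennreal w"
    "AE \<omega> in M. \<forall>t\<in>time_set T. 0 \<le> x t \<omega> \<and> 0 \<le> C t \<omega>"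
    "AE \<omega> in M. right_continuous_path T (\<lambda>t. C t \<omega>) \<and> mono_on (time_set T) (\<lambda>t. C t \<omega>)"
    using xC unfolding budget_def by blast+
  obtain X where X: "(\<lambda>(\<omega>, t). X t \<omega>) \<in> borel_measurable (optional_sigma M F T)"
    "AE \<omega> in M. \<forall>t\<in>time_set T. x t \<omega> = X t \<omega>"
    using b(1) unfolding optional_def by blast
  define y where "y z = X (snd z) (fst z)" for z
  have y: "y \<in> borel_measurable (M \<Otimes>\<^sub>M time_borel T)"
    using optional_jointly_measurable[OF X(1)] by (simp add: y_def[abs_def] case_prod_beta)
  have y_eq: "AE \<omega> in M. \<forall>t\<in>time_set T. x t \<omega> = y (\<omega>, t)"
    using X(2) by (simp add: y_def)
  have y_nonneg: "AE \<omega> in M. \<forall>t\<in>time_set T. 0 \<le> y (\<omega>, t)"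
    using y_eq b(4) by eventually_elim (metis)
  have path: "AE \<omega> in M. contribution_path T (\<lambda>t. C t \<omega>)"
    using b(4,5) by eventually_elim (auto simp: contribution_path_def)
  have "contribution_path T (\<lambda>_. 0)"
    by (simp add: contribution_path_def right_continuous_path_0 mono_on_def)
  from regular_version[OF optional_adapted[OF b(2)] path this]
  obtain D where D: "adapted F T D" "\<And>\<omega>. \<omega> \<in> space M \<Longrightarrow> contribution_path T (\<lambda>t. D t \<omega>)"
    "AE \<omega> in M. \<forall>t. C t \<omega> = D t \<omega>"
    by blast
  note [measurable] = jointly_measurable[OF D(1) contribution_path_right_continuous[OF D(2)]]
  have S_nonneg: "0 \<le> S t \<omega>" if "t \<in> time_set T" "\<omega> \<in> space M" for t \<omega>
    using S(2)[OF that(2)] that(1) by (simp add: contribution_path_def)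
  let ?c = "\<lambda>z. D (snd z) (fst z) + others (snd z) (fst z)"
  have dev: "payoff M T r u x C C' = (\<integral>\<^sup>+z. ennreal (discounted_utility y ?c z) \<partial>product_time)"
  proof (rule payoff_version)
    show "AE \<omega> in M. \<forall>t\<in>time_set T. x t \<omega> = y (\<omega>, t) \<and> C t \<omega> + C' t \<omega> = ?c (\<omega>, t) \<and>
        0 \<le> y (\<omega>, t) \<and> 0 \<le> ?c (\<omega>, t)"
      using y_eq y_nonneg D(3) C' AE_space
    proof eventually_elim
      case (elim \<omega>)
      have "0 \<le> ?c (\<omega>, t)" if "t \<in> time_set T" for t
        using D(2)[OF elim(5)] S_nonneg[OF that elim(5)] that n by (simp add: contribution_path_def)
      then show ?case using elim by simp
    qed
    show "?c \<in> borel_measurable (M \<Otimes>\<^sub>M time_borel T)" by measurable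
  qed (rule y)
  let ?c' = "\<lambda>z. real n * S (snd z) (fst z)"
  have hat: "payoff M T r u xhat Chat C' = (\<integral>\<^sup>+z. ennreal (discounted_utility private_good ?c' z) \<partial>product_time)"
  proof (rule payoff_version)
    show "AE \<omega> in M. \<forall>t\<in>time_set T. xhat t \<omega> = private_good (\<omega>, t) \<and> Chat t \<omega> + C' t \<omega> = ?c' (\<omega>, t) \<and>
        0 \<le> private_good (\<omega>, t) \<and> 0 \<le> ?c' (\<omega>, t)"
      using xhat Chat C' AE_space
    proof eventually_elim
      case (elim \<omega>)
      then show ?case
        using S_nonneg by (auto simp: private_good_def g_inv_nonneg[OF u] algebra_simps)
    qed
    show "?c' \<in> borel_measurable (M \<Otimes>\<^sub>M time_borel T)" by measurable
  qed (rule measurable_private_good)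
  have "payoff M T r u x C C' + ennreal lam * ennreal w \<le> payoff M T r u xhat Chat C' + ennreal lam * ennreal w"
  proof -
    have "payoff M T r u x C C' + ennreal lam * cost M T \<psi>\<^sub>x \<psi>\<^sub>c xhat Chat \<le>
        payoff M T r u xhat Chat C' + ennreal lam * cost M T \<psi>\<^sub>x \<psi>\<^sub>c x C"
    proof -
      let ?W = "\<lambda>y C. (\<integral>\<^sup>+z. ennreal (p\<^sub>x (snd z) (fst z) * y z) \<partial>product_time) +
        (\<integral>\<^sup>+\<omega>. \<integral>\<^sup>+a. contribution_price C a \<omega> \<partial>lborel \<partial>M)"
      have "cost M T \<psi>\<^sub>x \<psi>\<^sub>c xhat Chat = ?W private_good S"
        by (rule cost_version(2)[OF S measurable_private_good xhat Chat no_terminal_jump])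
      then have "payoff M T r u x C C' + ennreal lam * cost M T \<psi>\<^sub>x \<psi>\<^sub>c xhat Chat =
          payoff M T r u x C C' + ennreal lam * ?W private_good S"
        by (simp only:)
      also have "\<dots> \<le> payoff M T r u xhat Chat C' + ennreal lam * ?W y D"
        unfolding dev hat by (rule integrated_optimality[OF D(1,2) y y_nonneg])
      also have "?W y D \<le> cost M T \<psi>\<^sub>x \<psi>\<^sub>c x C"
        by (rule cost_version(1)[OF D(1,2) y y_eq D(3)])
      finally show ?thesis by (simp add: add_left_mono mult_left_mono)
    qed
    also have "\<dots> \<le> payoff M T r u xhat Chat C' + ennreal lam * ennreal w"
      using b(3) by (intro add_left_mono mult_left_mono) auto
    finally show ?thesis by (simp only: cost)
  qed
  \<comment> \<open>The only cancellation in the argument: the budget term is finite, whereas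
    payoffs need not be known to be.\<close>
  moreover have "ennreal lam * ennreal w \<noteq> \<infinity>"
    by (simp add: ennreal_mult_eq_top_iff)
  ultimately show ?thesis
    by (simp add: add.commute[of _ "ennreal lam * ennreal w"] ennreal_add_left_cancel_le)
qed

end

section \<open>The symmetric profile of candidates as an equilibrium\<close>

theorem theorem4p4:
  fixes M :: "'a measure" and F :: "ennreal \<Rightarrow> 'a measure" and T :: ennreal
    and \<psi>\<^sub>x \<psi>\<^sub>c r :: "'a process"
    and n :: nat and w lam :: real
    and u :: "real \<Rightarrow> real \<Rightarrow> real"
    and l :: "'a process"
    and xhat Chat :: "nat \<Rightarrow> 'a process"
  assumes "usual_filtered_space M F T"
    and "1 < n" and "0 < w / real n"
    and "assumption_P M F T \<psi>\<^sub>x \<psi>\<^sub>c r"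
    and "assumption_U M F T \<psi>\<^sub>x \<psi>\<^sub>c r n (\<lambda>_. w / real n) (\<lambda>_. u)"
    and "0 < lam"
    and "optional M F T l"
    and "upper_right_continuous M T l"
    and "AE \<omega> in M. \<forall>t\<in>time_set T. bdd_above ((\<lambda>s. l s \<omega>) ` {0..t})"
    and "AE \<omega> in M. l T \<omega> = 0"
    and "solves_backward_equation M F T \<psi>\<^sub>x \<psi>\<^sub>c r n u lam l"
    and Chat: "\<And>i t \<omega>. Chat i t \<omega> = max (SUP s\<in>{0..t}. l s \<omega>) 0"
    and xhat: "\<And>i t \<omega>. xhat i t \<omega> =
                 g_inv u (lam * exp (cum r t \<omega>) * \<psi>\<^sub>x t \<omega>) (\<Sum>j<n. Chat j t \<omega>)"
    and "\<And>i. i < n \<Longrightarrow> cost M T \<psi>\<^sub>x \<psi>\<^sub>c (xhat i) (Chat i) = ennreal (w / real n)"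
  shows "nash_equilibrium M F T \<psi>\<^sub>x \<psi>\<^sub>c r n (\<lambda>_. w / real n) (\<lambda>_. u) xhat Chat"
proof -
  interpret usual_filtered_space M F T by fact
  have u: "utility_function u"
    using assms(2,5) unfolding assumption_U_def by auto
  have P: "price_process M F T \<psi>\<^sub>c" "price_process M F T \<psi>\<^sub>x"
    and r: "optional M F T r" "strictly_positive_bounded M T r"
    using assms(4) unfolding assumption_P_def by blast+
  have \<psi>: "adapted F T \<psi>" "AE \<omega> in M. right_continuous_path T (\<lambda>t. \<psi> t \<omega>)"
      "AE \<omega> in M. \<forall>t\<in>time_set T. 0 < \<psi> t \<omega>" if "price_process M F T \<psi>" for \<psi>
    using that unfolding price_process_def by blast+
  define S\<^sub>0 where "S\<^sub>0 t \<omega> = max (SUP s\<in>{0..t}. l s \<omega>) 0" for t \<omega>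
  have Chat_eq: "Chat i = S\<^sub>0" for i
    by (simp add: fun_eq_iff Chat S\<^sub>0_def)
  have xhat_eq: "xhat i = (\<lambda>t \<omega>. g_inv u (lam * exp (cum r t \<omega>) * \<psi>\<^sub>x t \<omega>) (real n * S\<^sub>0 t \<omega>))" for i
    by (simp add: fun_eq_iff xhat Chat_eq)
  have S\<^sub>0: "adapted F T S\<^sub>0"
    using running_sup_adapted[OF assms(7,9)] by (simp add: S\<^sub>0_def[abs_def])
  have path: "AE \<omega> in M. contribution_path T (\<lambda>t. S\<^sub>0 t \<omega>)"
    using assms(8)[unfolded upper_right_continuous_def] assms(9)
    by eventually_elim (simp add: S\<^sub>0_def running_sup_contribution_path)
  then have S\<^sub>0_rc: "AE \<omega> in M. right_continuous_path T (\<lambda>t. S\<^sub>0 t \<omega>)"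
    by eventually_elim (simp add: contribution_path_def)
  have in_budget: "(xhat i, Chat i) \<in> budget M F T \<psi>\<^sub>x \<psi>\<^sub>c (w / real n)" if "i < n" for i
  proof -
    have "optional M F T (xhat i)"
      unfolding xhat_eq by (intro private_good_optional u r \<psi>(1,2)[OF P(2)] S\<^sub>0 S\<^sub>0_rc)
    moreover have "optional M F T (Chat i)"
      unfolding Chat_eq by (rule right_continuous_optional[OF S\<^sub>0 S\<^sub>0_rc])
    moreover have "0 \<le> xhat i t \<omega>" "0 \<le> Chat i t \<omega>" for t \<omega>
      by (simp_all add: xhat g_inv_nonneg[OF u] Chat)
    moreover have "AE \<omega> in M. right_continuous_path T (\<lambda>t. Chat i t \<omega>) \<and> mono_on (time_set T) (\<lambda>t. Chat i t \<omega>)"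
      using path unfolding Chat_eq by eventually_elim (simp add: contribution_path_def)
    ultimately show ?thesis
      using assms(14)[OF that] by (simp add: budget_def)
  qed
  have zero: "contribution_path T (\<lambda>_. 0)"
    by (simp add: contribution_path_def right_continuous_path_0 mono_on_def)
  obtain S where S: "adapted F T S" "\<And>\<omega>. \<omega> \<in> space M \<Longrightarrow> contribution_path T (\<lambda>t. S t \<omega>)"
    "AE \<omega> in M. \<forall>t. S\<^sub>0 t \<omega> = S t \<omega>"
    using regular_version[OF S\<^sub>0 path zero] by blast
  obtain R where R: "adapted F T R" "\<And>\<omega>. \<omega> \<in> space M \<Longrightarrow> right_continuous_path T (\<lambda>t. R t \<omega>)"
    "AE \<omega> in M. \<forall>t\<in>time_set T. cum r t \<omega> = R t \<omega>"
    using discount_version[OF r] by blast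
  obtain p\<^sub>x where p\<^sub>x: "adapted F T p\<^sub>x" "\<And>\<omega>. \<omega> \<in> space M \<Longrightarrow> right_continuous_path T (\<lambda>t. p\<^sub>x t \<omega>)"
    "AE \<omega> in M. \<forall>t. \<psi>\<^sub>x t \<omega> = p\<^sub>x t \<omega>"
    using regular_version[OF \<psi>(1,2)[OF P(2)] right_continuous_path_0] by blast
  obtain p\<^sub>c where p\<^sub>c: "adapted F T p\<^sub>c" "\<And>\<omega>. \<omega> \<in> space M \<Longrightarrow> right_continuous_path T (\<lambda>t. p\<^sub>c t \<omega>)"
    "AE \<omega> in M. \<forall>t. \<psi>\<^sub>c t \<omega> = p\<^sub>c t \<omega>"
    using regular_version[OF \<psi>(1,2)[OF P(1)] right_continuous_path_0] by blast
  note candidate_versions = R(3) p\<^sub>x(3) S(3)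
  interpret regular_candidate M F T \<psi>\<^sub>x \<psi>\<^sub>c r n u lam l S R p\<^sub>x p\<^sub>c
  proof unfold_locales
    show "AE \<omega> in M. \<forall>t\<in>time_set T. cum r t \<omega> = R t \<omega> \<and> \<psi>\<^sub>x t \<omega> = p\<^sub>x t \<omega> \<and> \<psi>\<^sub>c t \<omega> = p\<^sub>c t \<omega> \<and>
        0 < p\<^sub>x t \<omega> \<and> 0 < p\<^sub>c t \<omega>"
      using R(3) p\<^sub>x(3) p\<^sub>c(3) \<psi>(3)[OF P(1)] \<psi>(3)[OF P(2)] by eventually_elim auto
    show "AE \<omega> in M. \<forall>t\<in>time_set T. S t \<omega> = max (SUP s\<in>{0..t}. l s \<omega>) 0 \<and>
        bdd_above ((\<lambda>s. l s \<omega>) ` {0..t})"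
      using S(3) assms(9) by eventually_elim (simp add: S\<^sub>0_def)
  qed (use u assms(2,6,10,11) S R p\<^sub>x p\<^sub>c in auto)
  show ?thesis
    unfolding nash_equilibrium_def Let_def
  proof (intro allI impI conjI in_budget)
    fix i assume i: "i < n"
    define C' where "C' t \<omega> = (\<Sum>j\<in>{..<n} - {i}. Chat j t \<omega>)" for t \<omega>
    have C'_eq: "C' t \<omega> = (real n - 1) * S\<^sub>0 t \<omega>" for t \<omega>
      using i by (simp add: C'_def Chat_eq of_nat_diff)
    have "payoff M T r u x C C' \<le> payoff M T r u (xhat i) (Chat i) C'"
      if "(x, C) \<in> budget M F T \<psi>\<^sub>x \<psi>\<^sub>c (w / real n)" for x C
      using that
    proof (rule deviation_unprofitable)
      show "AE \<omega> in M. \<forall>t\<in>time_set T. xhat i t \<omega> = private_good (\<omega>, t)"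
        using candidate_versions by eventually_elim (simp add: xhat_eq private_good_def shadow_price_def)
      show "AE \<omega> in M. \<forall>t. Chat i t \<omega> = S t \<omega>"
        using candidate_versions(3) by (simp add: Chat_eq)
      show "AE \<omega> in M. \<forall>t\<in>time_set T. C' t \<omega> = (real n - 1) * S t \<omega>"
        using candidate_versions(3) by eventually_elim (simp add: C'_eq)
    qed (rule assms(14)[OF i])
    \<comment> \<open>The candidate is itself admissible, so the supremum over the budget set is
      attained at it.\<close>
    then have "best_payoff M F T \<psi>\<^sub>x \<psi>\<^sub>c r (w / real n) u C' = payoff M T r u (xhat i) (Chat i) C'"
      unfolding best_payoff_def using in_budget[OF i]
      by (intro antisym SUP_least SUP_upper2[of "(xhat i, Chat i)"]) auto
    then show "payoff M T r u (xhat i) (Chat i) (\<lambda>t \<omega>. \<Sum>j\<in>{..<n} - {i}. Chat j t \<omega>) =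
        best_payoff M F T \<psi>\<^sub>x \<psi>\<^sub>c r (w / real n) u (\<lambda>t \<omega>. \<Sum>j\<in>{..<n} - {i}. Chat j t \<omega>)"
      by (simp add: C'_def[abs_def])
  qed
qed

end
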